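(* Let $\beta,\gamma,\Sigma,(w_n)_n,w,p(n),\kappa,Q_n,Z_n,\Lambda_n,L_n$ be as in the context, so that $p(n)\to\infty$, $p(n)/n\to\kappa\in(0,\infty)$ and assumptions (a1) and (a2) stated there hold. Then the sequence $\left(\mathbb{P}\circ (L_n\circ\Lambda_n)^{-1}\right)_n=\left(Q_n\circ L_n^{-1}\right)_n$ of probability measures on $\mathcal{M}_1(\Sigma)$ satisfies a large deviation principle on $\mathcal{M}_1(\Sigma)$ with respect to the weak topology, with speed $n^2$ and good rate function $$I(\mu)=\frac{\beta}{2}\kappa^2\int\int \log|x^\gamma-y^\gamma|^{-1}\,\mu(dx)\,\mu(dy)-\kappa\int\log w(x)\,\mu(dx)+c,\qquad \mu\in\mathcal{M}_1(\Sigma),$$ where the limit $$c:=\lim_{n\to\infty}\frac{1}{n^2}\log Z_n$$ exists and satisfies $c<\infty$.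
   Context: Setting. Let $\beta>0$ and $\gamma\in\mathbb{N}=\{1,2,\dots\}$. Let $\Sigma$ be a closed subinterval of $\mathbb{R}$ if $\gamma$ is odd, and a closed subinterval of $[0,\infty)$ if $\gamma$ is even. Let $(w_n)_{n\in\mathbb{N}}$ be a family of continuous nonnegative real-valued functions on $\Sigma$. Let $p(n)$ be positive integers with $p(n)\to\infty$ and $\lim_{n\to\infty}p(n)/n=\kappa\in(0,\infty)$. For each $n$ let $\Lambda_n=(\lambda_1,\dots,\lambda_{p(n)})$ be a random vector whose distribution $Q_n=\mathbb{P}\circ\Lambda_n^{-1}\in\mathcal{M}_1(\Sigma^{p(n)})$ has Lebesgue density $$q_n(x_1,\dots,x_{p(n)})=\frac{1}{Z_n}\prod_{1\le i<j\le p(n)}|x_i^\gamma-x_j^\gamma|^\beta\prod_{j=1}^{p(n)}w_n(x_j)^n\,1_{\Sigma^{p(n)}}(x_1,\dots,x_{p(n)}),$$ where $Z_n$ is the normalizing constant. For $x=(x_1,\dots,x_{p(n)})\in\Sigma^{p(n)}$ put $L_n(x):=\frac{1}{p(n)}\sum_{j=1}^{p(n)}\delta_{x_j}$. Here $\mathcal{M}_1(X)$ denotes the space of Borel probability measures on $X$, with the weak topology, $a\vee b=\max(a,b)$, and $\mathcal{N}(f)$ denotes the set of zeros of a function $f$. The convention $\log 0=-\infty$ is used. Assumptions. (a1) There exists a continuous function $w:\Sigma\to[0,\infty)$ such that: $\#\mathcal{N}(w)<\infty$ and $\mathcal{N}(w_n)\subseteq\mathcal{N}(w)$ for large $n$;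 as $n\to\infty$, $w_n\to w$ and $\log w_n\to\log w$ uniformly on compact sets; $\log w$ is Lipschitz on compact sets away from $\mathcal{N}(w)$. (a2) If $\Sigma$ is unbounded, then there exist $n_0\in\mathbb{N}$ and a fixed $\epsilon>0$ such that $\lim_{x\to\pm\infty}|x|^{\gamma\kappa(\beta\vee1)+\epsilon}\sup_{n\ge n_0}w_n(x)=0$ (limit taken along $x\in\Sigma$). Interpretation of $I$. The sum of the two integral terms in $I(\mu)$ is understood as $\int\int F(x,y)\,\mu(dx)\mu(dy)\in(-\infty,\infty]$, where $F(x,y)=-\frac{\beta}{2}\kappa^2\log|x^\gamma-y^\gamma|-\frac{\kappa}{2}(\log w(x)+\log w(y))$, with $F(x,y)=\infty$ if $x^\gamma=y^\gamma$ or $\{x,y\}\cap\mathcal{N}(w)\ne\emptyset$; $F$ is bounded from below. Large deviation principle. A sequence $(\mu_n)_n$ of probability measures on a topological space $X$ satisfies an LDP with speed $n^2$ and good rate function $I:X\to[0,\infty]$ if $I$ is lower semicontinuous with compact level sets $\{x: I(x)\le L\}$ for all $L\in[0,\infty)$, and $\liminf_{n\to\infty}\frac{1}{n^2}\log\mu_n(G)\ge-\inf_{x\in G}I(x)$ for all open $G\subseteq X$, and $\limsup_{n\to\infty}\frac{1}{n^2}\log\mu_n(A)\le-\inf_{x\in A}I(x)$ for all closed $A\subseteq X$. *)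

theory Defs
  imports "HOL-Probability.Probability"
begin

section \<open>Large deviation principles\<close>

definition ln_ext :: "real \<Rightarrow> ereal" where
  "ln_ext x = (if x \<le> 0 then - \<infinity> else ereal (ln x))"

definition borel_of :: "'a topology \<Rightarrow> 'a measure" where
  "borel_of X = sigma (topspace X) {U. openin X U}"

definition good_rate_function :: "'a topology \<Rightarrow> ('a \<Rightarrow> ereal) \<Rightarrow> bool" where
  "good_rate_function X I \<longleftrightarrow>
     (\<forall>x\<in>topspace X. 0 \<le> I x) \<and>
     (\<forall>a::ereal. openin X {x \<in> topspace X. a < I x}) \<and>
     (\<forall>L::real. 0 \<le> L \<longrightarrow> compactin X {x \<in> topspace X. I x \<le> ereal L})"

text \<open>Sequences are indexed by the positive integers; the value at \<open>n = 0\<close> is irrelevant.\<close>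

definition large_deviation_principle ::
    "'a topology \<Rightarrow> (nat \<Rightarrow> 'a measure) \<Rightarrow> (nat \<Rightarrow> real) \<Rightarrow> ('a \<Rightarrow> ereal) \<Rightarrow> bool" where
  "large_deviation_principle X \<mu> s I \<longleftrightarrow>
     (\<forall>n\<ge>1. prob_space (\<mu> n) \<and> sets (\<mu> n) = sets (borel_of X)) \<and>
     good_rate_function X I \<and>
     (\<forall>G. openin X G \<longrightarrow>
        - (INF x\<in>G. I x) \<le> liminf (\<lambda>n. ereal (1 / s n) * ln_ext (measure (\<mu> n) G))) \<and>
     (\<forall>A. closedin X A \<longrightarrow>
        limsup (\<lambda>n. ereal (1 / s n) * ln_ext (measure (\<mu> n) A)) \<le> - (INF x\<in>A. I x))"

section \<open>Probability measures on a set with the weak topology\<close>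

definition borel_prob_measures :: "'a::topological_space set \<Rightarrow> 'a measure set" where
  "borel_prob_measures S = {\<mu>. prob_space \<mu> \<and> sets \<mu> = sets (restrict_space borel S)}"

text \<open>The coarsest topology making \<open>\<mu> \<mapsto> \<integral>f d\<mu>\<close> continuous for all bounded continuous
  \<open>f : S \<rightarrow> \<real>\<close>. Its underlying space is \<open>borel_prob_measures S\<close> (take \<open>U = UNIV\<close>).\<close>

definition weak_topology :: "'a::topological_space set \<Rightarrow> 'a measure topology" where
  "weak_topology S = topology_generated_by
     {{\<mu> \<in> borel_prob_measures S. (\<integral>x. f x \<partial>\<mu>) \<in> U} | (f :: 'a \<Rightarrow> real) U.
        continuous_on S f \<and> bounded (f ` S) \<and> open U}"

definition empirical_measure ::
    "'a::topological_space set \<Rightarrow> nat \<Rightarrow> (nat \<Rightarrow> 'a) \<Rightarrow> 'a measure" where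
  "empirical_measure S m x = measure_of S (sets (restrict_space borel S))
     (\<lambda>A. (\<Sum>j=1..m. emeasure (return (restrict_space borel S) (x j)) A) / of_nat m)"

section \<open>The ensembles and the rate function\<close>

text \<open>Vectors with \<open>m\<close> components are extensional functions on \<open>{1..m}\<close>.\<close>

definition ensemble_weight ::
    "real \<Rightarrow> nat \<Rightarrow> real set \<Rightarrow> (real \<Rightarrow> real) \<Rightarrow> nat \<Rightarrow> nat \<Rightarrow> (nat \<Rightarrow> real) \<Rightarrow> real" where
  "ensemble_weight \<beta> \<gamma> S v n m x =
     (\<Prod>(i, j)\<in>{(i, j). 1 \<le> i \<and> i < j \<and> j \<le> m}. \<bar>x i ^ \<gamma> - x j ^ \<gamma>\<bar> powr \<beta>) *
     (\<Prod>j=1..m. v (x j) ^ n) * indicator (PiE {1..m} (\<lambda>_. S)) x"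

definition ensemble_Z ::
    "real \<Rightarrow> nat \<Rightarrow> real set \<Rightarrow> (real \<Rightarrow> real) \<Rightarrow> nat \<Rightarrow> nat \<Rightarrow> real" where
  "ensemble_Z \<beta> \<gamma> S v n m =
     (\<integral>x. ensemble_weight \<beta> \<gamma> S v n m x \<partial>(\<Pi>\<^sub>M j\<in>{1..m}. lborel))"

definition ensemble_density ::
    "real \<Rightarrow> nat \<Rightarrow> real set \<Rightarrow> (real \<Rightarrow> real) \<Rightarrow> nat \<Rightarrow> nat \<Rightarrow> (nat \<Rightarrow> real) \<Rightarrow> real" where
  "ensemble_density \<beta> \<gamma> S v n m x =
     1 / ensemble_Z \<beta> \<gamma> S v n m * ensemble_weight \<beta> \<gamma> S v n m x"

definition zero_set :: "real set \<Rightarrow> (real \<Rightarrow> real) \<Rightarrow> real set" where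
  "zero_set S f = {x \<in> S. f x = 0}"

text \<open>Integral of an extended real function as \<open>\<integral>f\<^sup>+ - \<integral>f\<^sup>-\<close>; note that \<open>e2ennreal\<close> maps negative
  numbers to \<open>0\<close>. It is meaningful whenever one of the two parts is finite.\<close>

definition ereal_integral :: "'a measure \<Rightarrow> ('a \<Rightarrow> ereal) \<Rightarrow> ereal" where
  "ereal_integral M f =
     enn2ereal (\<integral>\<^sup>+x. e2ennreal (f x) \<partial>M) - enn2ereal (\<integral>\<^sup>+x. e2ennreal (- f x) \<partial>M)"

definition energy_kernel ::
    "real \<Rightarrow> nat \<Rightarrow> real set \<Rightarrow> real \<Rightarrow> (real \<Rightarrow> real) \<Rightarrow> real \<Rightarrow> real \<Rightarrow> ereal" where
  "energy_kernel \<beta> \<gamma> S \<kappa> w x y =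
     (if x ^ \<gamma> = y ^ \<gamma> \<or> {x, y} \<inter> zero_set S w \<noteq> {} then \<infinity>
      else ereal (- (\<beta> / 2) * \<kappa>\<^sup>2 * ln \<bar>x ^ \<gamma> - y ^ \<gamma>\<bar> - \<kappa> / 2 * (ln (w x) + ln (w y))))"

text \<open>The formal expression
  \<open>\<beta>/2 \<kappa>\<^sup>2 \<integral>\<integral>log |x\<^sup>\<gamma> - y\<^sup>\<gamma>|\<^sup>-\<^sup>1 \<mu>(dx) \<mu>(dy) - \<kappa> \<integral>log w d\<mu> + c\<close>, where the first two terms are read jointly
  as the double integral of the kernel (which, in the intended setting, is bounded from below).\<close>

definition rate_function ::
    "real \<Rightarrow> nat \<Rightarrow> real set \<Rightarrow> real \<Rightarrow> (real \<Rightarrow> real) \<Rightarrow> ereal \<Rightarrow> real measure \<Rightarrow> ereal" where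
  "rate_function \<beta> \<gamma> S \<kappa> w c \<mu> =
     ereal_integral (\<mu> \<Otimes>\<^sub>M \<mu>) (\<lambda>(x, y). energy_kernel \<beta> \<gamma> S \<kappa> w x y) + c"

end

theory Submission
  imports Defs
begin

text \<open>
  Put \<open>E x y = |x\<^sup>\<gamma> - y\<^sup>\<gamma>|\<close> to the power \<open>\<beta> \<kappa>\<^sup>2 / 2\<close> times \<open>w x * w y\<close> to the power \<open>\<kappa> / 2\<close>.
  The rate function is \<open>J + c\<close>, where \<open>J \<mu>\<close> is the double integral of \<open>- ln E\<close> against \<open>\<mu>\<close>. Up to
  diagonal terms the logarithm of the unnormalized density at \<open>x\<close> is a double sum over the points of \<open>x\<close>,
  and since \<open>p n / n \<rightarrow> \<kappa>\<close> and \<open>wn n \<rightarrow> w\<close> it is close to \<open>- n\<^sup>2 J\<close> evaluated at the empirical measure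
  of \<open>x\<close>. Everything is proved for the \<^emph>\<open>mass\<close> of a set \<open>G\<close> of measures, the integral of the
  unnormalized density over the vectors whose empirical measure lies in \<open>G\<close>. The mass of a closed set \<open>A\<close>
  is at most \<open>exp (- a n\<^sup>2)\<close> eventually whenever \<open>J\<close> exceeds some \<open>a' > a\<close> on \<open>A\<close>
  (\<open>empirical_mass_upper\<close>), and the mass of an open set is at least \<open>exp (- a n\<^sup>2)\<close> eventually whenever it
  contains a measure with \<open>J \<mu> < a\<close> (\<open>empirical_mass_lower\<close>). Applied to the set of all measures the two bounds
  give \<open>n\<^sup>-\<^sup>2 ln Z\<^sub>n \<rightarrow> - inf J\<close>, which is finite, and division by \<open>Z\<^sub>n\<close> gives the large deviation
  principle (\<open>large_deviation_principle_of_mass\<close>).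

  For the upper bound \<open>E\<close> is replaced by \<open>max (exp (- M)) E\<close>. The truncated kernel is bounded and continuous,
  so the truncated energies are weakly continuous, and they increase to \<open>J\<close> as \<open>M\<close> grows. By the decay
  of the weights \<open>E\<close> tends to \<open>0\<close> at infinity, so measures that put mass far out have large truncated energy.
  Hence a sequence of measures whose energies, truncated at growing levels, stay bounded is tight and
  accumulates at a measure of finite energy. This makes the sublevel sets of \<open>J\<close> compact and turns a
  lower bound for \<open>J\<close> on a closed set into one for a single truncated energy
  (\<open>cutoff_energy_uniform_on_closed\<close>). The density is bounded pointwise by the exponential of the
  truncated energy, after a fixed number of the \<open>n\<close> factors \<open>wn n\<close> at each point is set aside to keep the
  remaining integral finite.

  For the lower bound let first \<open>\<nu>\<close> have a bounded density and a compact support that avoids the zeros of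
  \<open>w\<close>. Under independent sampling from \<open>\<nu>\<close> the empirical measure is close to \<open>\<nu>\<close>
  (\<open>weak_law_of_large_numbers\<close>) and the logarithm of the density has expectation about \<open>- n\<^sup>2 J \<nu>\<close>; a
  Jensen type inequality (\<open>tilted_lower_bound\<close>) bounds the mass from below, and passing from \<open>\<nu>\<close> to
  Lebesgue measure costs only a factor exponential in \<open>p n\<close>. A general measure of finite energy has no atoms, so
  it can be restricted to a compact set that avoids the boundary of the interval, \<open>0\<close> and the zeros of \<open>w\<close>
  (\<open>restriction_to_regular_compact\<close>), and then convolved with a small uniform noise
  (\<open>smoothing_approximates\<close>). The energy does not increase in the limit: on such a compact set the kernel
  is a multiple of \<open>- ln |x - y|\<close> up to a bounded term, and averages of this singularity over the noise are dominated
  by the singularity itself plus a constant.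
\<close>

section \<open>The weak topology on the probability measures of a closed interval\<close>

lemma topspace_weak_topology [simp]: "topspace (weak_topology S) = borel_prob_measures S"
proof -
  have "borel_prob_measures S \<in> {{\<mu> \<in> borel_prob_measures S. (\<integral>x. f x \<partial>\<mu>) \<in> U} | (f :: 'a \<Rightarrow> real) U.
        continuous_on S f \<and> bounded (f ` S) \<and> open U}"
    by (rule CollectI, rule exI[of _ "\<lambda>_. 0"], rule exI[of _ UNIV]) (auto simp: image_constant_conv)
  then show ?thesis
    unfolding weak_topology_def topology_generated_by_topspace by auto
qed

lemma continuous_map_integral_weak_topology:
  fixes f :: "'a::topological_space \<Rightarrow> real"
  assumes "continuous_on S f" "bounded (f ` S)"
  shows "continuous_map (weak_topology S) euclideanreal (\<lambda>\<mu>. \<integral>x. f x \<partial>\<mu>)"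
proof -
  have "openin (weak_topology S) {\<mu> \<in> borel_prob_measures S. (\<integral>x. f x \<partial>\<mu>) \<in> U}" if "open U" for U
    unfolding weak_topology_def using assms that by (intro topology_generated_by_Basis) blast
  then show ?thesis
    by (auto simp: continuous_map_def)
qed

text \<open>Neighbourhoods are built from the defining subbase by finite intersections and unions, and both
  operations preserve the property of containing almost all members of a sequence.\<close>

lemma limitin_weak_topologyI:
  fixes S :: "'a::topological_space set"
  assumes \<mu>: "\<mu> \<in> borel_prob_measures S" and \<sigma>: "\<And>n. \<sigma> n \<in> borel_prob_measures S"
    and conv: "\<And>f :: 'a \<Rightarrow> real. continuous_on S f \<Longrightarrow> bounded (f ` S) \<Longrightarrow>
      (\<lambda>n. \<integral>x. f x \<partial>\<sigma> n) \<longlonglongrightarrow> (\<integral>x. f x \<partial>\<mu>)"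
  shows "limitin (weak_topology S) \<sigma> \<mu> sequentially"
proof -
  have "eventually (\<lambda>n. \<sigma> n \<in> U) sequentially" if "openin (weak_topology S) U" "\<mu> \<in> U" for U
  proof -
    have "generate_topology_on {{\<mu> \<in> borel_prob_measures S. (\<integral>x. f x \<partial>\<mu>) \<in> U} | (f :: 'a \<Rightarrow> real) U.
        continuous_on S f \<and> bounded (f ` S) \<and> open U} U"
      using that(1) unfolding weak_topology_def by (rule openin_topology_generated_by)
    then show ?thesis using that(2)
    proof (induction rule: generate_topology_on.induct)
      case (Int a b)
      then show ?case by (auto intro: eventually_conj)
    next
      case (UN K)
      then obtain k where "k \<in> K" "\<mu> \<in> k" by auto
      then show ?case using UN.IH[of k] by (auto elim: eventually_mono)
    next
      case (Basis s)
      then obtain f :: "'a \<Rightarrow> real" and U where s: "s = {\<mu> \<in> borel_prob_measures S. (\<integral>x. f x \<partial>\<mu>) \<in> U}"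
        "continuous_on S f" "bounded (f ` S)" "open U" by blast
      have "eventually (\<lambda>n. (\<integral>x. f x \<partial>\<sigma> n) \<in> U) sequentially"
        using conv[OF s(2,3)] s(1,4) Basis.prems by (intro topological_tendstoD) auto
      then show ?case using \<sigma> s(1) by (auto elim: eventually_mono)
    qed auto
  qed
  then show ?thesis using \<mu> by (auto simp: limitin_def)
qed

lemma limitin_weak_topologyD:
  fixes f :: "'a::topological_space \<Rightarrow> real"
  assumes "limitin (weak_topology S) \<sigma> \<mu> F" "continuous_on S f" "bounded (f ` S)"
  shows "((\<lambda>n. \<integral>x. f x \<partial>\<sigma> n) \<longlongrightarrow> (\<integral>x. f x \<partial>\<mu>)) F"
  using continuous_map_limit[OF continuous_map_integral_weak_topology[OF assms(2,3)] assms(1)]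
  by (simp add: o_def)

lemma borel_prob_measuresD:
  assumes "\<mu> \<in> borel_prob_measures S"
  shows "prob_space \<mu>" "sets \<mu> = sets (restrict_space borel S)" "space \<mu> = S"
  using assms sets_eq_imp_space_eq[of \<mu> "restrict_space borel S"]
  by (auto simp: borel_prob_measures_def space_restrict_space)

lemma borel_measurable_borel_prob_measure:
  fixes f :: "'a::topological_space \<Rightarrow> 'b::topological_space"
  assumes "\<mu> \<in> borel_prob_measures S" "continuous_on S f"
  shows "f \<in> borel_measurable \<mu>"
  using borel_measurable_continuous_on_restrict[OF assms(2)] borel_prob_measuresD[OF assms(1)]
    measurable_cong_sets by blast

text \<open>The same measure on the Borel sets of the whole line, where it has a distribution function.\<close>

definition to_line :: "real measure \<Rightarrow> real measure" where
  "to_line \<mu> = distr \<mu> borel (\<lambda>x. x)"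

lemma real_distribution_to_line:
  assumes "\<mu> \<in> borel_prob_measures S"
  shows "real_distribution (to_line \<mu>)"
proof -
  interpret prob_space \<mu> using borel_prob_measuresD[OF assms] by simp
  show ?thesis unfolding to_line_def
    by (rule real_distribution_distr) (rule borel_measurable_borel_prob_measure[OF assms], simp)
qed

lemma integral_to_line:
  fixes f :: "real \<Rightarrow> real"
  assumes "\<mu> \<in> borel_prob_measures S" "f \<in> borel_measurable borel"
  shows "(\<integral>x. f x \<partial>to_line \<mu>) = (\<integral>x. f x \<partial>\<mu>)"
  unfolding to_line_def
  by (rule integral_distr) (use assms borel_measurable_borel_prob_measure[OF assms(1), of "\<lambda>x. x"] in auto)

lemma from_line_prob:
  fixes S :: "real set"
  assumes "real_distribution M" "proj \<in> borel_measurable borel" "\<And>x. proj x \<in> S"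
  shows "distr M (restrict_space borel S) proj \<in> borel_prob_measures S"
proof -
  interpret real_distribution M by fact
  have "proj \<in> M \<rightarrow>\<^sub>M restrict_space borel S"
    using assms(2,3) by (intro measurable_restrict_space2) auto
  then show ?thesis
    unfolding borel_prob_measures_def by (auto intro: prob_space_distr)
qed

locale closed_real_interval =
  fixes S :: "real set"
  assumes closed_S: "closed S" and convex_S: "convex S" and nonempty_S: "S \<noteq> {}"
begin

text \<open>Composition with the projection extends a continuous function on \<open>S\<close> to a continuous function on the
  line.\<close>

abbreviation proj :: "real \<Rightarrow> real" where "proj \<equiv> closest_point S"

lemma proj_in [simp]: "proj x \<in> S"
  using closest_point_in_set[OF closed_S nonempty_S] .

lemma proj_id: "x \<in> S \<Longrightarrow> proj x = x"
  by (rule closest_point_self)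

lemma continuous_on_proj: "continuous_on A proj"
  using continuous_on_closest_point[OF convex_S closed_S nonempty_S] continuous_on_subset by blast

lemma continuous_on_compose_proj: "continuous_on S f \<Longrightarrow> continuous_on A (\<lambda>x. f (proj x))"
  by (rule continuous_on_compose2[OF _ continuous_on_proj]) auto

lemma borel_measurable_proj [measurable]: "proj \<in> borel_measurable borel"
  using continuous_on_proj by (rule borel_measurable_continuous_onI)

lemma integral_to_line_proj:
  fixes f :: "real \<Rightarrow> real"
  assumes "\<mu> \<in> borel_prob_measures S" "continuous_on S f"
  shows "(\<integral>x. f x \<partial>\<mu>) = (\<integral>x. f (proj x) \<partial>to_line \<mu>)"
proof -
  have "(\<integral>x. f (proj x) \<partial>to_line \<mu>) = (\<integral>x. f (proj x) \<partial>\<mu>)"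
    using continuous_on_compose_proj[OF assms(2)]
    by (intro integral_to_line[OF assms(1)] borel_measurable_continuous_onI)
  also have "\<dots> = (\<integral>x. f x \<partial>\<mu>)"
    using borel_prob_measuresD(3)[OF assms(1)] by (intro Bochner_Integration.integral_cong) (auto simp: proj_id)
  finally show ?thesis ..
qed

lemma weak_conv_m_imp_limitin:
  assumes \<mu>: "\<mu> \<in> borel_prob_measures S" and \<sigma>: "\<And>n. \<sigma> n \<in> borel_prob_measures S"
    and conv: "weak_conv_m (\<lambda>n. to_line (\<sigma> n)) (to_line \<mu>)"
  shows "limitin (weak_topology S) \<sigma> \<mu> sequentially"
proof (rule limitin_weak_topologyI[OF \<mu> \<sigma>])
  fix f :: "real \<Rightarrow> real" assume f: "continuous_on S f" "bounded (f ` S)"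
  obtain B where B: "\<And>x. x \<in> S \<Longrightarrow> norm (f x) \<le> B"
    using f(2) by (auto simp: bounded_iff)
  have "(\<lambda>n. \<integral>x. f (proj x) \<partial>to_line (\<sigma> n)) \<longlonglongrightarrow> (\<integral>x. f (proj x) \<partial>to_line \<mu>)"
  proof (rule weak_conv_imp_integral_bdd_continuous_conv)
    show "isCont (\<lambda>x. f (proj x)) x" for x
      using continuous_on_compose_proj[OF f(1), of UNIV] by (simp add: continuous_on_eq_continuous_within)
    show "norm (f (proj x)) \<le> B" for x by (rule B) simp
  qed (use conv \<mu> \<sigma> real_distribution_to_line in auto)
  then show "(\<lambda>n. \<integral>x. f x \<partial>\<sigma> n) \<longlonglongrightarrow> (\<integral>x. f x \<partial>\<mu>)"
    using integral_to_line_proj[OF \<mu> f(1)] integral_to_line_proj[OF \<sigma> f(1)] by simp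
qed

lemma distr_to_line_proj:
  assumes \<mu>: "\<mu> \<in> borel_prob_measures S"
  shows "distr (to_line \<mu>) (restrict_space borel S) proj = \<mu>"
proof -
  have p: "proj \<in> borel \<rightarrow>\<^sub>M restrict_space borel S" by (intro measurable_restrict_space2) auto
  have "distr (to_line \<mu>) (restrict_space borel S) proj = distr \<mu> (restrict_space borel S) (proj \<circ> (\<lambda>x. x))"
    unfolding to_line_def using borel_measurable_borel_prob_measure[OF \<mu>, of "\<lambda>x. x"] p
    by (intro distr_distr) auto
  also have "\<dots> = distr \<mu> \<mu> (\<lambda>x. x)"
    using borel_prob_measuresD[OF \<mu>] by (intro distr_cong) (auto simp: proj_id)
  also have "\<dots> = \<mu>" by (rule distr_id)
  finally show ?thesis .
qed

text \<open>Continuous functions that descend from \<open>1\<close> to \<open>0\<close> between a rational \<open>a\<close> and \<open>a + 1 / (j + 1)\<close>,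
  enumerated by the natural numbers. Countably many test functions suffice for weak convergence,
  which makes the weak topology metrizable.\<close>

definition ramp :: "nat \<Rightarrow> real \<Rightarrow> real" where
  "ramp k = (let (a, j) = from_nat k :: rat \<times> nat in cts_step (of_rat a) (of_rat a + 1 / real (Suc j)))"

definition ramp_integrals :: "real measure \<Rightarrow> nat \<Rightarrow> real" where
  "ramp_integrals \<mu> k = (\<integral>x. ramp k x \<partial>\<mu>)"

lemma ramp_to_nat: "ramp (to_nat (a :: rat, j :: nat)) = cts_step (of_rat a) (of_rat a + 1 / real (Suc j))"
  by (simp add: ramp_def)

lemma continuous_on_ramp: "continuous_on A (ramp k)"
proof -
  have "continuous_on UNIV (ramp k)"
    unfolding ramp_def by (auto simp: Let_def split: prod.split
        intro!: uniformly_continuous_imp_continuous cts_step_uniformly_continuous)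
  then show ?thesis using continuous_on_subset by blast
qed

lemma ramp_bounds: "0 \<le> ramp k x" "ramp k x \<le> 1"
  by (auto simp: ramp_def Let_def cts_step_def divide_simps split: prod.split)

lemma bounded_ramp: "bounded (ramp k ` A)"
  using ramp_bounds by (auto simp: bounded_iff intro!: exI[of _ 1])

text \<open>At a continuity point the distribution function is squeezed between the integrals of two ramps, one
  that ends before the point and one that starts after it.\<close>

lemma ramp_integrals_conv_imp_weak_conv:
  assumes M: "\<And>n. real_distribution (M n)" "real_distribution L"
    and conv: "\<And>k. (\<lambda>n. \<integral>x. ramp k x \<partial>M n) \<longlonglongrightarrow> (\<integral>x. ramp k x \<partial>L)"
  shows "weak_conv_m M L"
  unfolding weak_conv_m_def weak_conv_def
proof (intro allI impI)
  fix x assume c: "isCont (cdf L) x"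
  interpret L: real_distribution L by fact
  show "(\<lambda>n. cdf (M n) x) \<longlonglongrightarrow> cdf L x"
  proof (rule order_tendstoI)
    fix l assume l: "l < cdf L x"
    have "eventually (\<lambda>y. l < cdf L y) (at x)"
      using c l unfolding isCont_def by (rule order_tendstoD)
    then obtain d where d: "d > 0" "\<And>y. y \<noteq> x \<Longrightarrow> dist y x < d \<Longrightarrow> l < cdf L y"
      unfolding eventually_at by auto
    obtain a where a: "x - d < of_rat a" "of_rat a < x" using of_rat_dense[of "x - d" x] d(1) by auto
    obtain j where j: "1 / real (Suc j) < x - of_rat a"
      using reals_Archimedean[of "x - of_rat a"] a by (auto simp: inverse_eq_divide)
    let ?b = "of_rat a + 1 / real (Suc j)"
    have "l < cdf L (of_rat a)" using d(2)[of "of_rat a"] a by (auto simp: dist_real_def)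
    also have "\<dots> \<le> (\<integral>x. cts_step (of_rat a) ?b x \<partial>L)" by (rule L.cdf_cts_step) simp
    finally have "eventually (\<lambda>n. l < (\<integral>x. cts_step (of_rat a) ?b x \<partial>M n)) sequentially"
      using conv[of "to_nat (a, j)"] unfolding ramp_to_nat by (intro order_tendstoD(1))
    then show "eventually (\<lambda>n. l < cdf (M n) x) sequentially"
    proof eventually_elim
      case (elim n)
      interpret Mn: real_distribution "M n" by fact
      note elim
      also have "(\<integral>x. cts_step (of_rat a) ?b x \<partial>M n) \<le> cdf (M n) ?b" by (rule Mn.cdf_cts_step) simp
      also have "\<dots> \<le> cdf (M n) x" using j by (intro Mn.cdf_nondecreasing) simp
      finally show ?case .
    qed
  next
    fix u assume u: "cdf L x < u"
    have "eventually (\<lambda>y. cdf L y < u) (at x)"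
      using c u unfolding isCont_def by (rule order_tendstoD)
    then obtain d where d: "d > 0" "\<And>y. y \<noteq> x \<Longrightarrow> dist y x < d \<Longrightarrow> cdf L y < u"
      unfolding eventually_at by auto
    obtain a where a: "x < of_rat a" "of_rat a < x + d" using of_rat_dense[of x "x + d"] d(1) by auto
    obtain j where j: "1 / real (Suc j) < x + d - of_rat a"
      using reals_Archimedean[of "x + d - of_rat a"] a by (auto simp: inverse_eq_divide)
    let ?b = "of_rat a + 1 / real (Suc j)"
    have "0 < 1 / real (Suc j)" by simp
    then have "x < ?b" using a by linarith
    then have "cdf L ?b < u" using d(2)[of ?b] a j by (auto simp: dist_real_def)
    moreover have "(\<integral>x. cts_step (of_rat a) ?b x \<partial>L) \<le> cdf L ?b" by (rule L.cdf_cts_step) simp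
    ultimately have "(\<integral>x. cts_step (of_rat a) ?b x \<partial>L) < u" by simp
    then have "eventually (\<lambda>n. (\<integral>x. cts_step (of_rat a) ?b x \<partial>M n) < u) sequentially"
      using conv[of "to_nat (a, j)"] unfolding ramp_to_nat by (intro order_tendstoD(2))
    then show "eventually (\<lambda>n. cdf (M n) x < u) sequentially"
    proof eventually_elim
      case (elim n)
      interpret Mn: real_distribution "M n" by fact
      have "cdf (M n) x \<le> cdf (M n) (of_rat a)" using a by (intro Mn.cdf_nondecreasing) simp
      also have "\<dots> \<le> (\<integral>x. cts_step (of_rat a) ?b x \<partial>M n)" by (rule Mn.cdf_cts_step) simp
      finally show ?case using elim by simp
    qed
  qed
qed

lemma ramp_integrals_to_line:
  "\<mu> \<in> borel_prob_measures S \<Longrightarrow> (\<integral>x. ramp k x \<partial>to_line \<mu>) = ramp_integrals \<mu> k"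
  unfolding ramp_integrals_def
  by (intro integral_to_line borel_measurable_continuous_onI continuous_on_ramp)

lemma ramp_integrals_conv_imp_limitin:
  assumes \<mu>: "\<mu> \<in> borel_prob_measures S" and \<sigma>: "\<And>n. \<sigma> n \<in> borel_prob_measures S"
    and "\<And>k. (\<lambda>n. ramp_integrals (\<sigma> n) k) \<longlonglongrightarrow> ramp_integrals \<mu> k"
  shows "limitin (weak_topology S) \<sigma> \<mu> sequentially"
  using assms
  by (intro weak_conv_m_imp_limitin ramp_integrals_conv_imp_weak_conv real_distribution_to_line)
     (auto simp: ramp_integrals_to_line)

text \<open>Equal ramp integrals force equal distribution functions at all continuity points. These are dense,
  and right continuity does the rest.\<close>

lemma inj_on_ramp_integrals: "inj_on ramp_integrals (borel_prob_measures S)"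
proof (rule inj_onI)
  fix \<mu> \<nu> assume \<mu>: "\<mu> \<in> borel_prob_measures S" and \<nu>: "\<nu> \<in> borel_prob_measures S"
    and eq: "ramp_integrals \<mu> = ramp_integrals \<nu>"
  have L: "real_distribution (to_line \<mu>)" "real_distribution (to_line \<nu>)"
    using \<mu> \<nu> real_distribution_to_line by auto
  have "weak_conv_m (\<lambda>_. to_line \<mu>) (to_line \<nu>)"
    using L \<mu> \<nu> by (intro ramp_integrals_conv_imp_weak_conv) (auto simp: ramp_integrals_to_line eq)
  then have c: "cdf (to_line \<mu>) x = cdf (to_line \<nu>) x" if "isCont (cdf (to_line \<nu>)) x" for x
    using that LIMSEQ_const_iff by (auto simp: weak_conv_m_def weak_conv_def)
  have "weak_conv_m (\<lambda>_. to_line \<nu>) (to_line \<mu>)"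
    using L \<mu> \<nu> by (intro ramp_integrals_conv_imp_weak_conv) (auto simp: ramp_integrals_to_line eq)
  have "cdf (to_line \<mu>) = cdf (to_line \<nu>)"
  proof
    fix x
    interpret M: real_distribution "to_line \<mu>" by fact
    interpret N: real_distribution "to_line \<nu>" by fact
    have C: "countable {x. \<not> isCont (cdf (to_line \<nu>)) x}"
      using N.countable_support by (simp add: N.isCont_cdf)
    have "\<exists>y. x < y \<and> y < x + 1 / real (Suc n) \<and> isCont (cdf (to_line \<nu>)) y" for n
      using open_minus_countable[OF C, of "{x <..< x + 1 / real (Suc n)}"] by auto
    then obtain y where y: "\<And>n. x < y n" "\<And>n. y n < x + 1 / real (Suc n)"
      "\<And>n. isCont (cdf (to_line \<nu>)) (y n)" by metis
    have "y \<longlonglongrightarrow> x"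
    proof (rule tendsto_sandwich[of "\<lambda>_. x"])
      have "(\<lambda>n. x + 1 / real (Suc n)) \<longlonglongrightarrow> x + 0"
        by (intro tendsto_intros LIMSEQ_Suc lim_1_over_n)
      then show "(\<lambda>n. x + 1 / real (Suc n)) \<longlonglongrightarrow> x" by simp
    qed (use y in \<open>auto intro!: always_eventually less_imp_le simp del: of_nat_Suc\<close>)
    then have yr: "filterlim y (at_right x) sequentially"
      using y(1) by (auto simp: filterlim_at intro!: always_eventually)
    have "(\<lambda>n. cdf (to_line \<mu>) (y n)) \<longlonglongrightarrow> cdf (to_line \<mu>) x"
      using M.cdf_is_right_cont[of x] yr filterlim_compose unfolding continuous_within by blast
    moreover have "(\<lambda>n. cdf (to_line \<nu>) (y n)) \<longlonglongrightarrow> cdf (to_line \<nu>) x"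
      using N.cdf_is_right_cont[of x] yr filterlim_compose unfolding continuous_within by blast
    ultimately show "cdf (to_line \<mu>) x = cdf (to_line \<nu>) x"
      using c[OF y(3)] LIMSEQ_unique by auto
  qed
  then have "to_line \<mu> = to_line \<nu>" using cdf_unique[OF L] by simp
  then show "\<mu> = \<nu>" using distr_to_line_proj[OF \<mu>] distr_to_line_proj[OF \<nu>] by metis
qed

definition weak_dist :: "real measure \<Rightarrow> real measure \<Rightarrow> real" where
  "weak_dist \<mu> \<nu> = dist (ramp_integrals \<mu>) (ramp_integrals \<nu>)"

lemma Metric_space_weak_dist: "Metric_space (borel_prob_measures S) weak_dist"
  using inj_on_ramp_integrals
  by unfold_locales (auto simp: weak_dist_def dist_commute dist_triangle inj_on_def)

text \<open>Balls of \<open>weak_dist\<close> are weakly open because the ramp integrals are weakly continuous. Conversely,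
  if no ball around a point of a weakly open set were contained in it, a sequence outside the set
  would converge to that point.\<close>

lemma mtopology_weak_dist: "Metric_space.mtopology (borel_prob_measures S) weak_dist = weak_topology S"
proof -
  interpret W: Metric_space "borel_prob_measures S" weak_dist by (rule Metric_space_weak_dist)
  have R: "continuous_map (weak_topology S) euclidean ramp_integrals"
  proof -
    have "continuous_map (weak_topology S) (product_topology (\<lambda>_. euclidean) UNIV) ramp_integrals"
      unfolding continuous_map_componentwise_UNIV ramp_integrals_def
      using continuous_map_integral_weak_topology continuous_on_ramp bounded_ramp by blast
    then show ?thesis by (simp add: euclidean_product_topology)
  qed
  show ?thesis unfolding topology_eq
  proof (intro allI iffI)
    fix U assume U: "openin W.mtopology U"
    show "openin (weak_topology S) U"
    proof (subst openin_subopen, intro ballI)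
      fix \<mu> assume \<mu>: "\<mu> \<in> U"
      then obtain r where r: "r > 0" "W.mball \<mu> r \<subseteq> U" and U1: "U \<subseteq> borel_prob_measures S"
        using U by (auto simp: W.openin_mtopology)
      let ?T = "{\<nu> \<in> topspace (weak_topology S). ramp_integrals \<nu> \<in> ball (ramp_integrals \<mu>) r}"
      have "openin (weak_topology S) ?T"
        by (rule openin_continuous_map_preimage[OF R]) simp
      moreover have "?T \<subseteq> U" using r(2) \<mu> U1 by (auto simp: W.mball_def weak_dist_def)
      moreover have "\<mu> \<in> ?T" using \<mu> r(1) U1 by auto
      ultimately show "\<exists>T. openin (weak_topology S) T \<and> \<mu> \<in> T \<and> T \<subseteq> U" by blast
    qed
  next
    fix U assume U: "openin (weak_topology S) U"
    show "openin W.mtopology U" unfolding W.openin_mtopology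
    proof (intro conjI allI impI)
      show US: "U \<subseteq> borel_prob_measures S" using openin_subset[OF U] by simp
      fix \<mu> assume \<mu>: "\<mu> \<in> U"
      show "\<exists>r>0. W.mball \<mu> r \<subseteq> U"
      proof (rule ccontr)
        assume "\<not> ?thesis"
        then have "\<exists>\<nu>. \<nu> \<in> W.mball \<mu> (1 / real (Suc n)) \<and> \<nu> \<notin> U" for n
          by (metis subsetI zero_less_divide_1_iff of_nat_0_less_iff zero_less_Suc)
        then obtain \<nu> where \<nu>: "\<And>n. \<nu> n \<in> W.mball \<mu> (1 / real (Suc n))" "\<And>n. \<nu> n \<notin> U" by metis
        have "(\<lambda>n. ramp_integrals (\<nu> n)) \<longlonglongrightarrow> ramp_integrals \<mu>"
        proof (rule metric_tendsto_imp_tendsto[of "\<lambda>n. 1 / real (Suc n)" 0])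
          show "(\<lambda>n. 1 / real (Suc n)) \<longlonglongrightarrow> 0" by (intro LIMSEQ_Suc lim_1_over_n)
        qed (use \<nu>(1) in \<open>auto simp: weak_dist_def W.mball_def dist_commute less_imp_le\<close>)
        moreover have "isCont (\<lambda>x::nat \<Rightarrow> real. x k) (ramp_integrals \<mu>)" for k
          using continuous_on_product_coordinates[of k] continuous_on_eq_continuous_at[OF open_UNIV] by blast
        ultimately have "(\<lambda>n. ramp_integrals (\<nu> n) k) \<longlonglongrightarrow> ramp_integrals \<mu> k" for k
          by (rule isCont_tendsto_compose[rotated])
        then have "limitin (weak_topology S) \<nu> \<mu> sequentially"
          using \<nu>(1) \<mu> US by (intro ramp_integrals_conv_imp_limitin) auto
        then have "eventually (\<lambda>n. \<nu> n \<in> U) sequentially" using U \<mu> by (auto simp: limitin_def)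
        then show False using \<nu>(2) by auto
      qed
    qed
  qed
qed

lemma openin_weak_topology_sequentially:
  assumes "U \<subseteq> borel_prob_measures S"
    and "\<And>\<sigma> \<mu>. \<mu> \<in> U \<Longrightarrow> (\<And>n. \<sigma> n \<in> borel_prob_measures S) \<Longrightarrow>
      limitin (weak_topology S) \<sigma> \<mu> sequentially \<Longrightarrow> \<exists>n. \<sigma> n \<in> U"
  shows "openin (weak_topology S) U"
proof -
  interpret W: Metric_space "borel_prob_measures S" weak_dist by (rule Metric_space_weak_dist)
  have "\<exists>r>0. W.mball \<mu> r \<subseteq> U" if \<mu>: "\<mu> \<in> U" for \<mu>
  proof (rule ccontr)
    assume "\<not> ?thesis"
    then have "\<exists>\<nu>. \<nu> \<in> W.mball \<mu> (1 / real (Suc n)) \<and> \<nu> \<notin> U" for n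
      by (metis subsetI zero_less_divide_1_iff of_nat_0_less_iff zero_less_Suc)
    then obtain \<nu> where \<nu>: "\<And>n. \<nu> n \<in> W.mball \<mu> (1 / real (Suc n))" "\<And>n. \<nu> n \<notin> U" by metis
    have "limitin W.mtopology \<nu> \<mu> sequentially"
      unfolding W.limitin_metric_dist_null
    proof (intro conjI)
      show "((\<lambda>n. weak_dist (\<nu> n) \<mu>) \<longlongrightarrow> 0) sequentially"
      proof (rule tendsto_sandwich[of "\<lambda>_. 0"])
        show "(\<lambda>n. 1 / real (Suc n)) \<longlonglongrightarrow> 0" by (intro LIMSEQ_Suc lim_1_over_n)
      qed (use \<nu>(1) in \<open>auto simp: weak_dist_def W.mball_def dist_commute less_imp_le\<close>)
    qed (use \<mu> \<nu>(1) assms(1) in auto)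
    then show False using assms(2)[of \<mu> \<nu>] \<mu> \<nu> unfolding mtopology_weak_dist by auto
  qed
  then show ?thesis using assms(1) mtopology_weak_dist W.openin_mtopology by metis
qed

lemma compactin_weak_topology_sequentially:
  "compactin (weak_topology S) A \<longleftrightarrow> A \<subseteq> borel_prob_measures S \<and>
     (\<forall>\<sigma>::nat \<Rightarrow> real measure. range \<sigma> \<subseteq> A \<longrightarrow>
        (\<exists>l r. l \<in> A \<and> strict_mono r \<and> limitin (weak_topology S) (\<sigma> \<circ> r) l sequentially))"
  using Metric_space.compactin_sequentially[OF Metric_space_weak_dist, of A]
  unfolding mtopology_weak_dist .

text \<open>Helly's selection theorem provides a limit on the line. It is carried by \<open>S\<close> because the bounded
  continuous function \<open>min 1 |x - proj x|\<close>, whose zeros are the points of \<open>S\<close>, has integral \<open>0\<close>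
  along the sequence and hence in the limit.\<close>

lemma tight_imp_convergent_subsequence:
  assumes \<sigma>: "\<And>n. \<sigma> n \<in> borel_prob_measures S"
    and tight: "tight (\<lambda>n. to_line (\<sigma> n))"
  shows "\<exists>r \<mu>. strict_mono r \<and> \<mu> \<in> borel_prob_measures S \<and> limitin (weak_topology S) (\<sigma> \<circ> r) \<mu> sequentially"
proof -
  obtain r M where r: "strict_mono (r :: nat \<Rightarrow> nat)" and M: "real_distribution M"
    and conv: "weak_conv_m ((\<lambda>n. to_line (\<sigma> n)) \<circ> id \<circ> r) M"
    using tight_imp_convergent_subsubsequence[OF tight, of id] by (auto simp: strict_mono_def)
  interpret M: real_distribution M by fact
  let ?\<mu> = "distr M (restrict_space borel S) proj"
  have \<mu>: "?\<mu> \<in> borel_prob_measures S" by (rule from_line_prob[OF M]) auto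
  let ?h = "\<lambda>x::real. min 1 \<bar>x - proj x\<bar>"
  have hc: "continuous_on A ?h" for A by (intro continuous_intros continuous_on_proj)
  have "(\<lambda>n. \<integral>x. ?h x \<partial>to_line (\<sigma> (r n))) \<longlonglongrightarrow> (\<integral>x. ?h x \<partial>M)"
  proof (rule weak_conv_imp_integral_bdd_continuous_conv)
    show "isCont ?h x" for x using hc[of UNIV] by (simp add: continuous_on_eq_continuous_within)
    show "norm (?h x) \<le> 1" for x by auto
  qed (use conv M \<sigma> real_distribution_to_line in \<open>auto simp: o_def\<close>)
  moreover have "(\<integral>x. ?h x \<partial>to_line (\<sigma> k)) = 0" for k
  proof -
    have "(\<integral>x. ?h x \<partial>to_line (\<sigma> k)) = (\<integral>x. ?h x \<partial>\<sigma> k)"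
      by (rule integral_to_line[OF \<sigma>]) auto
    also have "\<dots> = (\<integral>x. 0 \<partial>\<sigma> k)"
      using borel_prob_measuresD(3)[OF \<sigma>] by (intro Bochner_Integration.integral_cong) (auto simp: proj_id)
    finally show ?thesis by simp
  qed
  ultimately have "(\<integral>x. ?h x \<partial>M) = 0" using LIMSEQ_unique[OF tendsto_const] by force
  moreover have "integrable M ?h"
    by (rule M.integrable_const_bound[of _ 1]) auto
  ultimately have "AE x in M. ?h x = 0"
    by (subst (asm) integral_nonneg_eq_0_iff_AE) auto
  then have AE: "AE x in M. proj x = x" by eventually_elim (auto simp: min_def split: if_splits)
  have "to_line ?\<mu> = distr M borel ((\<lambda>x. x) \<circ> proj)"
    unfolding to_line_def using borel_measurable_borel_prob_measure[OF \<mu>, of "\<lambda>x. x"]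
    by (intro distr_distr) (auto intro: measurable_restrict_space2)
  also have "\<dots> = distr M borel (\<lambda>x. x)" using AE by (intro distr_cong_AE) auto
  also have "\<dots> = M" by (rule distr_id2) simp
  finally have tl: "to_line ?\<mu> = M" .
  have "limitin (weak_topology S) (\<sigma> \<circ> r) ?\<mu> sequentially"
    using \<mu> \<sigma> conv by (intro weak_conv_m_imp_limitin) (auto simp: tl o_def)
  with r \<mu> show ?thesis by blast
qed

lemma limitin_imp_weak_conv_m:
  assumes \<mu>: "\<mu> \<in> borel_prob_measures S" and \<sigma>: "\<And>n. \<sigma> n \<in> borel_prob_measures S"
    and lim: "limitin (weak_topology S) \<sigma> \<mu> sequentially"
  shows "weak_conv_m (\<lambda>n. to_line (\<sigma> n)) (to_line \<mu>)"
  using assms limitin_weak_topologyD[OF lim continuous_on_ramp bounded_ramp]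
  by (intro ramp_integrals_conv_imp_weak_conv real_distribution_to_line)
     (auto simp: ramp_integrals_to_line ramp_integrals_def)

lemma continuous_on_compose_proj2:
  assumes "continuous_on (S \<times> S) (\<lambda>(x, y). h x y)"
  shows "continuous_on A (\<lambda>(x, y). h (proj x) (proj y))"
proof -
  have c: "continuous_on A (\<lambda>z. (proj (fst z), proj (snd z)))"
    by (intro continuous_intros continuous_on_compose2[OF continuous_on_proj[of UNIV]]) auto
  show ?thesis
    using continuous_on_compose2[OF assms c] by (simp add: case_prod_unfold image_subset_iff)
qed

lemma double_integral_to_line:
  fixes h :: "real \<Rightarrow> real \<Rightarrow> real"
  assumes \<mu>: "\<mu> \<in> borel_prob_measures S"
    and h: "continuous_on (S \<times> S) (\<lambda>(x, y). h x y)"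
  shows "(\<integral>x. \<integral>y. h x y \<partial>\<mu> \<partial>\<mu>) = (\<integral>x. \<integral>y. h (proj x) (proj y) \<partial>to_line \<mu> \<partial>to_line \<mu>)"
proof -
  interpret prob_space \<mu> using borel_prob_measuresD[OF \<mu>] by simp
  interpret L: real_distribution "to_line \<mu>" using \<mu> by (rule real_distribution_to_line)
  have [measurable]: "(\<lambda>(x, y). h (proj x) (proj y)) \<in> borel_measurable (borel \<Otimes>\<^sub>M borel)"
    unfolding borel_prod
    by (intro borel_measurable_continuous_onI continuous_on_compose_proj2 h)
  have [measurable_cong]: "sets (to_line \<mu>) = sets borel" by (simp add: to_line_def)
  have m: "(\<lambda>x. \<integral>y. h (proj x) (proj y) \<partial>to_line \<mu>) \<in> borel_measurable borel"
    by (rule L.borel_measurable_lebesgue_integral) measurable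
  have "(\<integral>x. \<integral>y. h (proj x) (proj y) \<partial>to_line \<mu> \<partial>to_line \<mu>) = (\<integral>x. \<integral>y. h (proj x) (proj y) \<partial>to_line \<mu> \<partial>\<mu>)"
    by (rule integral_to_line[OF \<mu> m])
  also have "\<dots> = (\<integral>x. \<integral>y. h x y \<partial>\<mu> \<partial>\<mu>)"
  proof (rule Bochner_Integration.integral_cong[OF refl])
    fix x assume "x \<in> space \<mu>"
    then have x: "x \<in> S" "proj x = x" using borel_prob_measuresD(3)[OF \<mu>] proj_id by auto
    have "continuous_on S (h x)"
      using continuous_on_compose2[OF h, of S "\<lambda>y. (x, y)"] x continuous_on_Pair[OF continuous_on_const continuous_on_id, of S x]
      by auto
    then show "(\<integral>y. h (proj x) (proj y) \<partial>to_line \<mu>) = (\<integral>y. h x y \<partial>\<mu>)"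
      using integral_to_line_proj[OF \<mu>] x by simp
  qed
  finally show ?thesis ..
qed

text \<open>By Skorohod's representation the measures are laws of pointwise convergent random variables on one
  space \<open>\<Omega>\<close>. Both iterated integrals are then taken over the fixed measure \<open>\<Omega>\<close>, where dominated
  convergence applies twice.\<close>

lemma tendsto_double_integral:
  fixes h :: "real \<Rightarrow> real \<Rightarrow> real"
  assumes \<mu>: "\<mu> \<in> borel_prob_measures S" and \<sigma>: "\<And>n. \<sigma> n \<in> borel_prob_measures S"
    and lim: "limitin (weak_topology S) \<sigma> \<mu> sequentially"
    and h: "continuous_on (S \<times> S) (\<lambda>(x, y). h x y)" and B: "\<And>x y. x \<in> S \<Longrightarrow> y \<in> S \<Longrightarrow> \<bar>h x y\<bar> \<le> B"
  shows "(\<lambda>n. \<integral>x. \<integral>y. h x y \<partial>\<sigma> n \<partial>\<sigma> n) \<longlonglongrightarrow> (\<integral>x. \<integral>y. h x y \<partial>\<mu> \<partial>\<mu>)"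
proof -
  obtain \<Omega> :: "real measure" and Y_seq Y where ps: "prob_space \<Omega>" and
    [measurable]: "\<And>n. Y_seq n \<in> borel_measurable \<Omega>" and
    dn: "\<And>n. distr \<Omega> borel (Y_seq n) = to_line (\<sigma> n)" and
    Y: "Y \<in> \<Omega> \<rightarrow>\<^sub>M lborel" and d: "distr \<Omega> borel Y = to_line \<mu>" and
    conv: "\<And>x. x \<in> space \<Omega> \<Longrightarrow> (\<lambda>n. Y_seq n x) \<longlonglongrightarrow> Y x"
    using Skorohod[of "\<lambda>n. to_line (\<sigma> n)" "to_line \<mu>"] \<mu> \<sigma> real_distribution_to_line
      limitin_imp_weak_conv_m[OF \<mu> \<sigma> lim] by metis
  have [measurable]: "Y \<in> borel_measurable \<Omega>" using Y by simp
  interpret prob_space \<Omega> by fact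
  let ?h = "\<lambda>x y. h (proj x) (proj y)"
  have hc: "continuous_on UNIV (\<lambda>(x, y). ?h x y)"
    by (rule continuous_on_compose_proj2[OF h])
  have [measurable]: "(\<lambda>(x, y). ?h x y) \<in> borel_measurable (borel \<Otimes>\<^sub>M borel)"
    unfolding borel_prod by (rule borel_measurable_continuous_onI[OF hc])
  have hB: "\<bar>?h x y\<bar> \<le> B" for x y by (rule B) auto
  have B0: "0 \<le> B" using hB[of 0 0] by linarith
  have push: "(\<integral>x. \<integral>y. h x y \<partial>\<nu> \<partial>\<nu>) = (\<integral>s. \<integral>t. ?h (X s) (X t) \<partial>\<Omega> \<partial>\<Omega>)"
    if \<nu>: "\<nu> \<in> borel_prob_measures S" and X: "X \<in> borel_measurable \<Omega>" "distr \<Omega> borel X = to_line \<nu>" for \<nu> X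
  proof -
    note X(1)[measurable]
    interpret L: real_distribution "to_line \<nu>" using \<nu> by (rule real_distribution_to_line)
    have [measurable_cong]: "sets (to_line \<nu>) = sets borel" by (simp add: to_line_def)
    have m: "(\<lambda>x. \<integral>y. ?h x y \<partial>to_line \<nu>) \<in> borel_measurable borel"
      by (rule L.borel_measurable_lebesgue_integral) measurable
    have "(\<integral>x. \<integral>y. h x y \<partial>\<nu> \<partial>\<nu>) = (\<integral>x. \<integral>y. ?h x y \<partial>to_line \<nu> \<partial>to_line \<nu>)"
      by (rule double_integral_to_line[OF \<nu> h])
    also have "\<dots> = (\<integral>s. \<integral>y. ?h (X s) y \<partial>to_line \<nu> \<partial>\<Omega>)"
      unfolding X(2)[symmetric] by (rule integral_distr) (use X m in \<open>auto simp: X(2)\<close>)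
    also have "\<dots> = (\<integral>s. \<integral>t. ?h (X s) (X t) \<partial>\<Omega> \<partial>\<Omega>)"
      unfolding X(2)[symmetric] by (intro Bochner_Integration.integral_cong refl integral_distr) auto
    finally show ?thesis .
  qed
  have hY: "(\<lambda>n. ?h (Y_seq n s) (Y_seq n t)) \<longlonglongrightarrow> ?h (Y s) (Y t)" if "s \<in> space \<Omega>" "t \<in> space \<Omega>" for s t
  proof -
    have "isCont (\<lambda>(x, y). ?h x y) (Y s, Y t)" using hc by (simp add: continuous_on_eq_continuous_within)
    from isCont_tendsto_compose[OF this tendsto_Pair[OF conv[OF that(1)] conv[OF that(2)]]]
    show ?thesis by simp
  qed
  have inner_bd: "norm (\<integral>t. ?h (X s) (X t) \<partial>\<Omega>) \<le> B" if X[measurable]: "X \<in> borel_measurable \<Omega>" for X s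
  proof -
    have i: "integrable \<Omega> (\<lambda>t. ?h (X s) (X t))"
      by (rule integrable_const_bound[of _ B]) (use hB in auto)
    have "norm (\<integral>t. ?h (X s) (X t) \<partial>\<Omega>) \<le> (\<integral>t. norm (?h (X s) (X t)) \<partial>\<Omega>)"
      by (rule integral_norm_bound)
    also have "\<dots> \<le> (\<integral>t. B \<partial>\<Omega>)" using i hB by (intro integral_mono integrable_norm) auto
    finally show ?thesis using prob_space by simp
  qed
  have "(\<lambda>n. \<integral>s. \<integral>t. ?h (Y_seq n s) (Y_seq n t) \<partial>\<Omega> \<partial>\<Omega>) \<longlonglongrightarrow> (\<integral>s. \<integral>t. ?h (Y s) (Y t) \<partial>\<Omega> \<partial>\<Omega>)"
  proof (rule integral_dominated_convergence[where w = "\<lambda>_. B"])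
    show "AE s in \<Omega>. (\<lambda>n. \<integral>t. ?h (Y_seq n s) (Y_seq n t) \<partial>\<Omega>) \<longlonglongrightarrow> (\<integral>t. ?h (Y s) (Y t) \<partial>\<Omega>)"
    proof (rule AE_I2)
      fix s assume "s \<in> space \<Omega>"
      then show "(\<lambda>n. \<integral>t. ?h (Y_seq n s) (Y_seq n t) \<partial>\<Omega>) \<longlonglongrightarrow> (\<integral>t. ?h (Y s) (Y t) \<partial>\<Omega>)"
        using hY hB by (intro integral_dominated_convergence[where w = "\<lambda>_. B"]) auto
    qed
  qed (use inner_bd in \<open>auto intro!: AE_I2\<close>)
  then show ?thesis
    using push[OF \<mu> _ d] push[OF \<sigma> _ dn] by simp
qed

end

section \<open>Energies of kernels that vanish at infinity\<close>

text \<open>Shifting by the bound reduces the difference of two integrals to a single integral of a nonnegative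
  function.\<close>

lemma ereal_integral_bounded_below:
  assumes "prob_space M" and [measurable]: "f \<in> borel_measurable M"
    and B: "0 \<le> B" "\<And>x. x \<in> space M \<Longrightarrow> ereal (- B) \<le> f x"
  shows "ereal_integral M f = enn2ereal (\<integral>\<^sup>+x. e2ennreal (f x + ereal B) \<partial>M) - ereal B"
proof -
  interpret prob_space M by fact
  let ?p = "\<integral>\<^sup>+x. e2ennreal (f x) \<partial>M" and ?q = "\<integral>\<^sup>+x. e2ennreal (- f x) \<partial>M"
    and ?N = "\<integral>\<^sup>+x. e2ennreal (f x + ereal B) \<partial>M"
  have pt: "e2ennreal (f x + ereal B) + e2ennreal (- f x) = e2ennreal (f x) + ennreal B" if "x \<in> space M" for x
  proof (cases "f x")
    case (real r)
    then have "- B \<le> r" using B(2)[OF that] by simp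
    then show ?thesis using real B(1)
      by (cases "r \<ge> 0") (auto simp: ennreal_def[symmetric] ennreal_neg e2ennreal_ereal simp flip: ennreal_plus)
  qed (use B(2)[OF that] in auto)
  have "?N + ?q = (\<integral>\<^sup>+x. e2ennreal (f x + ereal B) + e2ennreal (- f x) \<partial>M)"
    by (rule nn_integral_add[symmetric]) auto
  also have "\<dots> = (\<integral>\<^sup>+x. e2ennreal (f x) + ennreal B \<partial>M)" by (rule nn_integral_cong) (rule pt)
  also have "\<dots> = ?p + ennreal B" by (subst nn_integral_add) (auto simp: emeasure_space_1)
  finally have eq: "?N + ?q = ?p + ennreal B" .
  have "?q \<le> (\<integral>\<^sup>+x. ennreal B \<partial>M)"
  proof (rule nn_integral_mono)
    fix x assume "x \<in> space M"
    then have "- f x \<le> ereal B" using B(2)[of x] by (cases "f x") auto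
    then have "e2ennreal (- f x) \<le> e2ennreal (ereal B)" by (rule e2ennreal_mono)
    then show "e2ennreal (- f x) \<le> ennreal B" by (simp add: ennreal_def e2ennreal_ereal)
  qed
  then have q: "?q \<le> ennreal B" by (simp add: emeasure_space_1)
  then have "?q < \<infinity>" by (rule le_less_trans) simp
  then obtain r where r: "?q = ennreal r" "0 \<le> r" by (cases ?q) auto
  have "enn2ereal (?N + ?q) = enn2ereal (?p + ennreal B)" using eq by simp
  then have "enn2ereal ?N + ereal r = enn2ereal ?p + ereal B"
    using r B(1) by (simp add: plus_ennreal.rep_eq)
  then show ?thesis unfolding ereal_integral_def using r
    by (cases "enn2ereal ?N"; cases "enn2ereal ?p") auto
qed

text \<open>The energy kernel is \<open>- ln E\<close>. Stated for \<open>E\<close>, the singularities of the energy kernel on the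
  diagonal, at the zeros of the weight and at infinity are all covered by continuity and by decay.\<close>

locale vanishing_kernel = closed_real_interval +
  fixes E :: "real \<Rightarrow> real \<Rightarrow> real" and B :: real
  assumes cont_E: "continuous_on (S \<times> S) (\<lambda>(x, y). E x y)"
    and E_le: "\<And>x y. x \<in> S \<Longrightarrow> y \<in> S \<Longrightarrow> E x y \<le> exp B"
    and B_nonneg: "0 \<le> B"
    and E_vanishes: "\<And>e. e > 0 \<Longrightarrow> \<exists>R. \<forall>x\<in>S. \<forall>y\<in>S. R \<le> \<bar>x\<bar> \<longrightarrow> E x y \<le> e"
begin

text \<open>The energy kernel \<open>- ln E\<close> truncated at height \<open>M\<close>.\<close>

definition cutoff :: "real \<Rightarrow> real \<Rightarrow> real \<Rightarrow> real" where
  "cutoff M x y = - ln (max (exp (- M)) (E x y))"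

definition cutoff_energy :: "real \<Rightarrow> real measure \<Rightarrow> real" where
  "cutoff_energy M \<mu> = (\<integral>x. \<integral>y. cutoff M x y \<partial>\<mu> \<partial>\<mu>)"

definition log_kernel :: "real \<Rightarrow> real \<Rightarrow> ereal" where
  "log_kernel x y = (if E x y \<le> 0 then \<infinity> else ereal (- ln (E x y)))"

definition log_energy :: "real measure \<Rightarrow> ereal" where
  "log_energy \<mu> = ereal_integral (\<mu> \<Otimes>\<^sub>M \<mu>) (\<lambda>(x, y). log_kernel x y)"

text \<open>Since \<open>E \<le> exp B\<close>, adding \<open>B\<close> makes the kernel nonnegative, so that monotone convergence and
  Fubini's theorem apply in \<open>ennreal\<close>.\<close>

definition shifted_kernel :: "real \<Rightarrow> real \<Rightarrow> ennreal" where
  "shifted_kernel x y = e2ennreal (log_kernel x y + ereal B)"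

definition shifted_energy :: "real measure \<Rightarrow> ennreal" where
  "shifted_energy \<mu> = (\<integral>\<^sup>+x. \<integral>\<^sup>+y. shifted_kernel x y \<partial>\<mu> \<partial>\<mu>)"

lemma borel_measurable_pair_S:
  fixes h :: "real \<Rightarrow> real \<Rightarrow> real"
  assumes \<mu>: "\<mu> \<in> borel_prob_measures S" and h: "continuous_on (S \<times> S) (\<lambda>(x, y). h x y)"
  shows "(\<lambda>(x, y). h x y) \<in> borel_measurable (\<mu> \<Otimes>\<^sub>M \<mu>)"
proof -
  have [measurable]: "(\<lambda>x. x) \<in> borel_measurable \<mu>"
    by (rule borel_measurable_borel_prob_measure[OF \<mu>]) simp
  have [measurable]: "(\<lambda>(x, y). h (proj x) (proj y)) \<in> borel_measurable (borel \<Otimes>\<^sub>M borel)"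
    unfolding borel_prod by (intro borel_measurable_continuous_onI continuous_on_compose_proj2 h)
  have "(\<lambda>z. (\<lambda>(x, y). h (proj x) (proj y)) (fst z, snd z)) \<in> borel_measurable (\<mu> \<Otimes>\<^sub>M \<mu>)"
    by measurable
  then show ?thesis
    by (rule measurable_cong[THEN iffD1, rotated])
       (auto simp: space_pair_measure borel_prob_measuresD(3)[OF \<mu>] proj_id)
qed

lemma continuous_on_cutoff: "continuous_on (S \<times> S) (\<lambda>(x, y). cutoff M x y)"
proof -
  have "max (exp (- M)) (E x y) \<noteq> 0" for x y
    using less_le_trans[OF exp_gt_zero[of "- M"] max.cobounded1[of _ "E x y"]] by simp
  then show ?thesis using cont_E unfolding cutoff_def case_prod_unfold
    by (intro continuous_intros) auto
qed

lemma cutoff_le: "cutoff M x y \<le> M"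
proof -
  have "ln (exp (- M)) \<le> ln (max (exp (- M)) (E x y))"
    by (subst ln_le_cancel_iff) (auto simp: less_max_iff_disj)
  then show ?thesis by (simp add: cutoff_def)
qed

lemma cutoff_ge:
  assumes "x \<in> S" "y \<in> S" "0 \<le> M" shows "- B \<le> cutoff M x y"
proof -
  have "ln (max (exp (- M)) (E x y)) \<le> ln (exp B)"
    using E_le[OF assms(1,2)] B_nonneg assms(3) by (subst ln_le_cancel_iff) (auto simp: less_max_iff_disj)
  then show ?thesis by (simp add: cutoff_def)
qed

lemma cutoff_mono: "M \<le> M' \<Longrightarrow> cutoff M x y \<le> cutoff M' x y"
  unfolding cutoff_def
  by (auto simp: less_max_iff_disj intro!: max.mono ln_le_cancel_iff[THEN iffD2] simp del: max.bounded_iff)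

lemma abs_cutoff_le: "x \<in> S \<Longrightarrow> y \<in> S \<Longrightarrow> 0 \<le> M \<Longrightarrow> \<bar>cutoff M x y\<bar> \<le> M + B"
  using cutoff_le[of M x y] cutoff_ge[of x y M] B_nonneg by linarith

lemma integrable_cutoff:
  assumes \<mu>: "\<mu> \<in> borel_prob_measures S" and M: "0 \<le> M"
  shows "x \<in> S \<Longrightarrow> integrable \<mu> (\<lambda>y. cutoff M x y)"
    and "integrable \<mu> (\<lambda>x. \<integral>y. cutoff M x y \<partial>\<mu>)"
    and "x \<in> S \<Longrightarrow> \<bar>\<integral>y. cutoff M x y \<partial>\<mu>\<bar> \<le> M + B"
proof -
  interpret prob_space \<mu> using borel_prob_measuresD[OF \<mu>] by simp
  note [simp] = borel_prob_measuresD(3)[OF \<mu>]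
  note m[measurable] = borel_measurable_pair_S[OF \<mu> continuous_on_cutoff[of M]]
  have i: "integrable \<mu> (\<lambda>y. cutoff M x y)" if "x \<in> S" for x
  proof (rule integrable_const_bound[of _ "M + B"])
    show "(\<lambda>y. cutoff M x y) \<in> borel_measurable \<mu>"
      using measurable_compose[OF measurable_Pair1' m, of x] that by simp
  qed (use that M abs_cutoff_le in \<open>auto intro!: AE_I2\<close>)
  have b: "\<bar>\<integral>y. cutoff M x y \<partial>\<mu>\<bar> \<le> M + B" if "x \<in> S" for x
  proof -
    have "\<bar>\<integral>y. cutoff M x y \<partial>\<mu>\<bar> \<le> (\<integral>y. \<bar>cutoff M x y\<bar> \<partial>\<mu>)" using integral_norm_bound[of \<mu> "cutoff M x"] by simp
    also have "\<dots> \<le> (\<integral>y. M + B \<partial>\<mu>)"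
      using i[OF that] that M abs_cutoff_le by (intro integral_mono) auto
    finally show ?thesis using prob_space by simp
  qed
  show "x \<in> S \<Longrightarrow> integrable \<mu> (\<lambda>y. cutoff M x y)" by (rule i)
  show "x \<in> S \<Longrightarrow> \<bar>\<integral>y. cutoff M x y \<partial>\<mu>\<bar> \<le> M + B" by (rule b)
  have "(\<lambda>x. \<integral>y. cutoff M x y \<partial>\<mu>) \<in> borel_measurable \<mu>"
    by (rule borel_measurable_lebesgue_integral) measurable
  then show "integrable \<mu> (\<lambda>x. \<integral>y. cutoff M x y \<partial>\<mu>)"
    by (rule integrable_const_bound[of _ "M + B", rotated]) (use b in \<open>auto intro!: AE_I2\<close>)
qed

lemma cutoff_energy_mono:
  assumes \<mu>: "\<mu> \<in> borel_prob_measures S" and M: "0 \<le> M" "M \<le> M'"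
  shows "cutoff_energy M \<mu> \<le> cutoff_energy M' \<mu>"
proof -
  have "0 \<le> M'" using M by simp
  then show ?thesis unfolding cutoff_energy_def
    using integrable_cutoff[OF \<mu> M(1)] integrable_cutoff[OF \<mu>, of M'] cutoff_mono[OF M(2)]
    by (intro integral_mono) (auto simp: borel_prob_measuresD(3)[OF \<mu>])
qed

lemma tendsto_cutoff_energy:
  assumes "\<mu> \<in> borel_prob_measures S" "\<And>n. \<sigma> n \<in> borel_prob_measures S"
    and "limitin (weak_topology S) \<sigma> \<mu> sequentially" "0 \<le> M"
  shows "(\<lambda>n. cutoff_energy M (\<sigma> n)) \<longlonglongrightarrow> cutoff_energy M \<mu>"
  unfolding cutoff_energy_def
  by (rule tendsto_double_integral[OF assms(1-3) continuous_on_cutoff abs_cutoff_le[OF _ _ assms(4)]])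

text \<open>The truncated kernel equals \<open>M\<close> where \<open>|x| \<ge> R\<close> and is at least \<open>- B\<close> elsewhere.\<close>

lemma cutoff_energy_tail:
  assumes \<mu>: "\<mu> \<in> borel_prob_measures S" and M: "0 \<le> M"
    and R: "\<And>x y. x \<in> S \<Longrightarrow> y \<in> S \<Longrightarrow> R \<le> \<bar>x\<bar> \<Longrightarrow> E x y \<le> exp (- M)"
  shows "(M + B) * measure \<mu> {x \<in> S. R \<le> \<bar>x\<bar>} - B \<le> cutoff_energy M \<mu>"
proof -
  interpret prob_space \<mu> using borel_prob_measuresD[OF \<mu>] by simp
  note [simp] = borel_prob_measuresD(3)[OF \<mu>]
  let ?A = "{x \<in> S. R \<le> \<bar>x\<bar>}"
  have [measurable]: "(\<lambda>x. x) \<in> borel_measurable \<mu>"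
    by (rule borel_measurable_borel_prob_measure[OF \<mu>]) simp
  have A: "?A \<in> sets \<mu>"
  proof -
    have "{x \<in> space \<mu>. R \<le> \<bar>x\<bar>} \<in> sets \<mu>" by measurable
    then show ?thesis by simp
  qed
  have "(M + B) * measure \<mu> ?A - B = (\<integral>x. (M + B) * indicator ?A x - B \<partial>\<mu>)"
    using A prob_space sets.sets_into_space[OF A]
    by (subst Bochner_Integration.integral_diff) (auto simp: Int_absorb2 emeasure_eq_measure)
  also have "\<dots> \<le> (\<integral>x. \<integral>y. cutoff M x y \<partial>\<mu> \<partial>\<mu>)"
  proof (rule integral_mono)
    fix x assume x: "x \<in> space \<mu>"
    show "(M + B) * indicator ?A x - B \<le> (\<integral>y. cutoff M x y \<partial>\<mu>)"
    proof (cases "x \<in> ?A")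
      case True
      have "(\<integral>y. cutoff M x y \<partial>\<mu>) = (\<integral>y. M \<partial>\<mu>)"
        using True R by (intro Bochner_Integration.integral_cong) (auto simp: cutoff_def max_absorb1)
      then show ?thesis using True prob_space by simp
    next
      case False
      have "(\<integral>y. - B \<partial>\<mu>) \<le> (\<integral>y. cutoff M x y \<partial>\<mu>)"
        using x integrable_cutoff[OF \<mu> M] cutoff_ge M by (intro integral_mono) auto
      then show ?thesis using False prob_space by simp
    qed
  next
    show "integrable \<mu> (\<lambda>x. (M + B) * indicator ?A x - B :: real)"
      using A by (intro Bochner_Integration.integrable_diff integrable_mult_right
          integrable_real_indicator) (auto simp: emeasure_eq_measure)
    show "integrable \<mu> (\<lambda>x. \<integral>y. cutoff M x y \<partial>\<mu>)" by (rule integrable_cutoff(2)[OF \<mu> M])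
  qed
  finally show ?thesis by (simp add: cutoff_energy_def)
qed

lemma measure_to_line:
  assumes "\<mu> \<in> borel_prob_measures S" "A \<in> sets borel"
  shows "measure (to_line \<mu>) A = measure \<mu> (A \<inter> S)"
  unfolding to_line_def using assms borel_measurable_borel_prob_measure[OF assms(1), of "\<lambda>x. x"]
    borel_prob_measuresD(3)[OF assms(1)]
  by (subst measure_distr) auto

lemma single_measure_tight:
  assumes \<mu>: "\<mu> \<in> borel_prob_measures S" and e: "e > 0"
  shows "\<exists>R. measure (to_line \<mu>) {-R<..R} > 1 - e"
proof -
  interpret L: real_distribution "to_line \<mu>" using \<mu> by (rule real_distribution_to_line)
  have U: "(\<Union>i::nat. {-real i<..real i}) = UNIV"
  proof -
    have "\<exists>i::nat. -real i < x \<and> x \<le> real i" for x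
    proof -
      obtain i :: nat where "\<bar>x\<bar> < real i" using reals_Archimedean2 by blast
      then have "- real i < x \<and> x \<le> real i" by linarith
      then show ?thesis by blast
    qed
    then show ?thesis by auto
  qed
  have "(\<lambda>i. measure (to_line \<mu>) {-real i<..real i}) \<longlonglongrightarrow> measure (to_line \<mu>) (\<Union>i::nat. {-real i<..real i})"
    by (rule L.finite_Lim_measure_incseq) (auto simp: incseq_def to_line_def)
  then have "(\<lambda>i. measure (to_line \<mu>) {-real i<..real i}) \<longlonglongrightarrow> 1"
    unfolding U using L.prob_space by (simp add: to_line_def)
  then have "eventually (\<lambda>i. 1 - e < measure (to_line \<mu>) {-real i<..real i}) sequentially"
    using e by (intro order_tendstoD(1)) auto
  then show ?thesis by (auto simp: eventually_sequentially)
qed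

text \<open>By \<open>cutoff_energy_tail\<close> a mass of \<open>e\<close> far out makes the energy truncated at level \<open>m\<close> at least \<open>m e
  - B\<close>, which exceeds the bound for some \<open>m\<close>. This controls all members of the sequence from index
  \<open>m\<close> on; the finitely many others are tight individually.\<close>

lemma cutoff_energy_bounded_imp_tight:
  assumes \<sigma>: "\<And>k. \<sigma> k \<in> borel_prob_measures S"
    and bd: "\<And>k. cutoff_energy (real k) (\<sigma> k) \<le> a"
  shows "tight (\<lambda>k. to_line (\<sigma> k))"
  unfolding tight_def
proof (intro conjI allI impI)
  show "real_distribution (to_line (\<sigma> n))" for n using \<sigma> by (rule real_distribution_to_line)
  fix e :: real assume e: "e > 0"
  obtain m :: nat where m: "(\<bar>a + B\<bar> + 1) / e < real m" using reals_Archimedean2 by blast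
  have "(\<bar>a + B\<bar> + 1) / e > 0" using e by simp
  then have m0: "real m > 0" using m by linarith
  obtain R where R: "\<And>x y. x \<in> S \<Longrightarrow> y \<in> S \<Longrightarrow> R \<le> \<bar>x\<bar> \<Longrightarrow> E x y \<le> exp (- real m)"
    using E_vanishes[of "exp (- real m)"] by auto
  have tail: "measure (\<sigma> k) {x \<in> S. R \<le> \<bar>x\<bar>} < e" if "k \<ge> m" for k
  proof (rule ccontr)
    assume "\<not> ?thesis"
    then have "e \<le> measure (\<sigma> k) {x \<in> S. R \<le> \<bar>x\<bar>}" by simp
    then have "(real m + B) * e \<le> (real m + B) * measure (\<sigma> k) {x \<in> S. R \<le> \<bar>x\<bar>}"
      using m0 B_nonneg by (intro mult_left_mono) auto
    also have "\<dots> \<le> cutoff_energy (real m) (\<sigma> k) + B"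
      using cutoff_energy_tail[of "\<sigma> k" "real m" R] \<sigma>[of k] m0 R by simp
    also have "\<dots> \<le> cutoff_energy (real k) (\<sigma> k) + B" using that by (intro add_right_mono cutoff_energy_mono \<sigma>) auto
    also have "\<dots> \<le> a + B" using bd by simp
    finally have "real m * e + B * e \<le> a + B" by (simp add: algebra_simps)
    moreover have "0 \<le> B * e" using B_nonneg e by simp
    ultimately have "real m * e \<le> a + B" by linarith
    then show False using m e by (simp add: divide_less_eq)
  qed
  obtain r where r: "\<And>k. measure (to_line (\<sigma> k)) {-r k<..r k} > 1 - e"
    using single_measure_tight[OF \<sigma> e] by metis
  define T where "T = Max (insert (\<bar>R\<bar> + 1) ((\<lambda>k. \<bar>r k\<bar>) ` {..<m}))"
  have T: "\<bar>R\<bar> + 1 \<le> T" "\<And>k. k < m \<Longrightarrow> \<bar>r k\<bar> \<le> T" by (auto simp: T_def)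
  have "measure (to_line (\<sigma> n)) {-T<..T} > 1 - e" for n
  proof (cases "n < m")
    case True
    interpret L: real_distribution "to_line (\<sigma> n)" using \<sigma> by (rule real_distribution_to_line)
    have "measure (to_line (\<sigma> n)) {-r n<..r n} \<le> measure (to_line (\<sigma> n)) {-T<..T}"
      using T(2)[OF True] by (intro L.finite_measure_mono) (auto simp: to_line_def)
    then show ?thesis using r[of n] by simp
  next
    case False
    interpret P: prob_space "\<sigma> n" using borel_prob_measuresD[OF \<sigma>] by simp
    have [measurable]: "(\<lambda>x. x) \<in> borel_measurable (\<sigma> n)"
      by (rule borel_measurable_borel_prob_measure[OF \<sigma>]) simp
    note sp = borel_prob_measuresD(3)[OF \<sigma>[of n]]
    have A: "{x \<in> space (\<sigma> n). R \<le> \<bar>x\<bar>} \<in> sets (\<sigma> n)" "{x \<in> space (\<sigma> n). -T < x \<and> x \<le> T} \<in> sets (\<sigma> n)"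
      by measurable
    have "1 - e < 1 - measure (\<sigma> n) {x \<in> S. R \<le> \<bar>x\<bar>}" using tail False by auto
    also have "\<dots> = measure (\<sigma> n) (space (\<sigma> n) - {x \<in> S. R \<le> \<bar>x\<bar>})"
      using A(1) sp by (intro P.prob_compl[symmetric]) auto
    also have "\<dots> \<le> measure (\<sigma> n) ({-T<..T} \<inter> S)"
    proof (rule P.finite_measure_mono)
      have "{-T<..T} \<inter> S = {x \<in> space (\<sigma> n). -T < x \<and> x \<le> T}" using sp by auto
      then show "{-T<..T} \<inter> S \<in> sets (\<sigma> n)" using A(2) by simp
    qed (use sp T(1) in auto)
    also have "\<dots> = measure (to_line (\<sigma> n)) {-T<..T}" by (rule measure_to_line[symmetric, OF \<sigma>]) simp
    finally show ?thesis .
  qed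
  moreover have "-T < T" using T(1) by linarith
  ultimately show "\<exists>a b. a < b \<and> (\<forall>n. 1 - e < measure (to_line (\<sigma> n)) {a<..b})" by blast
qed

text \<open>Weak continuity holds only at a fixed truncation level \<open>m\<close>; by monotonicity the level of late
  members of the sequence may be lowered to \<open>m\<close> before passing to the limit.\<close>

lemma cutoff_energy_bounded_imp_limit:
  assumes \<sigma>: "\<And>k. \<sigma> k \<in> borel_prob_measures S"
    and bd: "\<And>k. cutoff_energy (real k) (\<sigma> k) \<le> a"
  obtains r \<mu> where "strict_mono r" "\<mu> \<in> borel_prob_measures S"
    "limitin (weak_topology S) (\<sigma> \<circ> r) \<mu> sequentially" "\<And>m::nat. cutoff_energy (real m) \<mu> \<le> a"
proof -
  obtain r \<mu> where r: "strict_mono r" "\<mu> \<in> borel_prob_measures S"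
    "limitin (weak_topology S) (\<sigma> \<circ> r) \<mu> sequentially"
    using tight_imp_convergent_subsequence[OF \<sigma> cutoff_energy_bounded_imp_tight[OF \<sigma> bd]] by blast
  have "cutoff_energy (real m) \<mu> \<le> a" for m
  proof (rule LIMSEQ_le_const2)
    show "(\<lambda>n. cutoff_energy (real m) ((\<sigma> \<circ> r) n)) \<longlonglongrightarrow> cutoff_energy (real m) \<mu>"
      by (rule tendsto_cutoff_energy[OF r(2) _ r(3)]) (use \<sigma> in auto)
    have "cutoff_energy (real m) ((\<sigma> \<circ> r) n) \<le> a" if "n \<ge> m" for n
    proof -
      have "m \<le> r n" using that seq_suble[OF r(1), of n] by simp
      then have "cutoff_energy (real m) (\<sigma> (r n)) \<le> cutoff_energy (real (r n)) (\<sigma> (r n))"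
        by (intro cutoff_energy_mono \<sigma>) auto
      then show ?thesis using bd[of "r n"] by simp
    qed
    then show "\<exists>N. \<forall>n\<ge>N. cutoff_energy (real m) ((\<sigma> \<circ> r) n) \<le> a" by blast
  qed
  with r that show ?thesis by blast
qed

lemma borel_measurable_log_kernel:
  assumes \<mu>: "\<mu> \<in> borel_prob_measures S"
  shows "(\<lambda>(x, y). log_kernel x y) \<in> borel_measurable (\<mu> \<Otimes>\<^sub>M \<mu>)"
proof -
  note [measurable] = borel_measurable_pair_S[OF \<mu> cont_E, unfolded case_prod_unfold]
  show ?thesis unfolding log_kernel_def case_prod_unfold by measurable
qed

lemma borel_measurable_shifted_kernel:
  assumes \<mu>: "\<mu> \<in> borel_prob_measures S"
  shows "(\<lambda>(x, y). shifted_kernel x y) \<in> borel_measurable (\<mu> \<Otimes>\<^sub>M \<mu>)"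
  using borel_measurable_log_kernel[OF \<mu>] unfolding shifted_kernel_def case_prod_unfold by measurable

lemma shifted_kernel_pos: "E x y > 0 \<Longrightarrow> shifted_kernel x y = ennreal (B - ln (E x y))"
  by (simp add: shifted_kernel_def log_kernel_def e2ennreal_ereal add.commute)

lemma log_energy_shifted:
  assumes \<mu>: "\<mu> \<in> borel_prob_measures S"
  shows "log_energy \<mu> = enn2ereal (shifted_energy \<mu>) - ereal B"
proof -
  interpret prob_space \<mu> using borel_prob_measuresD[OF \<mu>] by simp
  have lb: "ereal (- B) \<le> (\<lambda>(x, y). log_kernel x y) z" if zin: "z \<in> space (\<mu> \<Otimes>\<^sub>M \<mu>)" for z
  proof -
    obtain x y where z: "z = (x, y)" "x \<in> S" "y \<in> S"
      using zin unfolding space_pair_measure borel_prob_measuresD(3)[OF \<mu>] by blast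
    have "ln (E x y) \<le> B" if "E x y > 0"
      using E_le[OF z(2,3)] that by (metis exp_gt_zero ln_exp ln_le_cancel_iff)
    then show ?thesis using z by (auto simp: log_kernel_def)
  qed
  have "prob_space (\<mu> \<Otimes>\<^sub>M \<mu>)" by (rule prob_space_pair) (rule borel_prob_measuresD(1)[OF \<mu>])+
  from ereal_integral_bounded_below[OF this borel_measurable_log_kernel[OF \<mu>] B_nonneg lb]
  have "log_energy \<mu> = enn2ereal (\<integral>\<^sup>+z. (\<lambda>(x, y). shifted_kernel x y) z \<partial>(\<mu> \<Otimes>\<^sub>M \<mu>)) - ereal B"
    by (simp add: log_energy_def shifted_kernel_def case_prod_unfold)
  then show ?thesis unfolding shifted_energy_def
    using nn_integral_fst[OF borel_measurable_shifted_kernel[OF \<mu>]] by simp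
qed

lemma shifted_energy_cutoff:
  assumes \<mu>: "\<mu> \<in> borel_prob_measures S"
  shows "shifted_energy \<mu> = (SUP m::nat. ennreal (cutoff_energy (real m) \<mu> + B))"
proof -
  interpret prob_space \<mu> using borel_prob_measuresD[OF \<mu>] by simp
  note [simp] = borel_prob_measuresD(3)[OF \<mu>]
  let ?f = "\<lambda>(m::nat) x y. ennreal (cutoff (real m) x y + B)"
  have mono: "m \<le> m' \<Longrightarrow> ?f m x y \<le> ?f m' x y" for m m' x y
    by (intro ennreal_leI add_right_mono cutoff_mono) simp
  have sup: "shifted_kernel x y = (SUP m. ?f m x y)" for x y
  proof -
    have "(\<lambda>m. ?f m x y) \<longlonglongrightarrow> shifted_kernel x y"
    proof (cases "E x y > 0")
      case True
      obtain k :: nat where k: "- ln (E x y) < real k" using reals_Archimedean2 by blast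
      have "?f m x y = shifted_kernel x y" if "m \<ge> k" for m
      proof -
        have "exp (- real m) \<le> exp (ln (E x y))" using k that by (subst exp_le_cancel_iff) simp
        then have "exp (- real m) \<le> E x y" using True by simp
        then show ?thesis using True by (simp add: cutoff_def max_def shifted_kernel_pos)
      qed
      then show ?thesis by (intro tendsto_eventually) (auto simp: eventually_sequentially)
    next
      case False
      then have "?f m x y = ennreal (real m + B)" for m
        using order_less_le_trans[OF exp_gt_zero[of "- real m"], of "E x y"] by (auto simp: cutoff_def max_def add.commute)
      moreover have "(\<lambda>m. ennreal (real m + B)) \<longlonglongrightarrow> \<infinity>"
        unfolding infinity_ennreal_def ennreal_tendsto_top_eq_at_top
        by (rule filterlim_at_top_mono[OF filterlim_real_sequentially]) (use B_nonneg in auto)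
      ultimately show ?thesis using False by (simp add: shifted_kernel_def log_kernel_def)
    qed
    moreover have "(\<lambda>m. ?f m x y) \<longlonglongrightarrow> (SUP m. ?f m x y)"
      by (rule LIMSEQ_SUP) (auto simp: incseq_def intro: mono)
    ultimately show ?thesis by (rule LIMSEQ_unique)
  qed
  note m = borel_measurable_pair_S[OF \<mu> continuous_on_cutoff]
  have m1: "(\<lambda>y. ?f n x y) \<in> borel_measurable \<mu>" if "x \<in> S" for n x
    using measurable_compose[OF measurable_Pair1' m, of x] that by simp
  have m2: "(\<lambda>x. \<integral>\<^sup>+y. ?f n x y \<partial>\<mu>) \<in> borel_measurable \<mu>" for n
  proof (rule borel_measurable_nn_integral)
    show "(\<lambda>(x, y). ?f n x y) \<in> borel_measurable (\<mu> \<Otimes>\<^sub>M \<mu>)"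
      using m[of "real n"] unfolding case_prod_unfold by measurable
  qed
  have "shifted_energy \<mu> = (\<integral>\<^sup>+x. \<integral>\<^sup>+y. (SUP m. ?f m x y) \<partial>\<mu> \<partial>\<mu>)"
    unfolding shifted_energy_def sup ..
  also have "\<dots> = (\<integral>\<^sup>+x. (SUP m. \<integral>\<^sup>+y. ?f m x y \<partial>\<mu>) \<partial>\<mu>)"
    by (intro nn_integral_cong nn_integral_monotone_convergence_SUP m1) (auto simp: incseq_def le_fun_def intro: mono)
  also have "\<dots> = (SUP m. \<integral>\<^sup>+x. \<integral>\<^sup>+y. ?f m x y \<partial>\<mu> \<partial>\<mu>)"
    by (intro nn_integral_monotone_convergence_SUP m2)
       (auto simp: incseq_def le_fun_def intro!: nn_integral_mono mono)
  also have "\<dots> = (SUP m::nat. ennreal (cutoff_energy (real m) \<mu> + B))"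
  proof (rule SUP_cong[OF refl])
    fix n :: nat
    note i = integrable_cutoff[OF \<mu>, of "real n"]
    have g: "0 \<le> cutoff (real n) x y + B" if "x \<in> S" "y \<in> S" for x y
      using cutoff_ge[OF that, of "real n"] by linarith
    have eq: "(\<integral>\<^sup>+y. ?f n x y \<partial>\<mu>) = ennreal ((\<integral>y. cutoff (real n) x y \<partial>\<mu>) + B)" if "x \<in> S" for x
    proof -
      have "(\<integral>\<^sup>+y. ?f n x y \<partial>\<mu>) = ennreal (\<integral>y. cutoff (real n) x y + B \<partial>\<mu>)"
        using that i by (intro nn_integral_eq_integral AE_I2 g) auto
      then show ?thesis using that i prob_space by simp
    qed
    have nn: "0 \<le> (\<integral>y. cutoff (real n) x y \<partial>\<mu>) + B" if "x \<in> S" for x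
    proof -
      have "(\<integral>y. - B \<partial>\<mu>) \<le> (\<integral>y. cutoff (real n) x y \<partial>\<mu>)"
        using that i cutoff_ge by (intro integral_mono) auto
      then show ?thesis using prob_space by simp
    qed
    have "(\<integral>\<^sup>+x. \<integral>\<^sup>+y. ?f n x y \<partial>\<mu> \<partial>\<mu>) = (\<integral>\<^sup>+x. ennreal ((\<integral>y. cutoff (real n) x y \<partial>\<mu>) + B) \<partial>\<mu>)"
      by (rule nn_integral_cong) (simp add: eq)
    also have "\<dots> = ennreal (\<integral>x. (\<integral>y. cutoff (real n) x y \<partial>\<mu>) + B \<partial>\<mu>)"
      using i nn by (intro nn_integral_eq_integral) (auto intro!: AE_I2)
    also have "\<dots> = ennreal (cutoff_energy (real n) \<mu> + B)"
      using i prob_space by (simp add: cutoff_energy_def)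
    finally show "(\<integral>\<^sup>+x. \<integral>\<^sup>+y. ?f n x y \<partial>\<mu> \<partial>\<mu>) = ennreal (cutoff_energy (real n) \<mu> + B)" .
  qed
  finally show ?thesis .
qed

lemma cutoff_energy_ge:
  assumes \<mu>: "\<mu> \<in> borel_prob_measures S" and "0 \<le> M"
  shows "- B \<le> cutoff_energy M \<mu>"
proof -
  interpret prob_space \<mu> using borel_prob_measuresD[OF \<mu>] by simp
  obtain R where "\<And>x y. x \<in> S \<Longrightarrow> y \<in> S \<Longrightarrow> R \<le> \<bar>x\<bar> \<Longrightarrow> E x y \<le> exp (- M)"
    using E_vanishes[of "exp (- M)"] by auto
  from cutoff_energy_tail[OF \<mu> assms(2) this]
  have "(M + B) * measure \<mu> {x \<in> S. R \<le> \<bar>x\<bar>} - B \<le> cutoff_energy M \<mu>" .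
  moreover have "0 \<le> (M + B) * measure \<mu> {x \<in> S. R \<le> \<bar>x\<bar>}" using assms(2) B_nonneg by simp
  ultimately show ?thesis by linarith
qed

text \<open>Sublevel sets of the energy are intersections of sublevel sets of weakly continuous functions.\<close>

lemma log_energy_le_iff:
  assumes \<mu>: "\<mu> \<in> borel_prob_measures S"
  shows "log_energy \<mu> \<le> ereal a \<longleftrightarrow> (\<forall>m::nat. cutoff_energy (real m) \<mu> \<le> a)"
proof -
  have "log_energy \<mu> \<le> ereal a \<longleftrightarrow> enn2ereal (shifted_energy \<mu>) \<le> ereal (a + B)"
    unfolding log_energy_shifted[OF \<mu>] by (cases "enn2ereal (shifted_energy \<mu>)") auto
  also have "\<dots> \<longleftrightarrow> (\<forall>m::nat. cutoff_energy (real m) \<mu> \<le> a)"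
  proof (cases "a + B \<ge> 0")
    case True
    then have "enn2ereal (shifted_energy \<mu>) \<le> ereal (a + B) \<longleftrightarrow> shifted_energy \<mu> \<le> ennreal (a + B)"
      by (simp add: less_eq_ennreal.rep_eq)
    then show ?thesis unfolding shifted_energy_cutoff[OF \<mu>] SUP_le_iff using True by (simp add: ennreal_le_iff)
  next
    case False
    then have "\<not> enn2ereal (shifted_energy \<mu>) \<le> ereal (a + B)"
      using enn2ereal_nonneg[of "shifted_energy \<mu>"] by (metis ereal_less_eq(5) order_trans)
    moreover have "\<not> cutoff_energy (real 0) \<mu> \<le> a" using cutoff_energy_ge[OF \<mu>, of "real 0"] False by auto
    ultimately show ?thesis by blast
  qed
  finally show ?thesis .
qed

lemma log_energy_ge: "\<mu> \<in> borel_prob_measures S \<Longrightarrow> ereal (- B) \<le> log_energy \<mu>"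
  using enn2ereal_nonneg[of "shifted_energy \<mu>"] unfolding log_energy_shifted
  by (cases "enn2ereal (shifted_energy \<mu>)") simp_all

lemma openin_log_energy_greater:
  "openin (weak_topology S) {\<mu> \<in> borel_prob_measures S. ereal a < log_energy \<mu>}"
proof (rule openin_weak_topology_sequentially)
  fix \<sigma> \<mu> assume \<mu>: "\<mu> \<in> {\<mu> \<in> borel_prob_measures S. ereal a < log_energy \<mu>}"
    and \<sigma>: "\<And>n. \<sigma> n \<in> borel_prob_measures S" and lim: "limitin (weak_topology S) \<sigma> \<mu> sequentially"
  then obtain m :: nat where m: "a < cutoff_energy (real m) \<mu>"
    using log_energy_le_iff[of \<mu> a] by (auto simp: not_le[symmetric])
  have "(\<lambda>n. cutoff_energy (real m) (\<sigma> n)) \<longlonglongrightarrow> cutoff_energy (real m) \<mu>"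
    using \<mu> by (intro tendsto_cutoff_energy \<sigma> lim) auto
  then have "eventually (\<lambda>n. a < cutoff_energy (real m) (\<sigma> n)) sequentially" using m by (rule order_tendstoD)
  then obtain n where "a < cutoff_energy (real m) (\<sigma> n)" by (auto simp: eventually_sequentially)
  then have "\<not> log_energy (\<sigma> n) \<le> ereal a" unfolding log_energy_le_iff[OF \<sigma>] by (auto simp: not_le)
  then show "\<exists>n. \<sigma> n \<in> {\<mu> \<in> borel_prob_measures S. ereal a < log_energy \<mu>}" using \<sigma> by (auto simp: not_le)
qed auto

lemma compactin_log_energy_le:
  "compactin (weak_topology S) {\<mu> \<in> borel_prob_measures S. log_energy \<mu> \<le> ereal a}"
  unfolding compactin_weak_topology_sequentially
proof (intro conjI allI impI)
  fix \<sigma> :: "nat \<Rightarrow> real measure" assume "range \<sigma> \<subseteq> {\<mu> \<in> borel_prob_measures S. log_energy \<mu> \<le> ereal a}"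
  then have \<sigma>: "\<sigma> k \<in> borel_prob_measures S" "log_energy (\<sigma> k) \<le> ereal a" for k by auto
  have bd: "cutoff_energy (real k) (\<sigma> k) \<le> a" for k using \<sigma>(2)[of k] log_energy_le_iff[OF \<sigma>(1)] by blast
  obtain r \<mu> where "strict_mono r" "\<mu> \<in> borel_prob_measures S"
    "limitin (weak_topology S) (\<sigma> \<circ> r) \<mu> sequentially" "\<And>m::nat. cutoff_energy (real m) \<mu> \<le> a"
    using cutoff_energy_bounded_imp_limit[OF \<sigma>(1) bd] by metis
  then show "\<exists>l r. l \<in> {\<mu> \<in> borel_prob_measures S. log_energy \<mu> \<le> ereal a} \<and> strict_mono r \<and>
      limitin (weak_topology S) (\<sigma> \<circ> r) l sequentially"
    using log_energy_le_iff[of \<mu> a] by blast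
qed auto

text \<open>A Dini type argument. If every truncation level failed for some measure in \<open>A\<close>, these measures would
  accumulate at a point of \<open>A\<close> of energy at most \<open>a\<close>.\<close>

lemma cutoff_energy_uniform_on_closed:
  assumes A: "closedin (weak_topology S) A" and a: "\<And>\<mu>. \<mu> \<in> A \<Longrightarrow> ereal a < log_energy \<mu>"
  shows "\<exists>m::nat. \<forall>\<mu>\<in>A. a < cutoff_energy (real m) \<mu>"
proof (rule ccontr)
  assume "\<not> ?thesis"
  then obtain \<sigma> where \<sigma>: "\<And>m::nat. \<sigma> m \<in> A" "\<And>m. cutoff_energy (real m) (\<sigma> m) \<le> a"
    by (metis not_less)
  have "A \<subseteq> borel_prob_measures S" using closedin_subset[OF A] by simp
  then have \<sigma>': "\<sigma> m \<in> borel_prob_measures S" for m using \<sigma>(1) by auto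
  obtain r \<mu> where r: "strict_mono r" "\<mu> \<in> borel_prob_measures S"
    "limitin (weak_topology S) (\<sigma> \<circ> r) \<mu> sequentially" "\<And>m::nat. cutoff_energy (real m) \<mu> \<le> a"
    using cutoff_energy_bounded_imp_limit[OF \<sigma>' \<sigma>(2)] by metis
  have "\<mu> \<in> A"
    using limitin_closedin[OF r(3) A] \<sigma>(1) by auto
  then show False using a[of \<mu>] log_energy_le_iff[OF r(2), of a] r(4) by auto
qed

end

section \<open>Empirical measures and the masses of their events\<close>

(* Components of vectors have indices in {1..m}; the simplifier should keep the literal 1. *)
declare One_nat_def [simp del]

lemma empirical_measure_eq_distr:
  fixes S :: "'a::topological_space set"
  assumes m: "m \<ge> 1" and x: "\<And>j. j \<in> {1..m} \<Longrightarrow> x j \<in> S"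
  shows "empirical_measure S m x = distr (uniform_count_measure {1..m}) (restrict_space borel S) x"
proof -
  let ?R = "restrict_space borel S :: 'a measure" and ?U = "uniform_count_measure {1..m}"
  let ?D = "distr ?U ?R x"
  have xm: "x \<in> ?U \<rightarrow>\<^sub>M ?R"
    using x by (auto simp: measurable_def space_uniform_count_measure sets_uniform_count_measure space_restrict_space)
  have "empirical_measure S m x = measure_of (space ?D) (sets ?D) (emeasure ?D)"
    unfolding empirical_measure_def space_distr sets_distr space_restrict_space space_borel Int_UNIV_right
  proof (rule measure_of_eq)
    show "sets ?R \<subseteq> Pow S" using sets.sets_into_space[of _ ?R] by (auto simp: space_restrict_space)
    fix A assume "A \<in> sigma_sets S (sets ?R)"
    then have A: "A \<in> sets ?R" using sets.sigma_sets_eq[of ?R] by (simp add: space_restrict_space)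
    have "emeasure ?D A = emeasure ?U (x -` A \<inter> {1..m})"
      using emeasure_distr[OF xm A] by (simp add: space_uniform_count_measure)
    also have "\<dots> = ennreal (card (x -` A \<inter> {1..m}) / card {1..m})"
      by (subst emeasure_uniform_count_measure) auto
    also have "\<dots> = of_nat (card (x -` A \<inter> {1..m})) / of_nat m"
      using m by (simp add: divide_ennreal[symmetric] ennreal_of_nat_eq_real_of_nat)
    also have "of_nat (card (x -` A \<inter> {1..m})) = (\<Sum>j=1..m. indicator A (x j) :: ennreal)"
    proof -
      have "(\<Sum>j=1..m. indicator A (x j) :: ennreal) = (\<Sum>j\<in>{1..m}. indicator (x -` A) j)"
        by (simp add: indicator_def)
      also have "\<dots> = of_nat (card ({1..m} \<inter> x -` A))"
        by (simp add: indicator_def sum.If_cases Int_def vimage_def)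
      finally show ?thesis by (simp add: Int_commute)
    qed
    also have "\<dots> = (\<Sum>j=1..m. emeasure (return ?R (x j)) A)"
      using A by simp
    finally show "(\<Sum>j=1..m. emeasure (return ?R (x j)) A) / of_nat m = emeasure ?D A" by simp
  qed
  then show ?thesis by (simp only: measure_of_of_measure)
qed

lemma empirical_measure_in:
  fixes S :: "'a::topological_space set"
  assumes m: "m \<ge> 1" and x: "\<And>j. j \<in> {1..m} \<Longrightarrow> x j \<in> S"
  shows "empirical_measure S m x \<in> borel_prob_measures S"
proof -
  interpret prob_space "uniform_count_measure {1..m}" by (rule prob_space_uniform_count_measure) (use m in auto)
  have "x \<in> uniform_count_measure {1..m} \<rightarrow>\<^sub>M restrict_space borel S"
    using x by (auto simp: measurable_def space_uniform_count_measure sets_uniform_count_measure space_restrict_space)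
  then have "prob_space (distr (uniform_count_measure {1..m}) (restrict_space borel S) x)"
    by (rule prob_space_distr)
  then show ?thesis using empirical_measure_eq_distr[of m x S] assms
    unfolding borel_prob_measures_def by simp
qed

lemma integral_empirical_measure:
  fixes S :: "'a::topological_space set" and f :: "'a \<Rightarrow> real"
  assumes m: "m \<ge> 1" and x: "\<And>j. j \<in> {1..m} \<Longrightarrow> x j \<in> S"
    and f: "f \<in> borel_measurable (restrict_space borel S)"
  shows "(\<integral>y. f y \<partial>empirical_measure S m x) = (\<Sum>j=1..m. f (x j)) / real m"
proof -
  have "x \<in> uniform_count_measure {1..m} \<rightarrow>\<^sub>M restrict_space borel S"
    using x by (auto simp: measurable_def space_uniform_count_measure sets_uniform_count_measure space_restrict_space)
  then have "(\<integral>y. f y \<partial>empirical_measure S m x) = (\<integral>j. f (x j) \<partial>uniform_count_measure {1..m})"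
    using f empirical_measure_eq_distr[of m x S] m x by (simp add: integral_distr)
  also have "\<dots> = (\<Sum>j=1..m. f (x j)) / real m" by (simp add: integral_uniform_count_measure)
  finally show ?thesis .
qed

lemma empirical_measure_cong:
  assumes "\<And>j. j \<in> {1..m} \<Longrightarrow> x j = y j"
  shows "empirical_measure S m x = empirical_measure S m y"
proof -
  have "(\<Sum>j=1..m. emeasure (return (restrict_space borel S) (x j)) A) =
      (\<Sum>j=1..m. emeasure (return (restrict_space borel S) (y j)) A)" for A
    using assms by (intro sum.cong) auto
  then show ?thesis unfolding empirical_measure_def by simp
qed

lemma finite_index_pairs: "finite {(i, j). 1 \<le> i \<and> i < j \<and> j \<le> (m::nat)}"
  by (rule finite_subset[of _ "{1..m} \<times> {1..m}"]) auto

lemma continuous_map_empirical_measure: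
  fixes S :: "real set"
  assumes m: "m \<ge> 1"
  shows "continuous_map (top_of_set {z::nat \<Rightarrow> real. \<forall>j\<in>{1..m}. z j \<in> S}) (weak_topology S) (empirical_measure S m)"
  unfolding weak_topology_def
proof (rule continuous_on_generated_topo)
  let ?D = "{z::nat \<Rightarrow> real. \<forall>j\<in>{1..m}. z j \<in> S}"
  fix U assume "U \<in> {{\<mu> \<in> borel_prob_measures S. (\<integral>x. f x \<partial>\<mu>) \<in> V} | (f :: real \<Rightarrow> real) V.
        continuous_on S f \<and> bounded (f ` S) \<and> open V}"
  then obtain f :: "real \<Rightarrow> real" and V where U: "U = {\<mu> \<in> borel_prob_measures S. (\<integral>x. f x \<partial>\<mu>) \<in> V}"
    and f: "continuous_on S f" "open V" by blast
  have eq: "empirical_measure S m -` U \<inter> ?D = ?D \<inter> (\<lambda>z. (\<Sum>j=1..m. f (z j)) / real m) -` V"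
    using empirical_measure_in[OF m, of _ S] integral_empirical_measure[OF m, of _ S f]
      borel_measurable_continuous_on_restrict[OF f(1)] unfolding U by auto
  have "continuous_on ?D (\<lambda>z. (\<Sum>j=1..m. f (z j)) / real m)"
  proof (intro continuous_intros)
    fix j assume "j \<in> {1..m}"
    then show "continuous_on ?D (\<lambda>z. f (z j))"
      by (intro continuous_on_compose2[OF f(1)] continuous_on_subset[OF continuous_on_product_coordinates]) auto
  qed (use m in auto)
  then have "openin (top_of_set ?D) (?D \<inter> (\<lambda>z. (\<Sum>j=1..m. f (z j)) / real m) -` V)"
    using f(2) by (rule continuous_openin_preimage_gen)
  then show "openin (top_of_set ?D) (empirical_measure S m -` U \<inter> topspace (top_of_set ?D))"
    unfolding eq[symmetric] by simp
next
  have "borel_prob_measures S = \<Union> {{\<mu> \<in> borel_prob_measures S. (\<integral>x. f x \<partial>\<mu>) \<in> U} | (f :: real \<Rightarrow> real) U.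
        continuous_on S f \<and> bounded (f ` S) \<and> open U}"
    using topspace_weak_topology[of S] unfolding weak_topology_def topology_generated_by_topspace by (rule sym)
  then show "empirical_measure S m ` topspace (top_of_set {z. \<forall>j\<in>{1..m}. z j \<in> S}) \<subseteq>
     \<Union> {{\<mu> \<in> borel_prob_measures S. (\<integral>x. f x \<partial>\<mu>) \<in> U} | (f :: real \<Rightarrow> real) U.
        continuous_on S f \<and> bounded (f ` S) \<and> open U}"
    using empirical_measure_in[OF m, of _ S] by (simp add: image_subset_iff)
qed

context closed_real_interval
begin

text \<open>Open sets are available in the product topology of all functions on the natural numbers, so a vector
  is first extended by \<open>0\<close> beyond its last index. The component measures \<open>N j\<close> are kept general
  because the lemma serves Lebesgue measure, its restriction to \<open>S\<close> and sampling distributions.\<close>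

lemma sets_empirical_preimage:
  assumes m: "m \<ge> 1" and G: "openin (weak_topology S) G"
    and N: "\<And>j. j \<in> {1..m} \<Longrightarrow> (\<lambda>x. x) \<in> N j \<rightarrow>\<^sub>M borel" "\<And>j. j \<in> {1..m} \<Longrightarrow> S \<subseteq> space (N j)"
  shows "{x \<in> PiE {1..m} (\<lambda>_. S). empirical_measure S m x \<in> G} \<in> sets (PiM {1..m} N)"
proof -
  let ?D = "{z::nat \<Rightarrow> real. \<forall>j\<in>{1..m}. z j \<in> S}"
  let ?\<phi> = "\<lambda>x j. if j \<in> {1..m} then x j else 0 :: real"
  have "openin (top_of_set ?D) {z \<in> topspace (top_of_set ?D). empirical_measure S m z \<in> G}"
    by (rule openin_continuous_map_preimage[OF continuous_map_empirical_measure[OF m] G])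
  then obtain V where V: "open V" "{z \<in> ?D. empirical_measure S m z \<in> G} = ?D \<inter> V"
    by (auto simp: openin_open)
  have "closed ?D"
  proof -
    have "closed (\<Inter>j\<in>{1..m}. (\<lambda>z::nat \<Rightarrow> real. z j) -` S)"
      by (intro closed_INT ballI closed_vimage closed_S continuous_on_product_coordinates)
    moreover have "(\<Inter>j\<in>{1..m}. (\<lambda>z::nat \<Rightarrow> real. z j) -` S) = ?D" by auto
    ultimately show ?thesis by simp
  qed
  then have T: "?D \<inter> V \<in> sets (PiM UNIV (\<lambda>_. borel))"
    using V(1) unfolding sets_PiM_equal_borel by auto
  have \<phi>: "?\<phi> \<in> PiM {1..m} N \<rightarrow>\<^sub>M PiM UNIV (\<lambda>_. borel)"
  proof (rule measurable_PiM_single')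
    fix i :: nat
    show "(\<lambda>x. ?\<phi> x i) \<in> borel_measurable (PiM {1..m} N)"
    proof (cases "i \<in> {1..m}")
      case True
      have "(\<lambda>x. x i) \<in> PiM {1..m} N \<rightarrow>\<^sub>M N i" by (rule measurable_component_singleton[OF True])
      from measurable_compose[OF this N(1)[OF True]] show ?thesis using True by simp
    next
      case False
      then have "?\<phi> x i = 0" for x by auto
      then show ?thesis by (simp only: measurable_const UNIV_I space_borel)
    qed
  qed auto
  have "?\<phi> -` (?D \<inter> V) \<inter> space (PiM {1..m} N) \<in> sets (PiM {1..m} N)"
    using \<phi> T by (rule measurable_sets)
  moreover have "PiE {1..m} (\<lambda>_. S) \<in> sets (PiM {1..m} N)"
  proof (rule sets_PiM_I_finite)
    fix j assume j: "j \<in> {1..m}"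
    have "(\<lambda>x. x) -` S \<inter> space (N j) \<in> sets (N j)" using N(1)[OF j] closed_S by (intro measurable_sets) auto
    then show "S \<in> sets (N j)" using N(2)[OF j] by (simp add: Int_absorb2)
  qed simp
  moreover have "{x \<in> PiE {1..m} (\<lambda>_. S). empirical_measure S m x \<in> G} =
      (?\<phi> -` (?D \<inter> V) \<inter> space (PiM {1..m} N)) \<inter> PiE {1..m} (\<lambda>_. S)"
  proof -
    have "x \<in> PiE {1..m} (\<lambda>_. S) \<Longrightarrow> empirical_measure S m (?\<phi> x) = empirical_measure S m x" for x
      by (rule empirical_measure_cong) auto
    moreover have "PiE {1..m} (\<lambda>_. S) \<subseteq> space (PiM {1..m} N)"
      using N(2) by (fastforce simp: space_PiM PiE_iff)
    moreover have "x \<in> PiE {1..m} (\<lambda>_. S) \<Longrightarrow> ?\<phi> x \<in> ?D" for x by (auto simp: PiE_iff)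
    ultimately show ?thesis unfolding V(2)[symmetric] by auto
  qed
  ultimately show ?thesis by auto
qed

lemma measurable_empirical_measure:
  assumes m: "m \<ge> 1"
  shows "empirical_measure S m \<in> PiM {1..m} (\<lambda>_. restrict_space borel S) \<rightarrow>\<^sub>M borel_of (weak_topology S)"
  unfolding borel_of_def
proof (rule measurable_measure_of)
  show "{U. openin (weak_topology S) U} \<subseteq> Pow (topspace (weak_topology S))"
    using openin_subset by blast
  have sp: "space (PiM {1..m} (\<lambda>_. restrict_space borel S)) = PiE {1..m} (\<lambda>_. S)"
    by (simp add: space_PiM space_restrict_space)
  show "empirical_measure S m \<in> space (PiM {1..m} (\<lambda>_. restrict_space borel S)) \<rightarrow> topspace (weak_topology S)"
    unfolding sp using empirical_measure_in[OF m, of _ S] by (auto simp: PiE_iff)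
  fix G assume "G \<in> {U. openin (weak_topology S) U}"
  then have "openin (weak_topology S) G" by simp
  from sets_empirical_preimage[OF m this, of "\<lambda>_. restrict_space borel S"]
  have "{x \<in> PiE {1..m} (\<lambda>_. S). empirical_measure S m x \<in> G} \<in> sets (PiM {1..m} (\<lambda>_. restrict_space borel S))"
    by (simp add: space_restrict_space measurable_restrict_space1)
  moreover have "empirical_measure S m -` G \<inter> space (PiM {1..m} (\<lambda>_. restrict_space borel S)) =
      {x \<in> PiE {1..m} (\<lambda>_. S). empirical_measure S m x \<in> G}" unfolding sp by auto
  ultimately show "empirical_measure S m -` G \<inter> space (PiM {1..m} (\<lambda>_. restrict_space borel S)) \<in> sets (PiM {1..m} (\<lambda>_. restrict_space borel S))"
    by simp
qed

lemma sets_borel_of_weak_preimage: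
  assumes m: "m \<ge> 1" and G: "G \<in> sets (borel_of (weak_topology S))"
  shows "{x \<in> PiE {1..m} (\<lambda>_. S). empirical_measure S m x \<in> G} \<in> sets (PiM {1..m} (\<lambda>_. lborel :: real measure))"
proof -
  let ?T = "\<lambda>G. {x \<in> PiE {1..m} (\<lambda>_. S). empirical_measure S m x \<in> G}"
  let ?L = "PiM {1..m} (\<lambda>_. lborel :: real measure)"
  have top: "?T (topspace (weak_topology S)) \<in> sets ?L"
    by (rule sets_empirical_preimage[OF m openin_topspace]) auto
  have "x \<in> PiE {1..m} (\<lambda>_. S) \<Longrightarrow> empirical_measure S m x \<in> borel_prob_measures S" for x
    by (intro empirical_measure_in[OF m]) (auto simp: PiE_mem)
  then have eqt: "?T (topspace (weak_topology S)) = PiE {1..m} (\<lambda>_. S)" by auto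
  have "{U. openin (weak_topology S) U} \<subseteq> Pow (topspace (weak_topology S))"
    using openin_subset by blast
  then have "G \<in> sigma_sets (topspace (weak_topology S)) {U. openin (weak_topology S) U}"
    using G by (simp add: borel_of_def sets_measure_of)
  then show ?thesis
  proof (induction rule: sigma_sets.induct)
    case (Basic a)
    then show ?case by (intro sets_empirical_preimage[OF m]) auto
  next
    case (Compl a)
    have eq: "?T (topspace (weak_topology S) - a) = ?T (topspace (weak_topology S)) - ?T a" by auto
    show ?case unfolding eq by (rule sets.Diff[OF top Compl.IH])
  next
    case (Union a)
    have eq: "?T (\<Union>i. a i) = (\<Union>i. ?T (a i))" by auto
    show ?case unfolding eq by (rule sets.countable_nat_UN) (use Union.IH in auto)
  qed simp
qed

lemma ensemble_weight_nonneg: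
  assumes "\<And>x. x \<in> S \<Longrightarrow> 0 \<le> v x"
  shows "0 \<le> ensemble_weight \<beta> \<gamma> S v n m x"
proof (cases "x \<in> PiE {1..m} (\<lambda>_. S)")
  case True
  then have "0 \<le> (\<Prod>j=1..m. v (x j) ^ n)" using assms by (intro prod_nonneg) (auto simp: PiE_iff)
  moreover have "0 \<le> (\<Prod>(i, j)\<in>{(i, j). 1 \<le> i \<and> i < j \<and> j \<le> m}. \<bar>x i ^ \<gamma> - x j ^ \<gamma>\<bar> powr \<beta>)"
    by (intro prod_nonneg) auto
  ultimately show ?thesis using True by (simp add: ensemble_weight_def)
qed (simp add: ensemble_weight_def)

lemma borel_measurable_ensemble_weight:
  assumes "continuous_on S v"
  shows "ensemble_weight \<beta> \<gamma> S v n m \<in> borel_measurable (PiM {1..m} (\<lambda>_. lborel))"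
proof -
  let ?L = "PiM {1..m} (\<lambda>_. lborel :: real measure)"
  have [measurable]: "(\<lambda>x. v (proj x)) \<in> borel_measurable borel"
    using continuous_on_compose_proj[OF assms] by (rule borel_measurable_continuous_onI)
  have c[measurable]: "(\<lambda>x. x j) \<in> borel_measurable ?L" if "j \<in> {1..m}" for j
    using measurable_component_singleton[OF that, of "\<lambda>_. lborel :: real measure"] by simp
  have [measurable]: "PiE {1..m} (\<lambda>_. S) \<in> sets ?L"
    by (rule sets_PiM_I_finite) (use closed_S in auto)
  have eq: "ensemble_weight \<beta> \<gamma> S v n m x =
     (\<Prod>p\<in>{(i, j). 1 \<le> i \<and> i < j \<and> j \<le> m}. \<bar>x (fst p) ^ \<gamma> - x (snd p) ^ \<gamma>\<bar> powr \<beta>) *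
     (\<Prod>j=1..m. v (proj (x j)) ^ n) * indicator (PiE {1..m} (\<lambda>_. S)) x" for x
    by (cases "x \<in> PiE {1..m} (\<lambda>_. S)")
       (auto simp: ensemble_weight_def case_prod_unfold proj_id PiE_iff intro!: prod.cong)
  have 1: "(\<lambda>x. \<Prod>p\<in>{(i, j). 1 \<le> i \<and> i < j \<and> j \<le> m}. \<bar>x (fst p) ^ \<gamma> - x (snd p) ^ \<gamma>\<bar> powr \<beta>) \<in> borel_measurable ?L"
  proof (rule borel_measurable_prod)
    fix p assume "p \<in> {(i, j). 1 \<le> i \<and> i < j \<and> j \<le> m}"
    then have [measurable]: "(\<lambda>x. x (fst p)) \<in> borel_measurable ?L" "(\<lambda>x. x (snd p)) \<in> borel_measurable ?L"
      using c[of "fst p"] c[of "snd p"] by auto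
    show "(\<lambda>x. \<bar>x (fst p) ^ \<gamma> - x (snd p) ^ \<gamma>\<bar> powr \<beta>) \<in> borel_measurable ?L" by measurable
  qed
  have 2: "(\<lambda>x. \<Prod>j=1..m. v (proj (x j)) ^ n) \<in> borel_measurable ?L"
    by (intro borel_measurable_prod) measurable
  show ?thesis unfolding eq using 1 2 by measurable
qed

definition empirical_mass ::
  "real \<Rightarrow> nat \<Rightarrow> (real \<Rightarrow> real) \<Rightarrow> nat \<Rightarrow> nat \<Rightarrow> real measure set \<Rightarrow> ennreal" where
  "empirical_mass \<beta> \<gamma> v n m G = (\<integral>\<^sup>+x. ennreal (ensemble_weight \<beta> \<gamma> S v n m x) *
      indicator {x \<in> PiE {1..m} (\<lambda>_. S). empirical_measure S m x \<in> G} x \<partial>(PiM {1..m} (\<lambda>_. lborel)))"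

text \<open>The existence of a random vector with this density rules out all degenerate cases: if the weight had
  integral \<open>0\<close> or were not integrable, then \<open>ensemble_Z\<close> would be \<open>0\<close> and the density, a multiple of
  \<open>1 / 0 = 0\<close>, would have total mass \<open>0\<close>. The same happens if \<open>S\<close> is a null set.\<close>

lemma
  assumes v: "continuous_on S v" "\<And>x. x \<in> S \<Longrightarrow> 0 \<le> v x" and m: "m \<ge> 1" and P: "prob_space P"
    and \<Lambda>: "\<Lambda> \<in> P \<rightarrow>\<^sub>M PiM {1..m} (\<lambda>_. restrict_space borel S)"
    and dens: "distributed P (PiM {1..m} (\<lambda>_. lborel)) \<Lambda> (\<lambda>x. ennreal (ensemble_density \<beta> \<gamma> S v n m x))"
  shows ensemble_Z_pos: "0 < ensemble_Z \<beta> \<gamma> S v n m"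
    and ensemble_Z_eq_mass: "ennreal (ensemble_Z \<beta> \<gamma> S v n m) = empirical_mass \<beta> \<gamma> v n m (borel_prob_measures S)"
    and empirical_law: "G \<in> sets (borel_of (weak_topology S)) \<Longrightarrow>
      empirical_mass \<beta> \<gamma> v n m G = ennreal (ensemble_Z \<beta> \<gamma> S v n m *
        measure (distr (distr P (PiM {1..m} (\<lambda>_. restrict_space borel S)) \<Lambda>)
           (borel_of (weak_topology S)) (empirical_measure S m)) G)"
    and nondegenerate: "\<not> emeasure lborel S = 0"
proof -
  interpret prob_space P by fact
  let ?L = "PiM {1..m} (\<lambda>_. lborel :: real measure)" and ?Z = "ensemble_Z \<beta> \<gamma> S v n m"
  let ?W = "ensemble_weight \<beta> \<gamma> S v n m"
  have Wm[measurable]: "?W \<in> borel_measurable ?L" by (rule borel_measurable_ensemble_weight[OF v(1)])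
  have W0: "0 \<le> ?W x" for x by (rule ensemble_weight_nonneg[OF v(2)])
  have \<Lambda>L: "\<Lambda> \<in> P \<rightarrow>\<^sub>M ?L" using dens by (simp add: distributed_def)
  have D: "distr P ?L \<Lambda> = density ?L (\<lambda>x. ennreal (ensemble_density \<beta> \<gamma> S v n m x))"
    using dens by (simp add: distributed_def)
  have em: "emeasure (distr P ?L \<Lambda>) T = (\<integral>\<^sup>+x. ennreal (1 / ?Z * ?W x) * indicator T x \<partial>?L)" if "T \<in> sets ?L" for T
    unfolding D ensemble_density_def by (rule emeasure_density) (use that in measurable)
  have one: "1 = (\<integral>\<^sup>+x. ennreal (1 / ?Z * ?W x) \<partial>?L)"
  proof -
    have "1 = emeasure (distr P ?L \<Lambda>) (space ?L)"
      using prob_space.emeasure_space_1[OF prob_space_distr[OF \<Lambda>L]] by simp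
    also have "\<dots> = (\<integral>\<^sup>+x. ennreal (1 / ?Z * ?W x) * indicator (space ?L) x \<partial>?L)"
      by (rule em) simp
    also have "\<dots> = (\<integral>\<^sup>+x. ennreal (1 / ?Z * ?W x) \<partial>?L)"
      by (rule nn_integral_cong) simp
    finally show ?thesis .
  qed
  have Zint: "?Z = (\<integral>x. ?W x \<partial>?L)" by (simp add: ensemble_Z_def)
  have "?Z \<noteq> 0" using one by (cases "?Z = 0") auto
  moreover have "0 \<le> ?Z" unfolding Zint using W0 by (intro integral_nonneg_AE) auto
  ultimately show Zpos: "0 < ?Z" by simp
  then have int: "integrable ?L ?W" using not_integrable_integral_eq unfolding Zint by force
  have sc: "(\<integral>\<^sup>+x. ennreal (1 / ?Z * ?W x) * indicator T x \<partial>?L) =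
      ennreal (1 / ?Z) * (\<integral>\<^sup>+x. ennreal (?W x) * indicator T x \<partial>?L)" if "T \<in> sets ?L" for T
    using Zpos W0 that by (subst nn_integral_cmult[symmetric]) (auto simp: ennreal_mult'[symmetric] ac_simps mult.assoc[symmetric] intro!: nn_integral_cong simp del: times_divide_eq_left)
  have "x \<in> PiE {1..m} (\<lambda>_. S) \<Longrightarrow> empirical_measure S m x \<in> borel_prob_measures S" for x
    by (intro empirical_measure_in[OF m]) (auto simp: PiE_mem)
  then have PE: "PiE {1..m} (\<lambda>_. S) = {x \<in> PiE {1..m} (\<lambda>_. S). empirical_measure S m x \<in> borel_prob_measures S}"
    by auto
  have "ennreal ?Z = (\<integral>\<^sup>+x. ennreal (?W x) \<partial>?L)"
    unfolding Zint using int W0 by (intro nn_integral_eq_integral[symmetric]) auto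
  also have "\<dots> = empirical_mass \<beta> \<gamma> v n m (borel_prob_measures S)"
    unfolding empirical_mass_def PE[symmetric]
    by (rule nn_integral_cong) (auto simp: ensemble_weight_def split: split_indicator)
  finally show Zm: "ennreal ?Z = empirical_mass \<beta> \<gamma> v n m (borel_prob_measures S)" .
  show "empirical_mass \<beta> \<gamma> v n m G = ennreal (?Z *
        measure (distr (distr P (PiM {1..m} (\<lambda>_. restrict_space borel S)) \<Lambda>)
           (borel_of (weak_topology S)) (empirical_measure S m)) G)" if G: "G \<in> sets (borel_of (weak_topology S))"
  proof -
    let ?R = "PiM {1..m} (\<lambda>_. restrict_space borel S)"
    let ?T = "{x \<in> PiE {1..m} (\<lambda>_. S). empirical_measure S m x \<in> G}"
    have T: "?T \<in> sets ?L" by (rule sets_borel_of_weak_preimage[OF m G])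
    have spR: "space ?R = PiE {1..m} (\<lambda>_. S)" by (simp add: space_PiM space_restrict_space)
    have em': "empirical_measure S m \<in> ?R \<rightarrow>\<^sub>M borel_of (weak_topology S)" by (rule measurable_empirical_measure[OF m])
    have "distr (distr P ?R \<Lambda>) (borel_of (weak_topology S)) (empirical_measure S m) =
        distr P (borel_of (weak_topology S)) (empirical_measure S m \<circ> \<Lambda>)"
      by (rule distr_distr[OF em' \<Lambda>])
    then have "emeasure (distr (distr P ?R \<Lambda>) (borel_of (weak_topology S)) (empirical_measure S m)) G
        = emeasure P ((empirical_measure S m \<circ> \<Lambda>) -` G \<inter> space P)"
      using G measurable_comp[OF \<Lambda> em'] by (simp add: emeasure_distr)
    also have "(empirical_measure S m \<circ> \<Lambda>) -` G \<inter> space P = \<Lambda> -` ?T \<inter> space P"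
      using measurable_space[OF \<Lambda>] unfolding spR by auto
    also have "emeasure P \<dots> = emeasure (distr P ?L \<Lambda>) ?T" using T \<Lambda>L by (simp add: emeasure_distr)
    also have "\<dots> = ennreal (1 / ?Z) * empirical_mass \<beta> \<gamma> v n m G"
      unfolding em[OF T] sc[OF T] empirical_mass_def ..
    finally have "ennreal ?Z * emeasure (distr (distr P ?R \<Lambda>) (borel_of (weak_topology S)) (empirical_measure S m)) G
        = ennreal ?Z * (ennreal (1 / ?Z) * empirical_mass \<beta> \<gamma> v n m G)" by simp
    also have "\<dots> = empirical_mass \<beta> \<gamma> v n m G"
      using Zpos by (simp add: mult.assoc[symmetric] ennreal_mult'[symmetric])
    finally have "empirical_mass \<beta> \<gamma> v n m G = ennreal ?Z * emeasure (distr (distr P ?R \<Lambda>) (borel_of (weak_topology S)) (empirical_measure S m)) G" by simp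
    moreover interpret R: prob_space "distr P ?R \<Lambda>" by (rule prob_space_distr[OF \<Lambda>])
    interpret RR: prob_space "distr (distr P ?R \<Lambda>) (borel_of (weak_topology S)) (empirical_measure S m)"
      by (rule R.prob_space_distr) (use em' in simp)
    show ?thesis using calculation Zpos by (simp add: RR.emeasure_eq_measure ennreal_mult')
  qed
  show "\<not> emeasure lborel S = 0"
  proof
    assume z: "emeasure lborel S = 0"
    interpret product_sigma_finite "\<lambda>_::nat. lborel :: real measure" ..
    have "emeasure ?L (PiE {1..m} (\<lambda>_. S)) = (\<Prod>j\<in>{1..m}. emeasure lborel S)"
      by (rule emeasure_PiM) (use closed_S in auto)
    then have n: "emeasure ?L (PiE {1..m} (\<lambda>_. S)) = 0" using z m by (simp add: power_0_left)
    have "PiE {1..m} (\<lambda>_. S) \<in> null_sets ?L"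
      using n by (auto simp: null_sets_def intro!: sets_PiM_I_finite closed_S borel_closed)
    then have "AE x in ?L. x \<notin> PiE {1..m} (\<lambda>_. S)" by (rule AE_not_in)
    then have "AE x in ?L. ennreal (1 / ?Z * ?W x) = 0" by eventually_elim (simp add: ensemble_weight_def)
    then have "(\<integral>\<^sup>+x. ennreal (1 / ?Z * ?W x) \<partial>?L) = (\<integral>\<^sup>+x. 0 \<partial>?L)" by (rule nn_integral_cong_AE)
    then show False using one by simp
  qed
qed

end

context vanishing_kernel
begin

lemma cutoff_energy_empirical_measure:
  assumes m: "m \<ge> 1" and x: "\<And>j. j \<in> {1..m} \<Longrightarrow> x j \<in> S" and M: "0 \<le> M"
  shows "cutoff_energy M (empirical_measure S m x) = (\<Sum>i=1..m. \<Sum>j=1..m. cutoff M (x i) (x j)) / (real m)\<^sup>2"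
proof -
  let ?\<mu> = "empirical_measure S m x" and ?R = "restrict_space borel S :: real measure"
  have \<mu>: "?\<mu> \<in> borel_prob_measures S" by (rule empirical_measure_in[OF m x])
  note sets_\<mu> = borel_prob_measuresD(2)[OF \<mu>]
  have meas: "f \<in> borel_measurable ?R" if "integrable ?\<mu> f" for f :: "real \<Rightarrow> real"
    using borel_measurable_integrable[OF that] measurable_cong_sets[OF sets_\<mu> refl] by blast
  have inner: "(\<integral>y. cutoff M z y \<partial>?\<mu>) = (\<Sum>j=1..m. cutoff M z (x j)) / real m" if "z \<in> S" for z
    by (rule integral_empirical_measure[OF m x meas[OF integrable_cutoff(1)[OF \<mu> M that]]])
  have "cutoff_energy M ?\<mu> = (\<Sum>i=1..m. (\<integral>y. cutoff M (x i) y \<partial>?\<mu>)) / real m"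
    unfolding cutoff_energy_def
    by (rule integral_empirical_measure[OF m x meas[OF integrable_cutoff(2)[OF \<mu> M]]])
  also have "\<dots> = (\<Sum>i=1..m. (\<Sum>j=1..m. cutoff M (x i) (x j)) / real m) / real m"
    using x by (simp add: inner)
  finally show ?thesis by (simp add: sum_divide_distrib power2_eq_square)
qed

end

section \<open>The kernel of the ensemble\<close>

locale beta_ensemble = closed_real_interval +
  fixes \<beta> \<kappa> :: real and \<gamma> :: nat and wn :: "nat \<Rightarrow> real \<Rightarrow> real" and w :: "real \<Rightarrow> real" and p :: "nat \<Rightarrow> nat"
  assumes beta: "\<beta> > 0" and gamma: "\<gamma> \<ge> 1" and kappa: "\<kappa> > 0"
    and S_even: "even \<gamma> \<Longrightarrow> S \<subseteq> {0..}"
    and wn_cont: "\<And>n. n \<ge> 1 \<Longrightarrow> continuous_on S (wn n)"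
    and wn_nonneg: "\<And>n x. n \<ge> 1 \<Longrightarrow> x \<in> S \<Longrightarrow> wn n x \<ge> 0"
    and p_top: "filterlim p at_top sequentially"
    and p_kappa: "(\<lambda>n. real (p n) / real n) \<longlonglongrightarrow> \<kappa>"
    and w_cont: "continuous_on S w" and w_nonneg: "\<And>x. x \<in> S \<Longrightarrow> w x \<ge> 0"
    and zeros_finite: "finite (zero_set S w)"
    and zeros_wn: "eventually (\<lambda>n. zero_set S (wn n) \<subseteq> zero_set S w) sequentially"
    and wn_conv: "\<And>K. compact K \<Longrightarrow> K \<subseteq> S \<Longrightarrow> uniform_limit K wn w sequentially"
    and log_wn_conv: "\<And>K. compact K \<Longrightarrow> K \<subseteq> S - zero_set S w \<Longrightarrow>
      uniform_limit K (\<lambda>n x. ln (wn n x)) (\<lambda>x. ln (w x)) sequentially"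
    and wn_decay: "\<not> bounded S \<Longrightarrow> \<exists>n0\<ge>1. \<exists>\<epsilon>>0.
      ((\<lambda>x. ennreal (\<bar>x\<bar> powr (real \<gamma> * \<kappa> * max \<beta> 1 + \<epsilon>)) * (SUP n\<in>{n0..}. ennreal (wn n x)))
         \<longlongrightarrow> 0) (inf at_infinity (principal S))"
begin

text \<open>The kernel \<open>E\<close> of the limit is the case \<open>v = w\<close>, \<open>b = \<kappa> / 2\<close>. The weights \<open>wn n\<close> with exponents
  tending to \<open>\<kappa> / 2\<close> give the kernels at finite \<open>n\<close>.\<close>

definition ker :: "(real \<Rightarrow> real) \<Rightarrow> real \<Rightarrow> real \<Rightarrow> real \<Rightarrow> real" where
  "ker v b x y = \<bar>x ^ \<gamma> - y ^ \<gamma>\<bar> powr (\<beta> * \<kappa>\<^sup>2 / 2) * (v x * v y) powr b"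

abbreviation "E \<equiv> ker w (\<kappa> / 2)"

lemma ker_commute: "ker v b x y = ker v b y x"
  by (simp add: ker_def abs_minus_commute mult.commute)

lemma ker_nonneg: "0 \<le> ker v b x y"
  by (simp add: ker_def)

lemma wn_power_decay:
  obtains R \<epsilon> :: real and n0 where "R \<ge> 1" "\<epsilon> > 0" "n0 \<ge> 1"
    "\<And>n x. n \<ge> n0 \<Longrightarrow> x \<in> S \<Longrightarrow> R \<le> \<bar>x\<bar> \<Longrightarrow> wn n x \<le> \<bar>x\<bar> powr - (real \<gamma> * \<kappa> * max \<beta> 1 + \<epsilon>)"
proof (cases "bounded S")
  case True
  then obtain b where b: "\<And>x. x \<in> S \<Longrightarrow> \<bar>x\<bar> \<le> b" by (auto simp: bounded_iff)
  show ?thesis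
  proof (rule that[of "\<bar>b\<bar> + 1" 1 1])
    fix n :: nat and x assume "x \<in> S" "\<bar>b\<bar> + 1 \<le> \<bar>x\<bar>"
    then have False using b[of x] by linarith
    then show "wn n x \<le> \<bar>x\<bar> powr - (real \<gamma> * \<kappa> * max \<beta> 1 + 1)" ..
  qed auto
next
  case False
  from wn_decay[OF this] obtain n0 \<epsilon> where n0: "n0 \<ge> 1" and \<epsilon>: "\<epsilon> > 0" and
    lim: "((\<lambda>x. ennreal (\<bar>x\<bar> powr (real \<gamma> * \<kappa> * max \<beta> 1 + \<epsilon>)) * (SUP n\<in>{n0..}. ennreal (wn n x)))
         \<longlongrightarrow> 0) (inf at_infinity (principal S))" by blast
  let ?T = "real \<gamma> * \<kappa> * max \<beta> 1 + \<epsilon>"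
  have "eventually (\<lambda>x. ennreal (\<bar>x\<bar> powr ?T) * (SUP n\<in>{n0..}. ennreal (wn n x)) < 1) (inf at_infinity (principal S))"
    using lim by (rule order_tendstoD) simp
  then obtain R where R: "\<And>x. R \<le> \<bar>x\<bar> \<Longrightarrow> x \<in> S \<Longrightarrow> ennreal (\<bar>x\<bar> powr ?T) * (SUP n\<in>{n0..}. ennreal (wn n x)) < 1"
    unfolding eventually_inf_principal eventually_at_infinity by auto
  show ?thesis
  proof (rule that[of "max R 1" \<epsilon> n0])
    fix n x assume n: "n \<ge> n0" and x: "x \<in> S" "max R 1 \<le> \<bar>x\<bar>"
    have "ennreal (\<bar>x\<bar> powr ?T * wn n x) = ennreal (\<bar>x\<bar> powr ?T) * ennreal (wn n x)"
      by (simp add: ennreal_mult')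
    also have "\<dots> \<le> ennreal (\<bar>x\<bar> powr ?T) * (SUP n\<in>{n0..}. ennreal (wn n x))"
      using n by (intro mult_left_mono SUP_upper) auto
    also have "\<dots> < 1" using R x by auto
    finally have "ennreal (\<bar>x\<bar> powr ?T * wn n x) < ennreal 1" by simp
    then have "\<bar>x\<bar> powr ?T * wn n x < 1" by (subst (asm) ennreal_less_iff) (use n n0 x wn_nonneg in auto)
    moreover have "\<bar>x\<bar> powr ?T > 0" using x by auto
    ultimately show "wn n x \<le> \<bar>x\<bar> powr - ?T"
      unfolding powr_minus inverse_eq_divide by (subst pos_le_divide_eq) (auto simp: mult.commute)
  qed (use n0 \<epsilon> in auto)
qed

lemma wn_tendsto: "x \<in> S \<Longrightarrow> (\<lambda>n. wn n x) \<longlonglongrightarrow> w x"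
  using wn_conv[of "{x}"] by (auto intro: tendsto_uniform_limitI)

text \<open>Late members of the sequence and the limit obey the same bounds: near the origin by uniform
  convergence on compact sets, far out by the decay assumption.\<close>

lemma uniform_bounds:
  obtains R \<epsilon> C :: real and N where "R \<ge> 1" "\<epsilon> > 0" "C \<ge> 1" "N \<ge> 1"
    "\<And>n x. n \<ge> N \<Longrightarrow> x \<in> S \<Longrightarrow> R \<le> \<bar>x\<bar> \<Longrightarrow> wn n x \<le> \<bar>x\<bar> powr - (real \<gamma> * \<kappa> * max \<beta> 1 + \<epsilon>)"
    "\<And>n x. n \<ge> N \<Longrightarrow> x \<in> S \<Longrightarrow> wn n x \<le> C"
    "\<And>x. x \<in> S \<Longrightarrow> R \<le> \<bar>x\<bar> \<Longrightarrow> w x \<le> \<bar>x\<bar> powr - (real \<gamma> * \<kappa> * max \<beta> 1 + \<epsilon>)"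
    "\<And>x. x \<in> S \<Longrightarrow> w x \<le> C"
proof -
  obtain R \<epsilon> :: real and n0 where R: "R \<ge> 1" "\<epsilon> > 0" "n0 \<ge> 1"
    and dec: "\<And>n x. n \<ge> n0 \<Longrightarrow> x \<in> S \<Longrightarrow> R \<le> \<bar>x\<bar> \<Longrightarrow> wn n x \<le> \<bar>x\<bar> powr - (real \<gamma> * \<kappa> * max \<beta> 1 + \<epsilon>)"
    using wn_power_decay by metis
  let ?K = "S \<inter> cball 0 R"
  have K: "compact ?K" using closed_S by (simp add: closed_Int_compact)
  have "compact (w ` ?K)"
    by (rule compact_continuous_image[OF continuous_on_subset[OF w_cont] K]) auto
  from compact_imp_bounded[OF this] obtain c where "\<forall>z\<in>w ` ?K. norm z \<le> c"
    unfolding bounded_iff by blast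
  then have c: "\<And>x. x \<in> ?K \<Longrightarrow> \<bar>w x\<bar> \<le> c" by simp
  have "eventually (\<lambda>n. \<forall>x\<in>?K. dist (wn n x) (w x) < 1) sequentially"
    using wn_conv[OF K] by (auto simp: uniform_limit_iff)
  then obtain n1 where n1: "\<And>n x. n \<ge> n1 \<Longrightarrow> x \<in> ?K \<Longrightarrow> dist (wn n x) (w x) < 1"
    unfolding eventually_sequentially by blast
  have T: "real \<gamma> * \<kappa> * max \<beta> 1 + \<epsilon> > 0" using gamma kappa R(2) by (intro add_nonneg_pos) auto
  have le1: "\<bar>x\<bar> powr - (real \<gamma> * \<kappa> * max \<beta> 1 + \<epsilon>) \<le> 1" if "R \<le> \<bar>x\<bar>" for x :: real
  proof -
    have "\<bar>x\<bar> powr - (real \<gamma> * \<kappa> * max \<beta> 1 + \<epsilon>) \<le> \<bar>x\<bar> powr 0"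
      using that R(1) T by (intro powr_mono) auto
    also have "\<dots> = 1" using that R(1) by auto
    finally show ?thesis .
  qed
  have bd: "wn n x \<le> \<bar>c\<bar> + 1" if "n \<ge> max n0 n1" "x \<in> S" for n x
  proof (cases "R \<le> \<bar>x\<bar>")
    case True
    then have "wn n x \<le> 1" using dec[of n x] le1[of x] that by auto
    then show ?thesis by linarith
  next
    case False
    then show ?thesis using n1[of n x] c[of x] that by (auto simp: dist_real_def)
  qed
  have ev: "eventually (\<lambda>n. n \<ge> max n0 n1) sequentially" by (rule eventually_ge_at_top)
  show ?thesis
  proof (rule that[of R \<epsilon> "\<bar>c\<bar> + 1" "max n0 n1"])
    fix x assume x: "x \<in> S"
    show "w x \<le> \<bar>c\<bar> + 1"
      by (rule tendsto_upperbound[OF wn_tendsto[OF x]]) (use ev bd x in \<open>auto elim: eventually_mono\<close>)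
    assume "R \<le> \<bar>x\<bar>"
    then show "w x \<le> \<bar>x\<bar> powr - (real \<gamma> * \<kappa> * max \<beta> 1 + \<epsilon>)"
      by (intro tendsto_upperbound[OF wn_tendsto[OF x]]) (use ev dec x in \<open>auto elim: eventually_mono\<close>)
  qed (use R dec bd in auto)
qed

text \<open>With \<open>|y| \<le> |x|\<close> the difference of powers grows at most like \<open>|x|\<close> to the power \<open>\<gamma>\<close>, while one of
  the two weights decays in \<open>|x|\<close> and the other stays bounded.\<close>

lemma ker_decay:
  assumes v: "v x \<le> \<bar>x\<bar> powr - T" "0 \<le> v x" "0 \<le> v y" "v y \<le> C" and C: "C \<ge> 1"
    and xy: "\<bar>x\<bar> \<ge> 1" "\<bar>y\<bar> \<le> \<bar>x\<bar>" and b: "0 \<le> b" "b \<le> \<kappa>"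
    and d: "real \<gamma> * (\<beta> * \<kappa>\<^sup>2 / 2) + \<delta> \<le> T * b"
  shows "ker v b x y \<le> 2 powr (\<beta> * \<kappa>\<^sup>2 / 2) * C powr \<kappa> * \<bar>x\<bar> powr - \<delta>"
proof -
  let ?a = "\<beta> * \<kappa>\<^sup>2 / 2"
  have a: "?a \<ge> 0" using beta by simp
  have "\<bar>x ^ \<gamma> - y ^ \<gamma>\<bar> \<le> \<bar>x\<bar> ^ \<gamma> + \<bar>y\<bar> ^ \<gamma>" by (metis abs_triangle_ineq4 power_abs)
  also have "\<dots> \<le> 2 * \<bar>x\<bar> ^ \<gamma>" using power_mono[OF xy(2), of \<gamma>] by simp
  finally have "\<bar>x ^ \<gamma> - y ^ \<gamma>\<bar> powr ?a \<le> (2 * \<bar>x\<bar> ^ \<gamma>) powr ?a" using a by (intro powr_mono2) auto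
  also have "\<dots> = 2 powr ?a * \<bar>x\<bar> powr (real \<gamma> * ?a)"
    using xy by (subst powr_mult) (auto simp: powr_powr powr_realpow[symmetric])
  finally have 1: "\<bar>x ^ \<gamma> - y ^ \<gamma>\<bar> powr ?a \<le> 2 powr ?a * \<bar>x\<bar> powr (real \<gamma> * ?a)" .
  have "(v x * v y) powr b = v x powr b * v y powr b" using v by (intro powr_mult)
  also have "\<dots> \<le> (\<bar>x\<bar> powr - T) powr b * C powr b" using v b by (intro mult_mono powr_mono2) auto
  also have "\<dots> \<le> \<bar>x\<bar> powr - (T * b) * C powr \<kappa>"
    using b C by (intro mult_mono powr_mono) (auto simp: powr_powr)
  finally have 2: "(v x * v y) powr b \<le> \<bar>x\<bar> powr - (T * b) * C powr \<kappa>" .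
  have "ker v b x y \<le> (2 powr ?a * \<bar>x\<bar> powr (real \<gamma> * ?a)) * (\<bar>x\<bar> powr - (T * b) * C powr \<kappa>)"
    unfolding ker_def using 1 2 by (intro mult_mono) auto
  also have "\<dots> = 2 powr ?a * C powr \<kappa> * (\<bar>x\<bar> powr (real \<gamma> * ?a) * \<bar>x\<bar> powr - (T * b))"
    by (simp only: mult_ac)
  also have "\<dots> = 2 powr ?a * C powr \<kappa> * \<bar>x\<bar> powr (real \<gamma> * ?a + - (T * b))"
    by (simp only: powr_add)
  also have "\<dots> \<le> 2 powr ?a * C powr \<kappa> * \<bar>x\<bar> powr - \<delta>"
    using xy d by (intro mult_left_mono powr_mono) auto
  finally show ?thesis .
qed

lemma powr_neg_small:
  assumes "\<delta> > 0" "e > 0" "c > 0"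
  obtains r :: real where "r \<ge> 1" "\<And>t. t \<ge> r \<Longrightarrow> c * t powr - \<delta> \<le> e"
proof -
  have "((\<lambda>t::real. c * t powr - \<delta>) \<longlongrightarrow> c * 0) at_top"
    using assms by (intro tendsto_intros tendsto_neg_powr filterlim_ident) auto
  then have "eventually (\<lambda>t. c * t powr - \<delta> < e) at_top" using assms by (intro order_tendstoD(2)) auto
  then obtain r where "\<And>t. t \<ge> r \<Longrightarrow> c * t powr - \<delta> < e" by (auto simp: eventually_at_top_linorder)
  then show ?thesis by (intro that[of "max r 1"]) (auto intro: less_imp_le)
qed

text \<open>The decay \<open>(\<gamma> \<kappa> max \<beta> 1 + \<epsilon>) \<kappa> / 2\<close> of the weight exceeds the growth \<open>\<gamma> \<beta> \<kappa>\<^sup>2 / 2\<close> of the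
  interaction by at least \<open>\<epsilon> \<kappa> / 2\<close>.\<close>

lemma vanishing_kernel_E: "\<exists>B. vanishing_kernel S E B"
proof -
  obtain R \<epsilon> C :: real and N where R: "R \<ge> 1" "\<epsilon> > 0" "C \<ge> 1"
    and dec: "\<And>x. x \<in> S \<Longrightarrow> R \<le> \<bar>x\<bar> \<Longrightarrow> w x \<le> \<bar>x\<bar> powr - (real \<gamma> * \<kappa> * max \<beta> 1 + \<epsilon>)"
    and C: "\<And>x. x \<in> S \<Longrightarrow> w x \<le> C"
    using uniform_bounds by metis
  have cont: "continuous_on (S \<times> S) (\<lambda>(x, y). E x y)"
  proof -
    have w1: "continuous_on (S \<times> S) (\<lambda>z. w (fst z))" "continuous_on (S \<times> S) (\<lambda>z. w (snd z))"
      by (auto intro!: continuous_on_compose2[OF w_cont] continuous_intros)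
    have "\<kappa> / 2 > 0" "\<beta> * \<kappa>\<^sup>2 / 2 > 0" using kappa beta by auto
    then show ?thesis unfolding ker_def case_prod_unfold
      using w_nonneg by (intro continuous_intros continuous_on_powr' w1) auto
  qed
  let ?\<delta> = "\<epsilon> * \<kappa> / 2"
  have d: "real \<gamma> * (\<beta> * \<kappa>\<^sup>2 / 2) + ?\<delta> \<le> (real \<gamma> * \<kappa> * max \<beta> 1 + \<epsilon>) * (\<kappa> / 2)"
  proof -
    have "real \<gamma> * \<kappa> * \<beta> * (\<kappa> / 2) \<le> real \<gamma> * \<kappa> * max \<beta> 1 * (\<kappa> / 2)" using kappa by (intro mult_right_mono mult_left_mono) auto
    then show ?thesis by (simp add: power2_eq_square algebra_simps)
  qed
  have far: "E x y \<le> 2 powr (\<beta> * \<kappa>\<^sup>2 / 2) * C powr \<kappa> * max \<bar>x\<bar> \<bar>y\<bar> powr - ?\<delta>"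
    if xy: "x \<in> S" "y \<in> S" "R \<le> max \<bar>x\<bar> \<bar>y\<bar>" for x y
  proof (cases "\<bar>y\<bar> \<le> \<bar>x\<bar>")
    case True
    then have m: "max \<bar>x\<bar> \<bar>y\<bar> = \<bar>x\<bar>" by simp
    show ?thesis unfolding m using xy m True R kappa
      by (intro ker_decay[where v = w, OF dec[of x] _ _ C[of y] R(3) _ True _ _ d] w_nonneg) auto
  next
    case False
    then have m: "max \<bar>x\<bar> \<bar>y\<bar> = \<bar>y\<bar>" and le: "\<bar>x\<bar> \<le> \<bar>y\<bar>" by auto
    show ?thesis unfolding m ker_commute[of _ _ x y] using xy m R kappa
      by (intro ker_decay[where v = w, OF dec[of y] _ _ C[of x] R(3) _ le _ _ d] w_nonneg) auto
  qed
  have van: "\<exists>r\<ge>R. \<forall>x\<in>S. \<forall>y\<in>S. r \<le> max \<bar>x\<bar> \<bar>y\<bar> \<longrightarrow> E x y \<le> e" if e0: "e > 0" for e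
  proof -
    have "?\<delta> > 0" "2 powr (\<beta> * \<kappa>\<^sup>2 / 2) * C powr \<kappa> > 0" using R kappa by auto
    then obtain r where r: "r \<ge> 1" "\<And>t. t \<ge> r \<Longrightarrow> 2 powr (\<beta> * \<kappa>\<^sup>2 / 2) * C powr \<kappa> * t powr - ?\<delta> \<le> e"
      using powr_neg_small[of ?\<delta> e] e0 by metis
    show ?thesis using far r(2) by (intro exI[of _ "max R r"]) (meson max.bounded_iff max.cobounded1 order_trans)
  qed
  obtain r where r: "\<And>x y. x \<in> S \<Longrightarrow> y \<in> S \<Longrightarrow> r \<le> max \<bar>x\<bar> \<bar>y\<bar> \<Longrightarrow> E x y \<le> 1"
    using van[of 1] by auto
  let ?K = "S \<inter> cball 0 r"
  have "compact ?K" using closed_S by (simp add: closed_Int_compact)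
  then have "compact ((\<lambda>(x, y). E x y) ` (?K \<times> ?K))"
    by (intro compact_continuous_image continuous_on_subset[OF cont] compact_Times) auto
  from compact_imp_bounded[OF this] obtain c where c0: "\<forall>z\<in>(\<lambda>(x, y). E x y) ` (?K \<times> ?K). norm z \<le> c"
    unfolding bounded_iff by blast
  have c: "\<bar>E x y\<bar> \<le> c" if "x \<in> ?K" "y \<in> ?K" for x y
    using c0 imageI[of "(x, y)" "?K \<times> ?K" "\<lambda>(x, y). E x y"] that by simp
  have le: "E x y \<le> exp \<bar>c\<bar>" if "x \<in> S" "y \<in> S" for x y
  proof (cases "r \<le> max \<bar>x\<bar> \<bar>y\<bar>")
    case True
    then have "E x y \<le> 1" using r that by blast
    also have "1 \<le> exp \<bar>c\<bar>" by simp
    finally show ?thesis .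
  next
    case False
    then have "\<bar>E x y\<bar> \<le> c" using that by (intro c) auto
    then have "E x y \<le> \<bar>c\<bar>" by linarith
    also have "\<dots> \<le> exp \<bar>c\<bar>" using exp_ge_add_one_self[of "\<bar>c\<bar>"] by linarith
    finally show ?thesis .
  qed
  have "vanishing_kernel S E \<bar>c\<bar>"
  proof (intro vanishing_kernel.intro vanishing_kernel_axioms.intro closed_real_interval_axioms cont le)
    fix e :: real assume "e > 0"
    from van[OF this] obtain r where "\<forall>x\<in>S. \<forall>y\<in>S. r \<le> max \<bar>x\<bar> \<bar>y\<bar> \<longrightarrow> E x y \<le> e" by blast
    then show "\<exists>R. \<forall>x\<in>S. \<forall>y\<in>S. R \<le> \<bar>x\<bar> \<longrightarrow> E x y \<le> e" by (intro exI[of _ r]) auto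
  qed (auto simp: ker_nonneg)
  then show ?thesis ..
qed

text \<open>An upper bound for \<open>ln E\<close>.\<close>

definition Bd :: real where "Bd = (SOME B. vanishing_kernel S E B)"

sublocale K: vanishing_kernel S E Bd
  unfolding Bd_def by (rule someI_ex[OF vanishing_kernel_E])

text \<open>Each of the \<open>p n\<close> points belongs to \<open>p n - 1\<close> pairs. With this exponent the sum of \<open>ln (ker (wn n)
  (expo s n))\<close> over all pairs is therefore \<open>\<kappa>\<^sup>2 / 2\<close> times the logarithm of the ensemble weight in
  which \<open>s\<close> of the \<open>n\<close> factors \<open>wn n\<close> at each point are left out.\<close>

definition expo :: "nat \<Rightarrow> nat \<Rightarrow> real" where
  "expo s n = \<kappa>\<^sup>2 * (real n - real s) / (2 * (real (p n) - 1))"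

lemma expo_tendsto: "expo s \<longlonglongrightarrow> \<kappa> / 2"
proof -
  have "(\<lambda>n. (\<kappa>\<^sup>2 * (1 - real s / real n)) / (2 * (real (p n) / real n - 1 / real n))) \<longlonglongrightarrow> (\<kappa>\<^sup>2 * (1 - 0)) / (2 * (\<kappa> - 0))"
    using kappa by (intro tendsto_intros p_kappa lim_const_over_n) auto
  moreover have "eventually (\<lambda>n. (\<kappa>\<^sup>2 * (1 - real s / real n)) / (2 * (real (p n) / real n - 1 / real n)) = expo s n) sequentially"
    using eventually_gt_at_top[of 0]
  proof eventually_elim
    case (elim n)
    have "(\<kappa>\<^sup>2 * (1 - real s / real n)) / (2 * (real (p n) / real n - 1 / real n)) =
       (\<kappa>\<^sup>2 * (real n - real s) / real n) / (2 * (real (p n) - 1) / real n)"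
      using elim by (simp add: field_simps)
    also have "\<dots> = expo s n" unfolding expo_def using elim by simp
    finally show ?case .
  qed
  ultimately have "expo s \<longlonglongrightarrow> (\<kappa>\<^sup>2 * (1 - 0)) / (2 * (\<kappa> - 0))" by (rule Lim_transform_eventually)
  then show ?thesis using kappa by (simp add: power2_eq_square)
qed

text \<open>On bounded sets this holds because \<open>t powr b\<close> is uniformly continuous in \<open>(t, b)\<close> for \<open>b\<close> away from
  \<open>0\<close>, which includes the zeros of the weights. Far out the left-hand side alone is at most \<open>e\<close>, as
  half of the surplus of decay survives the perturbation of the exponent.\<close>

lemma ker_uniform_upper:
  assumes e: "e > 0"
  shows "eventually (\<lambda>n. \<forall>x\<in>S. \<forall>y\<in>S. ker (wn n) (expo s n) x y \<le> E x y + e) sequentially"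
proof -
  obtain R \<epsilon> C :: real and N where R: "R \<ge> 1" "\<epsilon> > 0" "C \<ge> 1" "N \<ge> 1"
    and decn: "\<And>n x. n \<ge> N \<Longrightarrow> x \<in> S \<Longrightarrow> R \<le> \<bar>x\<bar> \<Longrightarrow> wn n x \<le> \<bar>x\<bar> powr - (real \<gamma> * \<kappa> * max \<beta> 1 + \<epsilon>)"
    and Cn: "\<And>n x. n \<ge> N \<Longrightarrow> x \<in> S \<Longrightarrow> wn n x \<le> C"
    and C: "\<And>x. x \<in> S \<Longrightarrow> w x \<le> C"
    using uniform_bounds by metis
  let ?a = "\<beta> * \<kappa>\<^sup>2 / 2" and ?\<delta> = "\<epsilon> * \<kappa> / 4" and ?T = "real \<gamma> * \<kappa> * max \<beta> 1 + \<epsilon>"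
  have T: "?T > 0" using gamma kappa R(2) by (intro add_nonneg_pos) auto
  have "(\<lambda>n. ?T * expo s n) \<longlonglongrightarrow> ?T * (\<kappa> / 2)" by (intro tendsto_intros expo_tendsto)
  moreover have "real \<gamma> * ?a + ?\<delta> < ?T * (\<kappa> / 2)"
  proof -
    have "real \<gamma> * \<kappa> * \<beta> * (\<kappa> / 2) \<le> real \<gamma> * \<kappa> * max \<beta> 1 * (\<kappa> / 2)" using kappa by (intro mult_right_mono mult_left_mono) auto
    moreover have "\<epsilon> * \<kappa> > 0" using R kappa by simp
    ultimately show ?thesis by (simp add: power2_eq_square algebra_simps)
  qed
  ultimately have ev1: "eventually (\<lambda>n. real \<gamma> * ?a + ?\<delta> < ?T * expo s n) sequentially" by (rule order_tendstoD)
  have ev2: "eventually (\<lambda>n. \<kappa> / 4 < expo s n) sequentially" "eventually (\<lambda>n. expo s n < \<kappa>) sequentially"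
    using order_tendstoD(1)[OF expo_tendsto[of s], of "\<kappa> / 4"] order_tendstoD(2)[OF expo_tendsto[of s], of \<kappa>] kappa
    by simp_all
  have d0: "?\<delta> > 0" "2 powr ?a * C powr \<kappa> > 0" using R kappa by auto
  obtain r where r: "r \<ge> 1" "\<And>t. t \<ge> r \<Longrightarrow> 2 powr ?a * C powr \<kappa> * t powr - ?\<delta> \<le> e"
    using powr_neg_small[OF d0(1) e d0(2)] by metis
  define r' where "r' = max R r"
  have far: "eventually (\<lambda>n. \<forall>x\<in>S. \<forall>y\<in>S. r' \<le> max \<bar>x\<bar> \<bar>y\<bar> \<longrightarrow> ker (wn n) (expo s n) x y \<le> e) sequentially"
    using ev1 ev2 eventually_ge_at_top[of N]
  proof eventually_elim
    case (elim n)
    have n1: "n \<ge> 1" using elim(4) R(4) by simp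
    have one: "ker (wn n) (expo s n) x y \<le> e" if "x \<in> S" "y \<in> S" "r' \<le> \<bar>x\<bar>" "\<bar>y\<bar> \<le> \<bar>x\<bar>" for x y
    proof -
      have "ker (wn n) (expo s n) x y \<le> 2 powr ?a * C powr \<kappa> * \<bar>x\<bar> powr - ?\<delta>"
        using that elim R kappa n1 unfolding r'_def
        by (intro ker_decay[where v = "wn n" and T = ?T, OF decn[of n x] _ _ Cn[of n y] R(3)] wn_nonneg) auto
      also have "\<dots> \<le> e" using r(2) that by (simp add: r'_def)
      finally show ?thesis .
    qed
    show ?case
    proof (intro ballI impI)
      fix x y assume "x \<in> S" "y \<in> S" "r' \<le> max \<bar>x\<bar> \<bar>y\<bar>"
      then show "ker (wn n) (expo s n) x y \<le> e"
        using one[of x y] one[of y x] ker_commute[of "wn n" "expo s n" x y] by (cases "\<bar>y\<bar> \<le> \<bar>x\<bar>") auto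
    qed
  qed
  let ?K = "S \<inter> cball 0 r'"
  have K: "compact ?K" using closed_S by (simp add: closed_Int_compact)
  define D where "D = (2 * r' ^ \<gamma>) powr ?a"
  have r'1: "r' \<ge> 1" using R by (simp add: r'_def)
  have D: "D > 0" using r'1 by (simp add: D_def)
  let ?g = "\<lambda>z::real \<times> real. fst z powr snd z"
  \<comment> \<open>\<open>D\<close> bounds the interaction factor on \<open>K\<close>, so the other factor has to be approximated up to \<open>e / D\<close>.\<close>
  have "uniformly_continuous_on ({0..C\<^sup>2} \<times> {\<kappa>/4..\<kappa>}) ?g"
    using kappa by (intro compact_uniformly_continuous continuous_on_powr' continuous_intros compact_Times) auto
  then obtain d where d: "d > 0" "\<And>z z'. z \<in> {0..C\<^sup>2} \<times> {\<kappa>/4..\<kappa>} \<Longrightarrow> z' \<in> {0..C\<^sup>2} \<times> {\<kappa>/4..\<kappa>} \<Longrightarrow>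
     dist z' z < d \<Longrightarrow> dist (?g z') (?g z) < e / D"
    unfolding uniformly_continuous_on_def using e D by (metis divide_pos_pos)
  have C0: "C > 0" using R by simp
  have "eventually (\<lambda>n. \<forall>x\<in>?K. dist (wn n x) (w x) < d / (4 * C)) sequentially"
    using wn_conv[OF K] d(1) C0 by (auto simp: uniform_limit_iff)
  moreover have "eventually (\<lambda>n. dist (expo s n) (\<kappa> / 2) < d / 2) sequentially"
    using expo_tendsto d(1) by (intro tendstoD) auto
  ultimately have near: "eventually (\<lambda>n. \<forall>x\<in>?K. \<forall>y\<in>?K. ker (wn n) (expo s n) x y \<le> E x y + e) sequentially"
    using ev2 eventually_ge_at_top[of N]
  proof eventually_elim
    case (elim n)
    have n1: "n \<ge> 1" using elim(5) R(4) by simp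
    show ?case
    proof (intro ballI)
      fix x y assume x: "x \<in> ?K" and y: "y \<in> ?K"
      have wx: "0 \<le> wn n x" "wn n x \<le> C" "0 \<le> wn n y" "wn n y \<le> C" "0 \<le> w x" "w x \<le> C" "0 \<le> w y" "w y \<le> C"
        using x y elim(5) n1 wn_nonneg w_nonneg Cn C by auto
      have "\<bar>wn n x * wn n y - w x * w y\<bar> = \<bar>wn n x * (wn n y - w y) + w y * (wn n x - w x)\<bar>"
        by (simp add: algebra_simps)
      also have "\<dots> \<le> \<bar>wn n x * (wn n y - w y)\<bar> + \<bar>w y * (wn n x - w x)\<bar>" by (rule abs_triangle_ineq)
      also have "\<dots> \<le> C * (d / (4 * C)) + C * (d / (4 * C))"
        unfolding abs_mult using wx elim(1) x y by (intro add_mono mult_mono) (auto simp: dist_real_def less_imp_le)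
      also have "\<dots> = d / 2" using C0 by simp
      finally have d1: "\<bar>wn n x * wn n y - w x * w y\<bar> \<le> d / 2" .
      have "dist (wn n x * wn n y, expo s n) (w x * w y, \<kappa> / 2) \<le> dist (wn n x * wn n y) (w x * w y) + dist (expo s n) (\<kappa> / 2)"
        unfolding dist_Pair_Pair by (rule order_trans[OF sqrt_add_le_add_sqrt]) auto
      also have "\<dots> < d" using d1 elim(2) by (simp add: dist_real_def)
      finally have dd: "dist (wn n x * wn n y, expo s n) (w x * w y, \<kappa> / 2) < d" .
      have "dist (?g (wn n x * wn n y, expo s n)) (?g (w x * w y, \<kappa> / 2)) < e / D"
        using wx elim(3,4) kappa
        by (intro d(2) dd) (auto simp: power2_eq_square intro!: mult_mono)
      then have g: "(wn n x * wn n y) powr expo s n \<le> (w x * w y) powr (\<kappa> / 2) + e / D"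
        by (simp add: dist_real_def)
      have "\<bar>x ^ \<gamma> - y ^ \<gamma>\<bar> \<le> \<bar>x\<bar> ^ \<gamma> + \<bar>y\<bar> ^ \<gamma>" by (metis abs_triangle_ineq4 power_abs)
      also have "\<dots> \<le> r' ^ \<gamma> + r' ^ \<gamma>" using x y by (intro add_mono power_mono) auto
      finally have q: "\<bar>x ^ \<gamma> - y ^ \<gamma>\<bar> powr ?a \<le> D" unfolding D_def using beta by (intro powr_mono2) auto
      have "ker (wn n) (expo s n) x y \<le> \<bar>x ^ \<gamma> - y ^ \<gamma>\<bar> powr ?a * ((w x * w y) powr (\<kappa> / 2) + e / D)"
        unfolding ker_def by (intro mult_left_mono g) auto
      also have "\<dots> = E x y + \<bar>x ^ \<gamma> - y ^ \<gamma>\<bar> powr ?a * (e / D)" by (simp add: ker_def algebra_simps)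
      also have "\<dots> \<le> E x y + D * (e / D)" using e D by (intro add_left_mono mult_right_mono q) auto
      also have "\<dots> = E x y + e" using D by simp
      finally show "ker (wn n) (expo s n) x y \<le> E x y + e" .
    qed
  qed
  show ?thesis using near far
  proof eventually_elim
    case (elim n)
    show ?case
    proof (intro ballI)
      fix x y assume xy: "x \<in> S" "y \<in> S"
      show "ker (wn n) (expo s n) x y \<le> E x y + e"
      proof (cases "r' \<le> max \<bar>x\<bar> \<bar>y\<bar>")
        case True
        then show ?thesis using elim(2) xy ker_nonneg[of w "\<kappa> / 2" x y] by force
      next
        case False
        then show ?thesis using elim(1) xy by auto
      qed
    qed
  qed
qed

end

section \<open>The upper bound\<close>

lemma sum_off_diagonal:
  fixes f :: "nat \<Rightarrow> nat \<Rightarrow> real"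
  assumes sym: "\<And>i j. f i j = f j i"
  shows "(\<Sum>i=1..m. \<Sum>j=1..m. f i j) = 2 * (\<Sum>(i, j)\<in>{(i, j). 1 \<le> i \<and> i < j \<and> j \<le> m}. f i j) + (\<Sum>i=1..m. f i i)"
proof -
  let ?U = "{(i, j). 1 \<le> i \<and> i < j \<and> j \<le> m}" and ?L = "{(i, j). 1 \<le> j \<and> j < i \<and> i \<le> m}"
    and ?D = "(\<lambda>i. (i, i)) ` {1..m}" and ?g = "\<lambda>(i, j). f i j"
  have fin: "finite ?U" "finite ?L" "finite ?D"
    by (rule finite_subset[of _ "{1..m} \<times> {1..m}"]; auto)+
  have disj: "?U \<inter> ?L = {}" "(?U \<union> ?L) \<inter> ?D = {}" by auto
  have split: "{1..m} \<times> {1..m} = (?U \<union> ?L) \<union> ?D" by auto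
  have "(\<Sum>i=1..m. \<Sum>j=1..m. f i j) = sum ?g ({1..m} \<times> {1..m})" by (simp add: sum.cartesian_product)
  also have "\<dots> = sum ?g ?U + sum ?g ?L + sum ?g ?D"
    unfolding split using fin by (simp only: sum.union_disjoint[OF _ _ disj(2)] sum.union_disjoint[OF _ _ disj(1)] finite_Un)
  also have "sum ?g ?L = sum ?g ?U"
    by (rule sum.reindex_bij_witness[of _ "\<lambda>(i, j). (j, i)" "\<lambda>(i, j). (j, i)"]) (auto simp: sym)
  also have "sum ?g ?D = (\<Sum>i=1..m. f i i)"
    by (subst sum.reindex) (auto simp: inj_on_def)
  finally show ?thesis by simp
qed

lemma sum_upper_pairs:
  fixes g :: "nat \<Rightarrow> real"
  shows "(\<Sum>(i, j)\<in>{(i, j). 1 \<le> i \<and> i < j \<and> j \<le> m}. g i + g j) = (real m - 1) * (\<Sum>i=1..m. g i)"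
proof -
  have "(\<Sum>i=1..m. \<Sum>j=1..m. g i + g j) = 2 * real m * (\<Sum>i=1..m. g i)"
    by (simp add: sum.distrib sum_distrib_left[symmetric])
  moreover have "(\<Sum>i=1..m. g i + g i) = 2 * (\<Sum>i=1..m. g i)" by (simp add: sum_distrib_left)
  ultimately show ?thesis
    using sum_off_diagonal[of "\<lambda>i j. g i + g j" m] by (simp add: add.commute algebra_simps)
qed

lemma ln_ensemble_weight:
  assumes x: "x \<in> PiE {1..m} (\<lambda>_. S)"
    and pos: "\<And>j. j \<in> {1..m} \<Longrightarrow> v (x j) > 0"
    and dist: "\<And>i j. i \<in> {1..m} \<Longrightarrow> j \<in> {1..m} \<Longrightarrow> i < j \<Longrightarrow> x i ^ \<gamma> \<noteq> x j ^ \<gamma>"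
  shows "ensemble_weight \<beta> \<gamma> S v n m x = exp (\<beta> * (\<Sum>(i, j)\<in>{(i, j). 1 \<le> i \<and> i < j \<and> j \<le> m}. ln \<bar>x i ^ \<gamma> - x j ^ \<gamma>\<bar>)
     + real n * (\<Sum>j=1..m. ln (v (x j))))"
proof -
  have fin: "finite {(i, j). 1 \<le> i \<and> i < j \<and> j \<le> m}"
    by (rule finite_index_pairs)
  have "(\<Prod>(i, j)\<in>{(i, j). 1 \<le> i \<and> i < j \<and> j \<le> m}. \<bar>x i ^ \<gamma> - x j ^ \<gamma>\<bar> powr \<beta>) =
      (\<Prod>(i, j)\<in>{(i, j). 1 \<le> i \<and> i < j \<and> j \<le> m}. exp (\<beta> * ln \<bar>x i ^ \<gamma> - x j ^ \<gamma>\<bar>))"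
    using dist by (intro prod.cong) (auto simp: powr_def)
  also have "\<dots> = exp (\<beta> * (\<Sum>(i, j)\<in>{(i, j). 1 \<le> i \<and> i < j \<and> j \<le> m}. ln \<bar>x i ^ \<gamma> - x j ^ \<gamma>\<bar>))"
    using fin by (simp add: exp_sum case_prod_unfold sum_distrib_left)
  finally have 1: "(\<Prod>(i, j)\<in>{(i, j). 1 \<le> i \<and> i < j \<and> j \<le> m}. \<bar>x i ^ \<gamma> - x j ^ \<gamma>\<bar> powr \<beta>) =
     exp (\<beta> * (\<Sum>(i, j)\<in>{(i, j). 1 \<le> i \<and> i < j \<and> j \<le> m}. ln \<bar>x i ^ \<gamma> - x j ^ \<gamma>\<bar>))" .
  have "(\<Prod>j=1..m. v (x j) ^ n) = (\<Prod>j=1..m. exp (real n * ln (v (x j))))"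
    using pos by (intro prod.cong) (auto simp: exp_of_nat_mult)
  also have "\<dots> = exp (real n * (\<Sum>j=1..m. ln (v (x j))))" by (simp add: exp_sum sum_distrib_left)
  finally show ?thesis unfolding ensemble_weight_def using x 1 by (simp add: exp_add)
qed

lemma ensemble_weight_nonzeroD:
  assumes "ensemble_weight \<beta> \<gamma> S v n m x \<noteq> 0" "n \<ge> 1"
  shows "x \<in> PiE {1..m} (\<lambda>_. S)" "\<And>j. j \<in> {1..m} \<Longrightarrow> v (x j) \<noteq> 0"
    "\<And>i j. i \<in> {1..m} \<Longrightarrow> j \<in> {1..m} \<Longrightarrow> i < j \<Longrightarrow> x i ^ \<gamma> \<noteq> x j ^ \<gamma>"
proof -
  have fin: "finite {(i, j). 1 \<le> i \<and> i < j \<and> j \<le> m}"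
    by (rule finite_index_pairs)
  show "x \<in> PiE {1..m} (\<lambda>_. S)" using assms(1) by (auto simp: ensemble_weight_def split: split_indicator_asm)
  show "v (x j) \<noteq> 0" if "j \<in> {1..m}" for j
    using assms that by (auto simp: ensemble_weight_def)
  show "x i ^ \<gamma> \<noteq> x j ^ \<gamma>" if "i \<in> {1..m}" "j \<in> {1..m}" "i < j" for i j
  proof
    assume eq: "x i ^ \<gamma> = x j ^ \<gamma>"
    have "(\<Prod>(i, j)\<in>{(i, j). 1 \<le> i \<and> i < j \<and> j \<le> m}. \<bar>x i ^ \<gamma> - x j ^ \<gamma>\<bar> powr \<beta>) = 0"
      using that eq fin by (intro prod_zero bexI[of _ "(i, j)"]) auto
    then show False using assms(1) by (simp add: ensemble_weight_def)
  qed
qed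

context beta_ensemble
begin

lemma cutoff_diag: "K.cutoff M x x = M"
  by (simp add: K.cutoff_def ker_def max_def)

lemma cutoff_commute: "K.cutoff M x y = K.cutoff M y x"
  by (simp add: K.cutoff_def ker_commute[of _ _ x y])

text \<open>Summed over all ordered pairs the truncated kernel gives \<open>(p n)\<^sup>2\<close> times the truncated energy of the
  empirical measure. The ensemble has no diagonal terms; in the truncated sum each of them equals
  \<open>M\<close>, which accounts for the term \<open>p n * M\<close>.\<close>

lemma ensemble_weight_le:
  assumes n: "n \<ge> 1" "real s < real n" and m: "p n \<ge> 2" and x: "x \<in> PiE {1..p n} (\<lambda>_. S)"
    and \<eta>: "0 \<le> \<eta>" and M: "0 \<le> M"
    and ker: "\<And>x y. x \<in> S \<Longrightarrow> y \<in> S \<Longrightarrow> ker (wn n) (expo s n) x y \<le> exp \<eta> * max (exp (- M)) (E x y)"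
  shows "ensemble_weight \<beta> \<gamma> S (wn n) n (p n) x \<le>
     exp (1 / \<kappa>\<^sup>2 * (real (p n) ^ 2 * (\<eta> - K.cutoff_energy M (empirical_measure S (p n) x)) + real (p n) * M)) *
     (\<Prod>j=1..p n. wn n (x j) ^ s)"
    (is "?W \<le> _")
proof (cases "?W = 0")
  case True
  have "0 \<le> (\<Prod>j=1..p n. wn n (x j) ^ s)" using x n wn_nonneg by (intro prod_nonneg) (auto simp: PiE_iff)
  then show ?thesis using True by simp
next
  case False
  let ?m = "p n" and ?v = "wn n" and ?a = "\<beta> * \<kappa>\<^sup>2 / 2" and ?b = "expo s n"
  let ?U = "{(i, j). 1 \<le> i \<and> i < j \<and> j \<le> ?m}"
  note nz = ensemble_weight_nonzeroD[OF False n(1)]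
  have xS: "x j \<in> S" if "j \<in> {1..?m}" for j using x that by (auto simp: PiE_iff)
  have vpos: "?v (x j) > 0" if "j \<in> {1..?m}" for j
    using nz(2)[OF that] wn_nonneg[OF n(1) xS[OF that]] by simp
  define V where "V = (\<Sum>(i, j)\<in>?U. ln \<bar>x i ^ \<gamma> - x j ^ \<gamma>\<bar>)"
  define L where "L = (\<Sum>j=1..?m. ln (?v (x j)))"
  have W: "?W = exp (\<beta> * V + real n * L)"
    unfolding V_def L_def by (rule ln_ensemble_weight) (use x vpos nz(3) in blast)+
  have pair: "?a * ln \<bar>x i ^ \<gamma> - x j ^ \<gamma>\<bar> + ?b * (ln (?v (x i)) + ln (?v (x j))) \<le> \<eta> - K.cutoff M (x i) (x j)"
    if "i \<in> {1..?m}" "j \<in> {1..?m}" "i < j" for i j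
  proof -
    have d: "\<bar>x i ^ \<gamma> - x j ^ \<gamma>\<bar> > 0" using nz(3)[OF that] by simp
    have vv: "?v (x i) * ?v (x j) > 0" using vpos that by simp
    have "\<bar>x i ^ \<gamma> - x j ^ \<gamma>\<bar> \<noteq> 0" "?v (x i) * ?v (x j) \<noteq> 0" using d vv by linarith+
    then have k: "ker ?v ?b (x i) (x j) > 0"
      unfolding ker_def by (intro mult_pos_pos) (simp_all only: powr_gt_zero, simp_all)
    have mx: "max (exp (- M)) (E (x i) (x j)) > 0" by (simp add: less_max_iff_disj)
    have "?a * ln \<bar>x i ^ \<gamma> - x j ^ \<gamma>\<bar> + ?b * (ln (?v (x i)) + ln (?v (x j))) = ln (ker ?v ?b (x i) (x j))"
      unfolding ker_def using d vv vpos[OF that(1)] vpos[OF that(2)] by (simp add: ln_mult ln_powr)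
    also have "\<dots> \<le> ln (exp \<eta> * max (exp (- M)) (E (x i) (x j)))"
      using k ker[OF xS xS] that mx by (subst ln_le_cancel_iff) auto
    also have "\<dots> = \<eta> - K.cutoff M (x i) (x j)"
      using mx by (simp add: K.cutoff_def ln_mult)
    finally show ?thesis .
  qed
  define s1 where "s1 = (\<Sum>(i, j)\<in>?U. ?a * ln \<bar>x i ^ \<gamma> - x j ^ \<gamma>\<bar> + ?b * (ln (?v (x i)) + ln (?v (x j))))"
  define s2 where "s2 = (\<Sum>(i, j)\<in>?U. \<eta> - K.cutoff M (x i) (x j))"
  have s12: "s1 \<le> s2" unfolding s1_def s2_def
    by (intro sum_mono) (use pair in auto)
  have s1_eq: "s1 = ?a * V + ?b * ((real ?m - 1) * L)"
    unfolding s1_def V_def L_def sum_upper_pairs[of "\<lambda>j. ln (?v (x j))", symmetric]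
    by (simp only: case_prod_unfold sum.distrib sum_distrib_left distrib_left)
  have s2_le: "2 * s2 \<le>
      real ?m ^ 2 * (\<eta> - K.cutoff_energy M (empirical_measure S ?m x)) + real ?m * M"
  proof -
    have CE: "(\<Sum>i=1..?m. \<Sum>j=1..?m. K.cutoff M (x i) (x j)) = real ?m ^ 2 * K.cutoff_energy M (empirical_measure S ?m x)"
      using m by (subst K.cutoff_energy_empirical_measure) (use xS M in auto)
    have "(\<Sum>i=1..?m. \<Sum>j=1..?m. \<eta> - K.cutoff M (x i) (x j)) = real ?m ^ 2 * \<eta> - real ?m ^ 2 * K.cutoff_energy M (empirical_measure S ?m x)"
      unfolding CE[symmetric] by (simp add: sum_subtractf power2_eq_square)
    moreover have "(\<Sum>i=1..?m. \<Sum>j=1..?m. \<eta> - K.cutoff M (x i) (x j)) =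
       2 * s2 + (\<Sum>i=1..?m. \<eta> - K.cutoff M (x i) (x i))"
      unfolding s2_def by (rule sum_off_diagonal) (simp add: cutoff_commute)
    moreover have "(\<Sum>i=1..?m. \<eta> - K.cutoff M (x i) (x i)) = real ?m * (\<eta> - M)" by (simp add: cutoff_diag)
    moreover have "0 \<le> real ?m * \<eta>" using \<eta> by simp
    ultimately show ?thesis by (simp add: algebra_simps)
  qed
  have key: "2 * (?a * V + ?b * ((real ?m - 1) * L)) \<le>
      real ?m ^ 2 * (\<eta> - K.cutoff_energy M (empirical_measure S ?m x)) + real ?m * M"
    unfolding s1_eq[symmetric] using s12 by (intro order_trans[OF _ s2_le]) simp
  have "2 * (?a * V + ?b * ((real ?m - 1) * L)) = \<kappa>\<^sup>2 * (\<beta> * V + (real n - real s) * L)"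
  proof -
    have "?b * (real ?m - 1) = \<kappa>\<^sup>2 * (real n - real s) / 2"
    proof -
      define q where "q = real ?m - 1"
      have "q > 0" using m by (simp add: q_def)
      then show ?thesis unfolding expo_def q_def[symmetric] by simp
    qed
    then have "?b * ((real ?m - 1) * L) = \<kappa>\<^sup>2 * (real n - real s) / 2 * L" by (simp only: mult.assoc[symmetric])
    then show ?thesis by (simp add: algebra_simps)
  qed
  then have "\<beta> * V + (real n - real s) * L = 1 / \<kappa>\<^sup>2 * (2 * (?a * V + ?b * ((real ?m - 1) * L)))"
    using kappa by simp
  also have "\<dots> \<le> 1 / \<kappa>\<^sup>2 * (real ?m ^ 2 * (\<eta> - K.cutoff_energy M (empirical_measure S ?m x)) + real ?m * M)"
    by (intro mult_left_mono key) simp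
  finally have le: "\<beta> * V + (real n - real s) * L \<le> 1 / \<kappa>\<^sup>2 * (real ?m ^ 2 * (\<eta> - K.cutoff_energy M (empirical_measure S ?m x)) + real ?m * M)" .
  have "(\<Prod>j=1..?m. ?v (x j) ^ s) = (\<Prod>j=1..?m. exp (real s * ln (?v (x j))))"
    using vpos by (intro prod.cong) (auto simp: exp_of_nat_mult)
  also have "\<dots> = exp (real s * L)" by (simp add: exp_sum sum_distrib_left L_def)
  finally have Ps: "(\<Prod>j=1..?m. ?v (x j) ^ s) = exp (real s * L)" .
  have "?W = exp (\<beta> * V + (real n - real s) * L) * exp (real s * L)"
    unfolding W exp_add[symmetric] by (simp add: algebra_simps)
  also have "\<dots> \<le> exp (1 / \<kappa>\<^sup>2 * (real ?m ^ 2 * (\<eta> - K.cutoff_energy M (empirical_measure S ?m x)) + real ?m * M)) * exp (real s * L)"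
    using le by (intro mult_right_mono) auto
  finally show ?thesis unfolding Ps .
qed

text \<open>The exponent \<open>s\<close> is chosen such that the decay of \<open>wn n\<close> to the power \<open>s\<close> is at least quadratic.\<close>

lemma wn_power_integrable_bound:
  obtains s :: nat and H :: real where "H > 0"
    "eventually (\<lambda>n. \<forall>x\<in>S. wn n x ^ s \<le> H * inverse (1 + x\<^sup>2)) sequentially"
proof -
  obtain R \<epsilon> C :: real and N where R: "R \<ge> 1" "\<epsilon> > 0" "C \<ge> 1" "N \<ge> 1"
    and decn: "\<And>n x. n \<ge> N \<Longrightarrow> x \<in> S \<Longrightarrow> R \<le> \<bar>x\<bar> \<Longrightarrow> wn n x \<le> \<bar>x\<bar> powr - (real \<gamma> * \<kappa> * max \<beta> 1 + \<epsilon>)"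
    and Cn: "\<And>n x. n \<ge> N \<Longrightarrow> x \<in> S \<Longrightarrow> wn n x \<le> C"
    using uniform_bounds by metis
  let ?T = "real \<gamma> * \<kappa> * max \<beta> 1 + \<epsilon>"
  have T: "?T > 0" using gamma kappa R(2) by (intro add_nonneg_pos) auto
  obtain s :: nat where s: "2 / ?T < real s" using reals_Archimedean2 by blast
  then have s2: "2 \<le> ?T * real s" using T by (simp add: divide_less_eq mult.commute less_imp_le)
  define H where "H = C ^ s * (1 + R\<^sup>2) + 2"
  have "C ^ s * (1 + R\<^sup>2) > 0" using R by (intro mult_pos_pos zero_less_power add_pos_nonneg) auto
  then have H: "H > 0" by (simp add: H_def)
  have bd: "wn n x ^ s \<le> H * inverse (1 + x\<^sup>2)" if n: "n \<ge> N" and x: "x \<in> S" for n x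
  proof -
    have v0: "0 \<le> wn n x" using wn_nonneg n R(4) x by simp
    have q: "1 + x\<^sup>2 > 0" by (simp add: add_pos_nonneg)
    have "wn n x ^ s * (1 + x\<^sup>2) \<le> H"
    proof (cases "R \<le> \<bar>x\<bar>")
      case True
      then have x1: "1 \<le> \<bar>x\<bar>" using R by simp
      have "wn n x ^ s \<le> (\<bar>x\<bar> powr - ?T) ^ s" by (rule power_mono[OF decn[OF n x True] v0])
      also have "\<dots> = \<bar>x\<bar> powr (- ?T * real s)"
        using x1 by (subst powr_realpow[symmetric]) (auto simp: powr_powr)
      also have "\<dots> \<le> \<bar>x\<bar> powr - 2"
        using x1 s2 by (intro powr_mono) (simp_all only: mult_minus_left neg_le_iff_le)
      also have "\<dots> = inverse (x\<^sup>2)" using x1 by (simp add: powr_minus powr_numeral)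
      finally have "wn n x ^ s * (1 + x\<^sup>2) \<le> inverse (x\<^sup>2) * (1 + x\<^sup>2)" using q by (intro mult_right_mono) auto
      also have "\<dots> \<le> 2"
      proof -
        have "1 \<le> x\<^sup>2" using x1 abs_le_square_iff[of 1 x] by simp
        moreover have "x \<noteq> 0" using x1 by auto
        ultimately show ?thesis unfolding inverse_eq_divide by (simp add: pos_divide_le_eq)
      qed
      finally show ?thesis using \<open>C ^ s * (1 + R\<^sup>2) > 0\<close> by (simp add: H_def)
    next
      case False
      have "wn n x ^ s \<le> C ^ s" by (rule power_mono[OF Cn[OF n x] v0])
      moreover have "x\<^sup>2 \<le> R\<^sup>2" using False R abs_le_square_iff[of x R] by simp
      ultimately have "wn n x ^ s * (1 + x\<^sup>2) \<le> C ^ s * (1 + R\<^sup>2)"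
        using R q by (intro mult_mono) auto
      then show ?thesis by (simp add: H_def)
    qed
    then show ?thesis using q by (simp add: field_simps)
  qed
  have "eventually (\<lambda>n. \<forall>x\<in>S. wn n x ^ s \<le> H * inverse (1 + x\<^sup>2)) sequentially"
    using eventually_ge_at_top[of N] by eventually_elim (use bd in blast)
  with H that show ?thesis by blast
qed

lemma p_over_n_facts:
  "(\<lambda>n. real (p n) / (real n)\<^sup>2) \<longlonglongrightarrow> 0" "(\<lambda>n. (real (p n) / real n)\<^sup>2) \<longlonglongrightarrow> \<kappa>\<^sup>2"
proof -
  have "(\<lambda>n. real (p n) / real n * (1 / real n)) \<longlonglongrightarrow> \<kappa> * 0"
    by (intro tendsto_intros p_kappa lim_1_over_n)
  then show "(\<lambda>n. real (p n) / (real n)\<^sup>2) \<longlonglongrightarrow> 0" by (simp add: power2_eq_square)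
  show "(\<lambda>n. (real (p n) / real n)\<^sup>2) \<longlonglongrightarrow> \<kappa>\<^sup>2" by (intro tendsto_intros p_kappa)
qed

lemma nn_integral_cauchy_density: "(\<integral>\<^sup>+x. ennreal (inverse (1 + x\<^sup>2)) \<partial>lborel) = ennreal pi"
proof -
  have i: "integrable lborel (\<lambda>x::real. inverse (1 + x\<^sup>2))"
    using integrable_inverse_1_plus_square by (simp add: set_integrable_def)
  have "(\<integral>x. inverse (1 + x\<^sup>2) \<partial>lborel) = pi"
    using LBINT_inverse_1_plus_square by (simp add: interval_lebesgue_integral_def set_lebesgue_integral_def)
  moreover have "0 \<le> inverse (1 + x\<^sup>2)" for x :: real by simp
  ultimately show ?thesis using i by (subst nn_integral_eq_integral) auto
qed

text \<open>One truncation level serves all of \<open>A\<close> by \<open>cutoff_energy_uniform_on_closed\<close>. The pointwise bound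
  then leaves a product of integrable functions of the single points, whose integral grows only
  exponentially in \<open>p n\<close>.\<close>

lemma empirical_mass_upper:
  assumes A: "closedin (weak_topology S) A" and a: "a < a'"
    and J: "\<And>\<mu>. \<mu> \<in> A \<Longrightarrow> ereal a' < K.log_energy \<mu>"
  shows "eventually (\<lambda>n. empirical_mass \<beta> \<gamma> (wn n) n (p n) A \<le> ennreal (exp (- a * (real n)\<^sup>2))) sequentially"
proof -
  obtain M :: nat where M: "\<And>\<mu>. \<mu> \<in> A \<Longrightarrow> a' < K.cutoff_energy (real M) \<mu>"
    using K.cutoff_energy_uniform_on_closed[OF A J] by blast
  define \<eta> where "\<eta> = (a' - a) / 2"
  have \<eta>: "\<eta> > 0" using a by (simp add: \<eta>_def)
  obtain s H where H: "H > 0" and Hev: "eventually (\<lambda>n. \<forall>x\<in>S. wn n x ^ s \<le> H * inverse (1 + x\<^sup>2)) sequentially"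
    by (rule wn_power_integrable_bound)
  have "exp (- real M) * (exp \<eta> - 1) > 0" using \<eta> by simp
  from ker_uniform_upper[OF this, of s]
  have kev: "eventually (\<lambda>n. \<forall>x\<in>S. \<forall>y\<in>S. ker (wn n) (expo s n) x y \<le> E x y + exp (- real M) * (exp \<eta> - 1)) sequentially" .
  let ?ex = "\<lambda>n. 1 / \<kappa>\<^sup>2 * ((real (p n) / real n)\<^sup>2 * (\<eta> - a') + real (p n) / (real n)\<^sup>2 * real M) + real (p n) / (real n)\<^sup>2 * ln (H * pi)"
  have "?ex \<longlonglongrightarrow> 1 / \<kappa>\<^sup>2 * (\<kappa>\<^sup>2 * (\<eta> - a') + 0 * real M) + 0 * ln (H * pi)"
    by (intro tendsto_intros p_over_n_facts)
  then have "?ex \<longlonglongrightarrow> \<eta> - a'" using kappa by simp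
  moreover have "\<eta> - a' < - a" using a by (simp add: \<eta>_def field_simps)
  ultimately have exev: "eventually (\<lambda>n. ?ex n < - a) sequentially" by (rule order_tendstoD)
  have pev: "eventually (\<lambda>n. p n \<ge> 2) sequentially" using p_top by (auto simp: filterlim_at_top)
  show ?thesis using Hev kev exev pev eventually_gt_at_top[of s]
  proof eventually_elim
    case (elim n)
    let ?m = "p n" and ?L = "PiM {1..p n} (\<lambda>_. lborel :: real measure)"
    let ?c = "exp (1 / \<kappa>\<^sup>2 * (real ?m ^ 2 * (\<eta> - a') + real ?m * real M))"
    interpret product_sigma_finite "\<lambda>_::nat. lborel :: real measure" ..
    have n: "n \<ge> 1" "real s < real n" using elim(5) by auto
    \<comment> \<open>An additive error becomes a factor \<open>exp \<eta>\<close> because \<open>max (exp (- M)) (E x y)\<close> is at least \<open>exp (- M)\<close>.\<close>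
    have ker: "ker (wn n) (expo s n) x y \<le> exp \<eta> * max (exp (- real M)) (E x y)" if "x \<in> S" "y \<in> S" for x y
    proof -
      let ?k = "max (exp (- real M)) (E x y)"
      have "ker (wn n) (expo s n) x y \<le> E x y + exp (- real M) * (exp \<eta> - 1)" using elim(2) that by blast
      also have "\<dots> \<le> ?k + ?k * (exp \<eta> - 1)" using \<eta> by (intro add_mono mult_right_mono) auto
      finally show ?thesis by (simp add: algebra_simps)
    qed
    have pt: "ennreal (ensemble_weight \<beta> \<gamma> S (wn n) n ?m x) * indicator {x \<in> PiE {1..?m} (\<lambda>_. S). empirical_measure S ?m x \<in> A} x
        \<le> ennreal ?c * (\<Prod>j\<in>{1..?m}. ennreal (H * inverse (1 + (x j)\<^sup>2)))" for x
    proof (cases "x \<in> PiE {1..?m} (\<lambda>_. S) \<and> empirical_measure S ?m x \<in> A")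
      case True
      then have x: "x \<in> PiE {1..?m} (\<lambda>_. S)" and xA: "empirical_measure S ?m x \<in> A" by auto
      have "ensemble_weight \<beta> \<gamma> S (wn n) n ?m x \<le>
         exp (1 / \<kappa>\<^sup>2 * (real ?m ^ 2 * (\<eta> - K.cutoff_energy (real M) (empirical_measure S ?m x)) + real ?m * real M)) * (\<Prod>j=1..?m. wn n (x j) ^ s)"
        by (rule ensemble_weight_le[OF n elim(4) x less_imp_le[OF \<eta>] _ ker]) auto
      also have "\<dots> \<le> ?c * (\<Prod>j=1..?m. H * inverse (1 + (x j)\<^sup>2))"
      proof (intro mult_mono prod_mono conjI)
        show "exp (1 / \<kappa>\<^sup>2 * (real ?m ^ 2 * (\<eta> - K.cutoff_energy (real M) (empirical_measure S ?m x)) + real ?m * real M)) \<le> ?c"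
          using M[OF xA] by (subst exp_le_cancel_iff) (intro mult_left_mono add_mono; simp)
        show "0 \<le> (\<Prod>j=1..?m. wn n (x j) ^ s)" using x n wn_nonneg by (intro prod_nonneg) (auto simp: PiE_iff)
        fix j assume j: "j \<in> {1..?m}"
        then have xj: "x j \<in> S" using x by (auto simp: PiE_iff)
        show "wn n (x j) ^ s \<le> H * inverse (1 + (x j)\<^sup>2)" using elim(1) xj by blast
        show "0 \<le> wn n (x j) ^ s" using wn_nonneg[OF n(1) xj] by simp
      qed simp
      finally have "ennreal (ensemble_weight \<beta> \<gamma> S (wn n) n ?m x) \<le> ennreal (?c * (\<Prod>j=1..?m. H * inverse (1 + (x j)\<^sup>2)))"
        by (rule ennreal_leI)
      also have "\<dots> = ennreal ?c * (\<Prod>j\<in>{1..?m}. ennreal (H * inverse (1 + (x j)\<^sup>2)))"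
        using H by (subst ennreal_mult') (auto simp: prod_ennreal)
      finally show ?thesis using True by simp
    qed auto
    have "empirical_mass \<beta> \<gamma> (wn n) n ?m A \<le> (\<integral>\<^sup>+x. ennreal ?c * (\<Prod>j\<in>{1..?m}. ennreal (H * inverse (1 + (x j)\<^sup>2))) \<partial>?L)"
      unfolding empirical_mass_def by (intro nn_integral_mono pt)
    also have "\<dots> = ennreal ?c * (\<integral>\<^sup>+x. (\<Prod>j\<in>{1..?m}. ennreal (H * inverse (1 + (x j)\<^sup>2))) \<partial>?L)"
      by (rule nn_integral_cmult) measurable
    also have "(\<integral>\<^sup>+x. (\<Prod>j\<in>{1..?m}. ennreal (H * inverse (1 + (x j)\<^sup>2))) \<partial>?L) =
        (\<Prod>j\<in>{1..?m}. \<integral>\<^sup>+x. ennreal (H * inverse (1 + x\<^sup>2)) \<partial>lborel)"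
      by (rule product_nn_integral_prod) auto
    also have "\<dots> = ennreal (H * pi) ^ ?m"
    proof -
      have "(\<integral>\<^sup>+x. ennreal (H * inverse (1 + x\<^sup>2)) \<partial>lborel) = ennreal H * (\<integral>\<^sup>+x. ennreal (inverse (1 + x\<^sup>2)) \<partial>lborel)"
        using H by (subst nn_integral_cmult[symmetric]) (auto simp: ennreal_mult')
      also have "\<dots> = ennreal (H * pi)" using H by (simp add: nn_integral_cauchy_density ennreal_mult')
      finally show ?thesis by simp
    qed
    also have "ennreal ?c * \<dots> = ennreal (?c * (H * pi) ^ ?m)"
    proof -
      have "0 \<le> H * pi" using H by simp
      then show ?thesis by (simp only: ennreal_power ennreal_mult'[OF exp_ge_zero])
    qed
    also have "\<dots> \<le> ennreal (exp (- a * (real n)\<^sup>2))"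
    proof (rule ennreal_leI)
      have "(H * pi) ^ ?m = exp (real ?m * ln (H * pi))" using H by (simp add: exp_of_nat_mult)
      then have "?c * (H * pi) ^ ?m = exp (1 / \<kappa>\<^sup>2 * (real ?m ^ 2 * (\<eta> - a') + real ?m * real M) + real ?m * ln (H * pi))"
        by (simp add: exp_add)
      also have "1 / \<kappa>\<^sup>2 * (real ?m ^ 2 * (\<eta> - a') + real ?m * real M) + real ?m * ln (H * pi) = ?ex n * (real n)\<^sup>2"
      proof -
        have scale: "k * ((q * N) * X + (r * N) * Y) + (r * N) * l = (k * (q * X + r * Y) + r * l) * N"
          for k q r X Y l N :: real by (simp add: algebra_simps)
        have "real ?m ^ 2 = (real ?m / real n)\<^sup>2 * (real n)\<^sup>2" "real ?m = real ?m / (real n)\<^sup>2 * (real n)\<^sup>2"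
          using n by (simp_all add: power_divide)
        then show ?thesis using scale by metis
      qed
      also have "exp (?ex n * (real n)\<^sup>2) \<le> exp (- a * (real n)\<^sup>2)"
        using elim(3) by (subst exp_le_cancel_iff) (intro mult_right_mono; simp)
      finally show "?c * (H * pi) ^ ?m \<le> exp (- a * (real n)\<^sup>2)" .
    qed
    finally show ?case .
  qed
qed

end

section \<open>A law of large numbers for empirical measures\<close>

lemma nn_integral_PiM_le:
  fixes M N :: "'b measure"
  assumes M: "sigma_finite_measure M" and N: "sigma_finite_measure N" and sets: "sets M = sets N"
    and le: "\<And>f. f \<in> borel_measurable N \<Longrightarrow> (\<integral>\<^sup>+x. f x \<partial>M) \<le> C * (\<integral>\<^sup>+x. f x \<partial>N)"
    and I: "finite I" and f: "f \<in> borel_measurable (PiM I (\<lambda>_. N))"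
  shows "(\<integral>\<^sup>+x. f x \<partial>PiM I (\<lambda>_. M)) \<le> C ^ card I * (\<integral>\<^sup>+x. f x \<partial>PiM I (\<lambda>_. N))"
  using I f
proof (induction I arbitrary: f rule: finite_induct)
  case empty
  then show ?case by (simp add: PiM_empty nn_integral_count_space_finite)
next
  case (insert i I)
  interpret M: product_sigma_finite "\<lambda>_::'a. M" using M by (simp add: product_sigma_finite_def)
  interpret N: product_sigma_finite "\<lambda>_::'a. N" using N by (simp add: product_sigma_finite_def)
  have sP: "sets (PiM J (\<lambda>_. M)) = sets (PiM J (\<lambda>_. N))" for J :: "'a set"
    using sets by (intro sets_PiM_cong) auto
  note f = insert.prems
  have fM: "f \<in> borel_measurable (PiM (insert i I) (\<lambda>_. M))"
    using f measurable_cong_sets[OF sP refl] by blast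
  have upd: "(\<lambda>(x, y). f (x(i := y))) \<in> borel_measurable (PiM I (\<lambda>_. N) \<Otimes>\<^sub>M N)"
    using measurable_compose[OF measurable_add_dim[of i I "\<lambda>_. N"] f] by (simp add: case_prod_unfold fun_upd_def)
  have inner: "(\<lambda>x. \<integral>\<^sup>+y. f (x(i := y)) \<partial>N) \<in> borel_measurable (PiM I (\<lambda>_. N))"
    using sigma_finite_measure.borel_measurable_nn_integral[OF N, of "\<lambda>x y. f (x(i := y))", OF upd] .
  have "(\<integral>\<^sup>+x. f x \<partial>PiM (insert i I) (\<lambda>_. M)) = (\<integral>\<^sup>+x. \<integral>\<^sup>+y. f (x(i := y)) \<partial>M \<partial>PiM I (\<lambda>_. M))"
    by (rule M.product_nn_integral_insert[OF insert.hyps fM])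
  also have "\<dots> \<le> (\<integral>\<^sup>+x. C * (\<integral>\<^sup>+y. f (x(i := y)) \<partial>N) \<partial>PiM I (\<lambda>_. M))"
  proof (rule nn_integral_mono)
    fix x assume "x \<in> space (PiM I (\<lambda>_. M))"
    then have "x \<in> space (PiM I (\<lambda>_. N))" using sets_eq_imp_space_eq[OF sP] by simp
    then have "(\<lambda>y. f (x(i := y))) \<in> borel_measurable N"
      using measurable_compose[OF measurable_Pair1' upd, of x] by simp
    then show "(\<integral>\<^sup>+y. f (x(i := y)) \<partial>M) \<le> C * (\<integral>\<^sup>+y. f (x(i := y)) \<partial>N)" by (rule le)
  qed
  also have "\<dots> \<le> C ^ card I * (\<integral>\<^sup>+x. C * (\<integral>\<^sup>+y. f (x(i := y)) \<partial>N) \<partial>PiM I (\<lambda>_. N))"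
    by (intro insert.IH borel_measurable_times_ennreal borel_measurable_const inner)
  also have "\<dots> = C ^ card I * (C * (\<integral>\<^sup>+x. \<integral>\<^sup>+y. f (x(i := y)) \<partial>N \<partial>PiM I (\<lambda>_. N)))"
    using inner by (simp add: nn_integral_cmult)
  also have "(\<integral>\<^sup>+x. \<integral>\<^sup>+y. f (x(i := y)) \<partial>N \<partial>PiM I (\<lambda>_. N)) = (\<integral>\<^sup>+x. f x \<partial>PiM (insert i I) (\<lambda>_. N))"
    by (rule N.product_nn_integral_insert[symmetric, OF insert.hyps f])
  finally show ?case using insert.hyps by (simp add: mult_ac)
qed

lemma indep_vars_PiM_components:
  assumes "\<And>i. i \<in> I \<Longrightarrow> prob_space (M i)" "I \<noteq> {}"
  shows "prob_space.indep_vars (PiM I M) M (\<lambda>i z. z i) I"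
proof -
  interpret prob_space "PiM I M" using assms by (intro prob_space_PiM) auto
  have "distr (PiM I M) (PiM I M) (\<lambda>z. \<lambda>i\<in>I. z i) = distr (PiM I M) (PiM I M) (\<lambda>z. z)"
    by (rule distr_cong) (auto simp: space_PiM PiE_def extensional_restrict)
  also have "\<dots> = PiM I M" by (rule distr_id)
  also have "\<dots> = PiM I (\<lambda>i. distr (PiM I M) (M i) (\<lambda>z. z i))"
    using assms by (intro PiM_cong refl distr_PiM_component[symmetric]) auto
  finally show ?thesis
    using assms(2) by (subst indep_vars_iff_distr_eq_PiM') auto
qed

lemma distr_PiM_pair:
  assumes M: "prob_space M" and ij: "i \<in> I" "j \<in> I" "i \<noteq> j"
  shows "distr (PiM I (\<lambda>_. M)) (M \<Otimes>\<^sub>M M) (\<lambda>z. (z i, z j)) = M \<Otimes>\<^sub>M M"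
proof -
  interpret M: prob_space M by fact
  interpret P: product_prob_space "\<lambda>_. M" I by unfold_locales
  have m: "(\<lambda>z. (z i, z j)) \<in> PiM I (\<lambda>_. M) \<rightarrow>\<^sub>M M \<Otimes>\<^sub>M M"
    using ij by (intro measurable_Pair measurable_component_singleton) auto
  show ?thesis
  proof (rule sym, rule pair_measure_eqI)
    fix A B assume A: "A \<in> sets M" and B: "B \<in> sets M"
    have "emeasure (distr (PiM I (\<lambda>_. M)) (M \<Otimes>\<^sub>M M) (\<lambda>z. (z i, z j))) (A \<times> B) =
       emeasure (PiM I (\<lambda>_. M)) ((\<lambda>z. (z i, z j)) -` (A \<times> B) \<inter> space (PiM I (\<lambda>_. M)))"
      using A B by (intro emeasure_distr m) auto
    also have "(\<lambda>z. (z i, z j)) -` (A \<times> B) \<inter> space (PiM I (\<lambda>_. M)) =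
       {z \<in> space (PiM I (\<lambda>_. M)). \<forall>k\<in>{i, j}. z k \<in> (if k = i then A else B)}"
      using ij by auto
    also have "emeasure (PiM I (\<lambda>_. M)) \<dots> = (\<Prod>k\<in>{i, j}. emeasure M (if k = i then A else B))"
      using ij A B by (intro P.emeasure_PiM_Collect) auto
    also have "\<dots> = emeasure M A * emeasure M B" using ij by simp
    finally show "emeasure M A * emeasure M B = emeasure (distr (PiM I (\<lambda>_. M)) (M \<Otimes>\<^sub>M M) (\<lambda>z. (z i, z j))) (A \<times> B)" ..
  qed (use M.sigma_finite_measure_axioms in auto)
qed

context closed_real_interval
begin

text \<open>Hoeffding's inequality treats the subbase, where the condition concerns the mean of a single bounded
  function. The general case follows by induction over the generation of open sets, as intersections
  of two events of probability close to \<open>1\<close> have probability close to \<open>1\<close>.\<close>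

lemma weak_law_of_large_numbers:
  assumes \<nu>: "real_distribution \<nu>" and G: "openin (weak_topology S) G"
    and in_G: "distr \<nu> (restrict_space borel S) proj \<in> G" and supp: "AE x in \<nu>. x \<in> S"
  shows "(\<lambda>m. measure (PiM {1..m} (\<lambda>_. \<nu>)) {x \<in> PiE {1..m} (\<lambda>_. S). empirical_measure S m x \<in> G}) \<longlonglongrightarrow> 1"
proof -
  interpret \<nu>: real_distribution \<nu> by fact
  let ?P = "\<lambda>m. PiM {1..m} (\<lambda>_::nat. \<nu>)"
  let ?T = "\<lambda>m G. {x \<in> PiE {1..m} (\<lambda>_. S). empirical_measure S m x \<in> G}"
  let ?\<nu>S = "distr \<nu> (restrict_space borel S) proj"
  let ?B = "{{\<mu> \<in> borel_prob_measures S. (\<integral>x. f x \<partial>\<mu>) \<in> V} | (f :: real \<Rightarrow> real) V.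
        continuous_on S f \<and> bounded (f ` S) \<and> open V}"
  have \<nu>S: "?\<nu>S \<in> borel_prob_measures S" by (rule from_line_prob[OF \<nu>]) auto
  have gen: "openin (weak_topology S) H \<longleftrightarrow> generate_topology_on ?B H" for H
    unfolding weak_topology_def by (rule openin_topology_generated_by_iff)
  have T: "?T m H \<in> sets (?P m)" if "generate_topology_on ?B H" "m \<ge> 1" for m H
    using that by (intro sets_empirical_preimage) (auto simp: gen measurable_ident_sets)
  have psP: "prob_space (?P m)" for m by (intro prob_space_PiM \<nu>.prob_space_axioms)
  have le1: "eventually (\<lambda>m. measure (?P m) (?T m H) \<le> 1) sequentially" for H
    by (intro always_eventually allI prob_space.prob_le_1 psP)
  have prob1: "measure (?P m) (PiE {1..m} (\<lambda>_. S)) = 1" for m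
  proof -
    interpret P: finite_product_prob_space "\<lambda>_::nat. \<nu>" "{1..m}" by unfold_locales auto
    have "measure (?P m) (PiE {1..m} (\<lambda>_. S)) = (\<Prod>i\<in>{1..m}. measure \<nu> S)"
      using closed_S by (intro P.prob_times) auto
    moreover have "measure \<nu> S = 1"
      using supp closed_S by (subst \<nu>.prob_eq_1) auto
    ultimately show ?thesis by simp
  qed
  have "generate_topology_on ?B G" using G gen by simp
  then show ?thesis using in_G
  proof (induction rule: generate_topology_on.induct)
    case (Int a b)
    have lim: "(\<lambda>m. measure (?P m) (?T m a) + measure (?P m) (?T m b) - 1) \<longlonglongrightarrow> 1 + 1 - 1"
      using Int by (intro tendsto_intros) auto
    have "eventually (\<lambda>m. measure (?P m) (?T m a) + measure (?P m) (?T m b) - 1 \<le> measure (?P m) (?T m (a \<inter> b))) sequentially"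
      using eventually_ge_at_top[of 1]
    proof eventually_elim
      case (elim m)
      interpret Pm: prob_space "?P m" by (rule psP)
      have s: "?T m a \<in> sets (?P m)" "?T m b \<in> sets (?P m)" using T Int elim by auto
      have "measure (?P m) (?T m a) + measure (?P m) (?T m b) =
          measure (?P m) (?T m a \<union> ?T m b) + measure (?P m) (?T m a \<inter> ?T m b)"
      proof -
        have "measure (?P m) (?T m a \<union> ?T m b) = measure (?P m) (?T m a) + measure (?P m) (?T m b - ?T m a)"
          using s by (intro measure_Un2) (auto simp: fmeasurable_def Pm.emeasure_eq_measure)
        then show ?thesis using Pm.finite_measure_Diff'[OF s(2,1)] by (simp add: Int_commute)
      qed
      moreover have "measure (?P m) (?T m a \<union> ?T m b) \<le> 1" by simp
      moreover have "?T m a \<inter> ?T m b = ?T m (a \<inter> b)" by auto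
      ultimately show ?case by simp
    qed
    then show ?case
      by (rule tendsto_sandwich[OF _ le1 _ tendsto_const]) (use lim in simp)
  next
    case (UN K)
    then obtain k where k: "k \<in> K" "?\<nu>S \<in> k" by auto
    have lim: "(\<lambda>m. measure (?P m) (?T m k)) \<longlonglongrightarrow> 1" using UN.IH[OF k] .
    have "eventually (\<lambda>m. measure (?P m) (?T m k) \<le> measure (?P m) (?T m (\<Union>K))) sequentially"
      using eventually_ge_at_top[of 1]
    proof eventually_elim
      case (elim m)
      interpret Pm: prob_space "?P m" by (rule psP)
      have "generate_topology_on ?B (\<Union>K)" using UN.hyps by (rule generate_topology_on.UN)
      then show ?case using k elim by (intro Pm.finite_measure_mono T) auto
    qed
    then show ?case by (rule tendsto_sandwich[OF _ le1 lim tendsto_const])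
  next
    case (Basis s)
    then obtain f :: "real \<Rightarrow> real" and V where s: "s = {\<mu> \<in> borel_prob_measures S. (\<integral>x. f x \<partial>\<mu>) \<in> V}"
      "continuous_on S f" "bounded (f ` S)" "open V" by blast
    obtain c where c: "\<forall>y\<in>f ` S. norm y \<le> c" using s(3) unfolding bounded_iff by blast
    let ?g = "\<lambda>x. f (proj x)"
    have g[measurable]: "?g \<in> borel_measurable borel"
      using continuous_on_compose_proj[OF s(2)] by (rule borel_measurable_continuous_onI)
    have gc: "\<bar>?g x\<bar> \<le> c" for x using c by simp
    define e where "e = (\<integral>x. ?g x \<partial>\<nu>)"
    have eS: "(\<integral>x. f x \<partial>?\<nu>S) = e" unfolding e_def
      by (intro integral_distr borel_measurable_continuous_on_restrict s(2)) (auto intro: measurable_restrict_space2)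
    then have "e \<in> V" using Basis.prems s(1) by auto
    then obtain d where d: "d > 0" "ball e d \<subseteq> V" using s(4) openE by blast
    define b where "b = \<bar>c\<bar> + 1"
    have b: "- b < b" by (simp add: b_def)
    have lower: "1 - 2 * exp (- (2 * d\<^sup>2 / (b - - b)\<^sup>2) * real m) \<le> measure (?P m) (?T m s)" if m: "m \<ge> 1" for m
    proof -
      interpret Pm: prob_space "?P m" by (rule psP)
      interpret H: Hoeffding_ineq_iid "?P m" "{1..m}" "\<lambda>j z. ?g (z j)" "\<lambda>z. ?g (z 1)" "- b" b "\<integral>z. ?g (z 1) \<partial>?P m"
      proof unfold_locales
        show "Pm.indep_vars (\<lambda>_. borel) (\<lambda>j z. ?g (z j)) {1..m}"
          by (rule Pm.indep_vars_compose2[OF indep_vars_PiM_components]) (use m \<nu>.prob_space_axioms in auto)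
        have c1: "(\<lambda>z. z j) \<in> ?P m \<rightarrow>\<^sub>M \<nu>" if "j \<in> {1..m}" for j using that by measurable
        have D: "distr (?P m) borel (\<lambda>z. ?g (z j)) = distr \<nu> borel ?g" if j: "j \<in> {1..m}" for j
        proof -
          have "distr (?P m) borel (?g \<circ> (\<lambda>z. z j)) = distr (distr (?P m) \<nu> (\<lambda>z. z j)) borel ?g"
            by (rule distr_distr[symmetric]) (use c1[OF j] in auto)
          also have "distr (?P m) \<nu> (\<lambda>z. z j) = \<nu>" using distr_PiM_component[of "{1..m}" "\<lambda>_. \<nu>" j] j \<nu>.prob_space_axioms by auto
          finally show ?thesis by (simp add: o_def)
        qed
        show "distr (?P m) borel (\<lambda>z. ?g (z i)) = distr (?P m) borel (\<lambda>z. ?g (z 1))" if "i \<in> {1..m}" for i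
          using D[OF that] D[of 1] m by simp
        show "(\<lambda>z. ?g (z 1)) \<in> borel_measurable (?P m)"
          using measurable_compose[OF c1[of 1], of ?g borel] m by simp
        have "?g (z 1) \<in> {- b..b}" for z using gc[of "z 1"] by (auto simp: b_def)
        then show "AE z in ?P m. ?g (z 1) \<in> {- b..b}" by (rule AE_I2)
      qed auto
      have mean: "(\<integral>z. ?g (z 1) \<partial>?P m) = e"
      proof -
        have c: "distr (?P m) \<nu> (\<lambda>z. z 1) = \<nu>"
          by (rule distr_PiM_component) (use m \<nu>.prob_space_axioms in auto)
        have "(\<integral>x. ?g x \<partial>distr (?P m) \<nu> (\<lambda>z. z 1)) = (\<integral>z. ?g (z 1) \<partial>?P m)"
          by (rule integral_distr[OF measurable_component_singleton]) (use m in auto)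
        then show ?thesis unfolding c e_def by (rule sym)
      qed
      let ?D = "{z \<in> space (?P m). \<bar>(\<Sum>i\<in>{1..m}. ?g (z i)) / real (card {1..m}) - (\<integral>z. ?g (z 1) \<partial>?P m)\<bar> \<ge> d}"
      have Dm: "?D \<in> sets (?P m)"
      proof -
        have [measurable]: "(\<lambda>z. ?g (z i)) \<in> borel_measurable (?P m)" if "i \<in> {1..m}" for i
          using measurable_compose[OF measurable_component_singleton[OF that, of "\<lambda>_. \<nu>"], of ?g borel] by simp
        show ?thesis by measurable
      qed
      have "measure (?P m) ?D \<le> 2 * exp (- 2 * real (card {1..m}) * d\<^sup>2 / (b - - b)\<^sup>2)"
        using d(1) b m by (intro H.Hoeffding_ineq_abs_ge') auto
      also have "\<dots> = 2 * exp (- (2 * d\<^sup>2 / (b - - b)\<^sup>2) * real m)" by (simp add: mult_ac)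
      finally have H: "measure (?P m) ?D \<le> 2 * exp (- (2 * d\<^sup>2 / (b - - b)\<^sup>2) * real m)" .
      have PE: "PiE {1..m} (\<lambda>_. S) \<in> sets (?P m)" using closed_S by (intro sets_PiM_I_finite) auto
      have "1 = measure (?P m) (PiE {1..m} (\<lambda>_. S))" using prob1 by simp
      also have "\<dots> \<le> measure (?P m) (?D \<union> ?T m s)"
      proof (rule Pm.finite_measure_mono)
        show "?D \<union> ?T m s \<in> sets (?P m)" using Dm T[OF generate_topology_on.Basis[OF Basis.hyps] m] by blast
        show "PiE {1..m} (\<lambda>_. S) \<subseteq> ?D \<union> ?T m s"
        proof
          fix z assume z: "z \<in> PiE {1..m} (\<lambda>_. S)"
          then have zS: "z j \<in> S" if "j \<in> {1..m}" for j using that by (auto simp: PiE_iff)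
          have sp: "z \<in> space (?P m)" using z by (auto simp: space_PiM PiE_iff)
          have i: "(\<integral>x. f x \<partial>empirical_measure S m z) = (\<Sum>i\<in>{1..m}. ?g (z i)) / real (card {1..m})"
            using integral_empirical_measure[OF m zS borel_measurable_continuous_on_restrict[OF s(2)]] zS
            by (simp add: proj_id)
          show "z \<in> ?D \<union> ?T m s"
          proof (cases "z \<in> ?D")
            case False
            then have "\<bar>(\<integral>x. f x \<partial>empirical_measure S m z) - e\<bar> < d" using sp unfolding i mean[symmetric] by auto
            then have "(\<integral>x. f x \<partial>empirical_measure S m z) \<in> V" using d(2) by (auto simp: dist_real_def abs_minus_commute)
            then show ?thesis using z empirical_measure_in[OF m zS] s(1) by auto
          qed simp
        qed
      qed
      also have "\<dots> \<le> measure (?P m) ?D + measure (?P m) (?T m s)"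
        using Dm T[OF generate_topology_on.Basis[OF Basis.hyps] m] by (rule measure_Un_le)
      finally show ?thesis using H by linarith
    qed
    have "2 * d\<^sup>2 / (b - - b)\<^sup>2 > 0" using d(1) b by simp
    then have "(\<lambda>m. exp (- (2 * d\<^sup>2 / (b - - b)\<^sup>2) * real m)) \<longlonglongrightarrow> 0"
      by (intro filterlim_compose[OF exp_at_bot] filterlim_tendsto_neg_mult_at_bot[OF tendsto_const] filterlim_real_sequentially) auto
    then have lim: "(\<lambda>m. 1 - 2 * exp (- (2 * d\<^sup>2 / (b - - b)\<^sup>2) * real m)) \<longlonglongrightarrow> 1 - 2 * 0"
      by (intro tendsto_intros)
    have "eventually (\<lambda>m. 1 - 2 * exp (- (2 * d\<^sup>2 / (b - - b)\<^sup>2) * real m) \<le> measure (?P m) (?T m s)) sequentially"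
      using eventually_ge_at_top[of 1] by eventually_elim (rule lower)
    then show ?case by (rule tendsto_sandwich[OF _ le1 _ tendsto_const]) (use lim in simp)
  qed simp
qed

end

section \<open>The lower bound for measures of bounded density\<close>

lemma AE_neq_of_bounded_density:
  fixes \<nu> :: "real measure"
  assumes sets: "sets \<nu> = sets borel"
    and dens: "\<And>f. f \<in> borel_measurable borel \<Longrightarrow> (\<integral>\<^sup>+y. f y \<partial>\<nu>) \<le> C * (\<integral>\<^sup>+y. f y \<partial>lborel)"
  shows "AE y in \<nu>. x \<noteq> y"
proof -
  have s: "{x} \<in> sets \<nu>" using sets by simp
  have "emeasure \<nu> {x} = (\<integral>\<^sup>+y. indicator {x} y \<partial>\<nu>)" using s by (simp add: nn_integral_indicator)
  also have "\<dots> \<le> C * (\<integral>\<^sup>+y. indicator {x} y \<partial>lborel)" by (rule dens) simp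
  also have "\<dots> = 0" by simp
  finally have "{x} \<in> null_sets \<nu>" using s by (auto simp: null_sets_def)
  then have "AE y in \<nu>. y \<notin> {x}" by (rule AE_not_in)
  then show ?thesis by eventually_elim auto
qed

lemma AE_pair_distinct_of_bounded_density:
  fixes \<nu> :: "real measure"
  assumes \<nu>: "real_distribution \<nu>"
    and dens: "\<And>f. f \<in> borel_measurable borel \<Longrightarrow> (\<integral>\<^sup>+y. f y \<partial>\<nu>) \<le> C * (\<integral>\<^sup>+y. f y \<partial>lborel)"
    and AEK: "AE x in \<nu>. x \<in> K" and [measurable]: "K \<in> sets borel"
  shows "AE z in \<nu> \<Otimes>\<^sub>M \<nu>. fst z \<in> K \<and> snd z \<in> K \<and> fst z \<noteq> snd z"
proof -
  interpret \<nu>: real_distribution \<nu> by fact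
  show ?thesis
  proof (rule pair_sigma_finite.AE_pair_measure)
    show "pair_sigma_finite \<nu> \<nu>" by unfold_locales
    have "{z \<in> space (\<nu> \<Otimes>\<^sub>M \<nu>). fst z \<in> K \<and> snd z \<in> K \<and> fst z - snd z \<noteq> 0} \<in> sets (\<nu> \<Otimes>\<^sub>M \<nu>)" by measurable
    then show "{z \<in> space (\<nu> \<Otimes>\<^sub>M \<nu>). fst z \<in> K \<and> snd z \<in> K \<and> fst z \<noteq> snd z} \<in> sets (\<nu> \<Otimes>\<^sub>M \<nu>)" by simp
    show "AE x in \<nu>. AE y in \<nu>. fst (x, y) \<in> K \<and> snd (x, y) \<in> K \<and> fst (x, y) \<noteq> snd (x, y)"
      using AEK
    proof eventually_elim
      case (elim x)
      have "AE y in \<nu>. x \<noteq> y" by (rule AE_neq_of_bounded_density[OF _ dens]) simp_all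
      with AEK show ?case by eventually_elim (use elim in simp)
    qed
  qed
qed

text \<open>The exponential lies above its tangent, \<open>exp x \<ge> exp t * (1 + x - t)\<close>. Integrated over \<open>T\<close> this
  needs the integral of \<open>l\<close> over \<open>T\<close>, which is at least the expectation minus the largest possible
  contribution of the complement of \<open>T\<close>.\<close>

lemma (in prob_space) tilted_lower_bound:
  fixes l :: "'a \<Rightarrow> real"
  assumes T: "T \<in> events" and l: "integrable M l" and up: "AE z in M. l z \<le> c"
  shows "ennreal (exp t * (prob T * (1 - t) + expectation l - c * (1 - prob T)))
     \<le> (\<integral>\<^sup>+z. ennreal (exp (l z)) * indicator T z \<partial>M)"
proof -
  let ?h = "\<lambda>z. exp t * (indicator T z * (1 - t) + indicator T z * l z)"
  have iT: "integrable M (\<lambda>z. indicator T z * l z :: real)"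
    using integrable_real_mult_indicator[OF T l] by (simp add: mult.commute)
  have iC: "integrable M (\<lambda>z. indicator (space M - T) z * l z :: real)"
    using integrable_real_mult_indicator[OF sets.compl_sets[OF T] l] by (simp add: mult.commute)
  have ih: "integrable M ?h"
    using T iT by (intro Bochner_Integration.integrable_mult_right Bochner_Integration.integrable_add integrable_mult_left integrable_real_indicator)
       (auto simp: emeasure_eq_measure)
  have "expectation l = (\<integral>z. indicator T z * l z + indicator (space M - T) z * l z \<partial>M)"
    by (rule Bochner_Integration.integral_cong) (auto split: split_indicator)
  also have "\<dots> = (\<integral>z. indicator T z * l z \<partial>M) + (\<integral>z. indicator (space M - T) z * l z \<partial>M)"
    by (rule Bochner_Integration.integral_add[OF iT iC])
  also have "(\<integral>z. indicator (space M - T) z * l z \<partial>M) \<le> (\<integral>z. c * indicator (space M - T) z \<partial>M)"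
  proof (rule integral_mono_AE[OF iC])
    show "integrable M (\<lambda>z. c * indicator (space M - T) z)"
      using T by (intro integrable_mult_right integrable_real_indicator) (auto simp: emeasure_eq_measure)
    show "AE z in M. indicator (space M - T) z * l z \<le> c * indicator (space M - T) z"
      using up by eventually_elim (auto split: split_indicator)
  qed
  also have "(\<integral>z. c * indicator (space M - T) z \<partial>M) = c * (1 - prob T)"
  proof -
    have "(\<integral>z. c * indicator (space M - T) z \<partial>M) = c * prob (space M - T)"
      using T by (subst integral_mult_right_zero) (simp add: Int_absorb2)
    then show ?thesis using prob_compl[OF T] by simp
  qed
  finally have e: "expectation l - c * (1 - prob T) \<le> (\<integral>z. indicator T z * l z \<partial>M)" by simp
  have "exp t * (prob T * (1 - t) + expectation l - c * (1 - prob T)) \<le>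
     exp t * (prob T * (1 - t) + (\<integral>z. indicator T z * l z \<partial>M))"
    using e by (intro mult_left_mono) auto
  also have "\<dots> = (\<integral>z. ?h z \<partial>M)"
  proof -
    have "integrable M (\<lambda>z. indicator T z * (1 - t) :: real)"
      using T by (intro integrable_mult_left integrable_real_indicator) (auto simp: emeasure_eq_measure)
    moreover have "(\<integral>z. indicator T z * (1 - t) \<partial>M) = prob T * (1 - t)"
      using T sets.sets_into_space[OF T] by (subst integral_mult_left_zero) (simp add: Int_absorb2)
    ultimately show ?thesis using iT by (simp add: Int_absorb2[OF sets.sets_into_space[OF T]])
  qed
  finally have "ennreal (exp t * (prob T * (1 - t) + expectation l - c * (1 - prob T))) \<le> ennreal (\<integral>z. ?h z \<partial>M)"
    by (rule ennreal_leI)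
  also have "\<dots> \<le> ennreal (\<integral>z. max 0 (?h z) \<partial>M)"
    using ih by (intro ennreal_leI integral_mono integrable_max) auto
  also have "\<dots> = (\<integral>\<^sup>+z. ennreal (max 0 (?h z)) \<partial>M)"
    using ih by (intro nn_integral_eq_integral[symmetric] integrable_max) auto
  also have "\<dots> \<le> (\<integral>\<^sup>+z. ennreal (exp (l z)) * indicator T z \<partial>M)"
  proof (rule nn_integral_mono)
    fix z
    have "exp t * (1 + (l z - t)) \<le> exp t * exp (l z - t)"
      using exp_ge_add_one_self[of "l z - t"] by (intro mult_left_mono) auto
    also have "\<dots> = exp (l z)" by (simp add: exp_add[symmetric])
    finally have "exp t * (1 - t + l z) \<le> exp (l z)" by (simp add: algebra_simps)
    then show "ennreal (max 0 (?h z)) \<le> ennreal (exp (l z)) * indicator T z"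
      by (auto split: split_indicator intro!: ennreal_leI)
  qed
  finally show ?thesis .
qed

lemma odd_power_inject_real:
  fixes x y :: real
  assumes "odd n" "x ^ n = y ^ n"
  shows "x = y"
proof -
  have "root n (x ^ n) = x" "root n (y ^ n) = y" using odd_real_root_power_cancel[OF assms(1)] by auto
  then show ?thesis using assms(2) by metis
qed

context beta_ensemble
begin

text \<open>This is where even \<open>\<gamma>\<close> requires \<open>S\<close> to be nonnegative.\<close>

lemma power_inject_on_S: "x \<in> S \<Longrightarrow> y \<in> S \<Longrightarrow> x ^ \<gamma> = y ^ \<gamma> \<longleftrightarrow> x = y"
  using S_even gamma odd_power_inject_real[of \<gamma> x y] power_eq_imp_eq_base[of x \<gamma> y] by (cases "even \<gamma>") auto

text \<open>Let \<open>l n\<close> be the logarithm of the ensemble weight. Under \<open>p n\<close> independent samples of \<open>\<nu>\<close> it has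
  expectation \<open>en n\<close>, where \<open>en n / n\<^sup>2 \<rightarrow> - J\<close> with \<open>J\<close> the left-hand side of the last assumption,
  and it is bounded above by a multiple of \<open>n\<^sup>2\<close>. By the law of large numbers the event \<open>?T\<close> that
  the empirical measure lies in \<open>G\<close> has probability near \<open>1\<close>, so \<open>tilted_lower_bound\<close> at a \<open>t\<close>
  slightly below \<open>en n\<close> bounds the integral of the weight over \<open>?T\<close> with respect to the law of the
  samples. Replacing this law by Lebesgue measure costs the factor \<open>C ^ p n\<close>.\<close>

lemma empirical_mass_lower_regular:
  fixes \<nu> :: "real measure" and K :: "real set" and C :: real
  assumes \<nu>: "real_distribution \<nu>" and K: "compact K" "K \<subseteq> S - zero_set S w" and supp: "AE x in \<nu>. x \<in> K"
    and C: "C \<ge> 1" and dens: "\<And>f. f \<in> borel_measurable borel \<Longrightarrow> (\<integral>\<^sup>+x. f x \<partial>\<nu>) \<le> ennreal C * (\<integral>\<^sup>+x. f x \<partial>lborel)"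
    and int: "integrable (\<nu> \<Otimes>\<^sub>M \<nu>) (\<lambda>(x, y). ln \<bar>x ^ \<gamma> - y ^ \<gamma>\<bar>)"
    and G: "openin (weak_topology S) G" "distr \<nu> (restrict_space borel S) proj \<in> G"
    and a: "- (\<beta> * \<kappa>\<^sup>2 / 2) * (\<integral>(x, y). ln \<bar>x ^ \<gamma> - y ^ \<gamma>\<bar> \<partial>(\<nu> \<Otimes>\<^sub>M \<nu>)) - \<kappa> * (\<integral>x. ln (w (proj x)) \<partial>\<nu>) < a"
  shows "eventually (\<lambda>n. ennreal (exp (- a * (real n)\<^sup>2)) \<le> empirical_mass \<beta> \<gamma> (wn n) n (p n) G) sequentially"
proof -
  interpret \<nu>: real_distribution \<nu> by fact
  let ?P = "\<lambda>m. PiM {1..m} (\<lambda>_::nat. \<nu>)" and ?L = "\<lambda>m. PiM {1..m} (\<lambda>_::nat. lborel :: real measure)"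
  let ?T = "\<lambda>m. {x \<in> PiE {1..m} (\<lambda>_. S). empirical_measure S m x \<in> G}"
  let ?U = "\<lambda>m. {(i, j). 1 \<le> i \<and> i < j \<and> j \<le> (m::nat)}"
  let ?k = "\<lambda>x y :: real. ln \<bar>x ^ \<gamma> - y ^ \<gamma>\<bar>"
  define I2 where "I2 = (\<integral>(x, y). ?k x y \<partial>(\<nu> \<Otimes>\<^sub>M \<nu>))"
  define lw where "lw n x = ln (wn n (proj x))" for n x
  define lw0 where "lw0 x = ln (w (proj x))" for x
  define l where "l n z = \<beta> * (\<Sum>(i, j)\<in>?U (p n). ?k (z i) (z j)) + real n * (\<Sum>j=1..p n. lw n (z j))" for n z
  define J where "J = - (\<beta> * \<kappa>\<^sup>2 / 2) * I2 - \<kappa> * (\<integral>x. lw0 x \<partial>\<nu>)"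
  have Ja: "J < a" using a unfolding J_def I2_def lw0_def .
  have KS: "K \<subseteq> S" using K by auto
  have psP: "prob_space (?P m)" for m by (intro prob_space_PiM \<nu>.prob_space_axioms)
  have finU: "finite (?U m)" for m by (rule finite_index_pairs)
  have cardU: "2 * real (card (?U m)) = real m * (real m - 1)" for m
  proof -
    have "(\<Sum>i=1..m. \<Sum>j=1..m. 1) = 2 * (\<Sum>(i, j)\<in>?U m. 1) + (\<Sum>i=1..m. 1 :: real)"
      by (rule sum_off_diagonal) simp
    then show ?thesis by (simp add: algebra_simps)
  qed
  have wpos: "w x > 0" if "x \<in> K" for x
    using that K(2) w_nonneg[of x] by (force simp: zero_set_def)

  have cont_lw: "continuous_on K (\<lambda>x. ln (w x))"
    using wpos by (intro continuous_on_ln continuous_on_subset[OF w_cont KS]) force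
  have "compact ((\<lambda>x. ln (w x)) ` K)" by (rule compact_continuous_image[OF cont_lw K(1)])
  from compact_imp_bounded[OF this] obtain B0 where "\<forall>y\<in>(\<lambda>x. ln (w x)) ` K. norm y \<le> B0" unfolding bounded_iff by blast
  then have B0: "\<bar>ln (w x)\<bar> \<le> B0" if "x \<in> K" for x using that by simp
  from compact_imp_bounded[OF K(1)] obtain R where R: "\<And>x. x \<in> K \<Longrightarrow> \<bar>x\<bar> \<le> R" unfolding bounded_iff by auto
  define D where "D = ln (2 * (\<bar>R\<bar> + 1) ^ \<gamma>)"
  have R1: "(\<bar>R\<bar> + 1) ^ \<gamma> \<ge> 1" by (rule one_le_power) simp
  have D0: "D \<ge> 0" unfolding D_def using R1 by (intro ln_ge_zero) linarith
  have kD: "?k x y \<le> D" if "x \<in> K" "y \<in> K" for x y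
  proof (cases "x ^ \<gamma> = y ^ \<gamma>")
    case False
    have "\<bar>x ^ \<gamma> - y ^ \<gamma>\<bar> \<le> \<bar>x\<bar> ^ \<gamma> + \<bar>y\<bar> ^ \<gamma>" by (metis abs_triangle_ineq4 power_abs)
    also have "\<dots> \<le> (\<bar>R\<bar> + 1) ^ \<gamma> + (\<bar>R\<bar> + 1) ^ \<gamma>"
      using R[OF that(1)] R[OF that(2)] by (intro add_mono power_mono) auto
    finally have "\<bar>x ^ \<gamma> - y ^ \<gamma>\<bar> \<le> 2 * (\<bar>R\<bar> + 1) ^ \<gamma>" by simp
    moreover have "0 < \<bar>x ^ \<gamma> - y ^ \<gamma>\<bar>" using False by simp
    ultimately show ?thesis unfolding D_def by (subst ln_le_cancel_iff) linarith+
  qed (use D0 in simp)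
  have wn_close: "eventually (\<lambda>n. \<forall>x\<in>K. \<bar>ln (wn n x) - ln (w x)\<bar> < d) sequentially" if "d > 0" for d
    using log_wn_conv[OF K] that by (auto simp: uniform_limit_iff dist_real_def)
  have wn_pos: "eventually (\<lambda>n. \<forall>x\<in>K. wn n x > 0) sequentially"
    using zeros_wn eventually_ge_at_top[of 1]
  proof eventually_elim
    case (elim n)
    show ?case
    proof
      fix x assume x: "x \<in> K"
      then have "wn n x \<noteq> 0" "x \<in> S" using elim(1) K(2) by (auto simp: zero_set_def)
      then show "wn n x > 0" using wn_nonneg[OF elim(2)] by (simp add: less_le)
    qed
  qed
  have lwm: "lw n \<in> borel_measurable borel" if "n \<ge> 1" for n
    unfolding lw_def using borel_measurable_continuous_onI[OF continuous_on_compose_proj[OF wn_cont[OF that]]]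
    by (rule borel_measurable_ln)
  have lw0m: "lw0 \<in> borel_measurable borel"
    unfolding lw0_def using borel_measurable_continuous_onI[OF continuous_on_compose_proj[OF w_cont]]
    by (rule borel_measurable_ln)
  have supp0: "AE x in \<nu>. \<bar>lw0 x\<bar> \<le> B0"
    using supp by eventually_elim (use B0 KS in \<open>auto simp: lw0_def proj_id subset_eq\<close>)
  have int0: "integrable \<nu> lw0"
    by (rule \<nu>.integrable_const_bound[of _ B0]) (use supp0 lw0m in auto)
  have close1: "eventually (\<lambda>n. \<forall>x\<in>K. \<bar>ln (wn n x) - ln (w x)\<bar> < 1) sequentially" by (rule wn_close) simp
  have lw_ae: "AE x in \<nu>. \<bar>lw n x - lw0 x\<bar> < d" if "\<forall>x\<in>K. \<bar>ln (wn n x) - ln (w x)\<bar> < d" for n d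
    using supp by eventually_elim (use that KS in \<open>auto simp: lw_def lw0_def proj_id subset_eq\<close>)
  have intn: "integrable \<nu> (lw n)" if "n \<ge> 1" "\<forall>x\<in>K. \<bar>ln (wn n x) - ln (w x)\<bar> < 1" for n
  proof (rule \<nu>.integrable_const_bound[of _ "B0 + 1"])
    show "AE x in \<nu>. norm (lw n x) \<le> B0 + 1"
      using lw_ae[OF that(2)] supp0 by eventually_elim (unfold real_norm_def, linarith)
  qed (use lwm[OF that(1)] in simp)
  have lim_lw: "(\<lambda>n. \<integral>x. lw n x \<partial>\<nu>) \<longlonglongrightarrow> (\<integral>x. lw0 x \<partial>\<nu>)"
  proof (rule tendstoI)
    fix e :: real assume e: "e > 0"
    have "eventually (\<lambda>n. \<forall>x\<in>K. \<bar>ln (wn n x) - ln (w x)\<bar> < e / 2) sequentially" using e by (intro wn_close) simp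
    then show "eventually (\<lambda>n. dist (\<integral>x. lw n x \<partial>\<nu>) (\<integral>x. lw0 x \<partial>\<nu>) < e) sequentially"
      using close1 eventually_ge_at_top[of 1]
    proof eventually_elim
      case (elim n)
      note i = intn[OF elim(3,2)] int0
      have "\<bar>(\<integral>x. lw n x \<partial>\<nu>) - (\<integral>x. lw0 x \<partial>\<nu>)\<bar> = \<bar>\<integral>x. lw n x - lw0 x \<partial>\<nu>\<bar>" using i by simp
      also have "\<dots> \<le> (\<integral>x. \<bar>lw n x - lw0 x\<bar> \<partial>\<nu>)" using integral_norm_bound[of \<nu> "\<lambda>x. lw n x - lw0 x"] by simp
      also have "\<dots> \<le> (\<integral>x. e / 2 \<partial>\<nu>)"
        using i lw_ae[OF elim(1)] by (intro integral_mono_AE) (auto elim: eventually_mono)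
      also have "\<dots> < e" using e \<nu>.prob_space by simp
      finally show ?case by (simp add: dist_real_def)
    qed
  qed
  have comp: "distr (?P m) \<nu> (\<lambda>z. z j) = \<nu>" if "j \<in> {1..m}" for m j
    using distr_PiM_component[of "{1..m}" "\<lambda>_. \<nu>" j] that \<nu>.prob_space_axioms by auto
  have E1: "integrable (?P m) (\<lambda>z. f (z j))" "(\<integral>z. f (z j) \<partial>?P m) = (\<integral>x. f x \<partial>\<nu>)"
    if "j \<in> {1..m}" "integrable \<nu> f" for m j and f :: "real \<Rightarrow> real"
  proof -
    have c: "(\<lambda>z. z j) \<in> ?P m \<rightarrow>\<^sub>M \<nu>" using that by measurable
    have f: "f \<in> borel_measurable \<nu>" using that by auto
    show "integrable (?P m) (\<lambda>z. f (z j))" using integrable_distr_eq[OF c f] that comp by simp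
    show "(\<integral>z. f (z j) \<partial>?P m) = (\<integral>x. f x \<partial>\<nu>)" using integral_distr[OF c f] that comp by simp
  qed
  have E2: "integrable (?P m) (\<lambda>z. ?k (z i) (z j))" "(\<integral>z. ?k (z i) (z j) \<partial>?P m) = I2"
    if "(i, j) \<in> ?U m" for m i j
  proof -
    have ij: "i \<in> {1..m}" "j \<in> {1..m}" "i \<noteq> j" using that by auto
    have c: "(\<lambda>z. (z i, z j)) \<in> ?P m \<rightarrow>\<^sub>M \<nu> \<Otimes>\<^sub>M \<nu>"
      using ij by (intro measurable_Pair measurable_component_singleton) auto
    have k: "(\<lambda>(x, y). ?k x y) \<in> borel_measurable (\<nu> \<Otimes>\<^sub>M \<nu>)" using int by auto
    note d = distr_PiM_pair[OF \<nu>.prob_space_axioms ij]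
    show "integrable (?P m) (\<lambda>z. ?k (z i) (z j))" using integrable_distr_eq[OF c k] d int by simp
    show "(\<integral>z. ?k (z i) (z j) \<partial>?P m) = I2" using integral_distr[OF c k] d by (simp add: I2_def)
  qed
  have lint: "integrable (?P (p n)) (l n)" and lexp: "(\<integral>z. l n z \<partial>?P (p n)) =
     \<beta> * (real (p n) * (real (p n) - 1) / 2 * I2) + real n * (real (p n) * (\<integral>x. lw n x \<partial>\<nu>))"
    if n: "n \<ge> 1" "\<forall>x\<in>K. \<bar>ln (wn n x) - ln (w x)\<bar> < 1" for n
  proof -
    let ?m = "p n"
    have i1: "integrable (?P ?m) (\<lambda>z. \<Sum>(i, j)\<in>?U ?m. ?k (z i) (z j))"
      unfolding case_prod_unfold by (rule Bochner_Integration.integrable_sum) (use E2 in auto)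
    have i2: "integrable (?P ?m) (\<lambda>z. \<Sum>j=1..?m. lw n (z j))"
      by (rule Bochner_Integration.integrable_sum) (rule E1(1)[OF _ intn[OF n]])
    show "integrable (?P ?m) (l n)" unfolding l_def using i1 i2 by simp
    have "(\<integral>z. l n z \<partial>?P ?m) = \<beta> * (\<integral>z. (\<Sum>(i, j)\<in>?U ?m. ?k (z i) (z j)) \<partial>?P ?m) + real n * (\<integral>z. (\<Sum>j=1..?m. lw n (z j)) \<partial>?P ?m)"
      unfolding l_def using i1 i2 by simp
    also have "(\<integral>z. (\<Sum>(i, j)\<in>?U ?m. ?k (z i) (z j)) \<partial>?P ?m) = (\<Sum>(i, j)\<in>?U ?m. I2)"
      unfolding case_prod_unfold
      by (subst Bochner_Integration.integral_sum) (use E2 in \<open>auto intro!: sum.cong\<close>)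
    also have "\<dots> = real ?m * (real ?m - 1) / 2 * I2" using cardU[of ?m] by simp
    also have "(\<integral>z. (\<Sum>j=1..?m. lw n (z j)) \<partial>?P ?m) = (\<Sum>j=1..?m. \<integral>x. lw n x \<partial>\<nu>)"
      by (subst Bochner_Integration.integral_sum) (use E1[OF _ intn[OF n]] in \<open>auto intro!: sum.cong\<close>)
    finally show "(\<integral>z. l n z \<partial>?P ?m) =
     \<beta> * (real ?m * (real ?m - 1) / 2 * I2) + real n * (real ?m * (\<integral>x. lw n x \<partial>\<nu>))" by simp
  qed
  define en where "en n = \<beta> * (real (p n) * (real (p n) - 1) / 2 * I2) + real n * (real (p n) * (\<integral>x. lw n x \<partial>\<nu>))" for n
  have en_lim: "(\<lambda>n. en n / (real n)\<^sup>2) \<longlonglongrightarrow> - J"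
  proof -
    have L: "(\<lambda>n. \<beta> * (((real (p n) / real n)\<^sup>2 - real (p n) / (real n)\<^sup>2) / 2 * I2) + real (p n) / real n * (\<integral>x. lw n x \<partial>\<nu>))
       \<longlonglongrightarrow> \<beta> * ((\<kappa>\<^sup>2 - 0) / 2 * I2) + \<kappa> * (\<integral>x. lw0 x \<partial>\<nu>)"
      by (intro tendsto_intros p_over_n_facts p_kappa lim_lw) simp
    have eqJ: "\<beta> * ((\<kappa>\<^sup>2 - 0) / 2 * I2) + \<kappa> * (\<integral>x. lw0 x \<partial>\<nu>) = - J" by (simp add: J_def algebra_simps)
    have ev: "eventually (\<lambda>n. \<beta> * (((real (p n) / real n)\<^sup>2 - real (p n) / (real n)\<^sup>2) / 2 * I2) + real (p n) / real n * (\<integral>x. lw n x \<partial>\<nu>)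
       = en n / (real n)\<^sup>2) sequentially"
      using eventually_gt_at_top[of 0]
    proof eventually_elim
      case (elim n)
      have "en n / (real n)\<^sup>2 = \<beta> * ((real (p n) * (real (p n) - 1)) / (real n)\<^sup>2 / 2 * I2) + (real n * real (p n)) / (real n)\<^sup>2 * (\<integral>x. lw n x \<partial>\<nu>)"
        unfolding en_def by (simp add: add_divide_distrib)
      also have "(real (p n) * (real (p n) - 1)) / (real n)\<^sup>2 = (real (p n) / real n)\<^sup>2 - real (p n) / (real n)\<^sup>2"
        by (simp add: power_divide power2_eq_square diff_divide_distrib right_diff_distrib)
      also have "(real n * real (p n)) / (real n)\<^sup>2 = real (p n) / real n" using elim by (simp add: power2_eq_square)
      finally show ?case by simp
    qed
    show ?thesis using Lim_transform_eventually[OF L ev] unfolding eqJ .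
  qed
  \<comment> \<open>Of the gap \<open>a - J = 4 \<delta>\<close>, one \<open>\<delta>\<close> covers the deviation of \<open>en n / n\<^sup>2\<close> from \<open>- J\<close>, two the distance of \<open>t\<close> from \<open>en n\<close>, and one the factor \<open>2 * C ^ p n\<close>.\<close>
  define \<delta> where "\<delta> = (a - J) / 4"
  have \<delta>: "\<delta> > 0" using Ja by (simp add: \<delta>_def)
  \<comment> \<open>\<open>C1 n\<^sup>2\<close> bounds the log weight from above as soon as \<open>p n \<le> (\<kappa> + 1) n\<close> and \<open>ln (wn n)\<close> is within \<open>1\<close> of \<open>ln w\<close>.\<close>
  define C1 where "C1 = \<beta> * (\<kappa> + 1)\<^sup>2 * D + (\<kappa> + 1) * (\<bar>B0\<bar> + 1)"
  have C1: "C1 \<ge> 0" unfolding C1_def using beta kappa D0 by (intro add_nonneg_nonneg mult_nonneg_nonneg) auto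
  have q_lim: "(\<lambda>n. measure (?P (p n)) (?T (p n))) \<longlonglongrightarrow> 1"
  proof -
    have "AE x in \<nu>. x \<in> S" using supp KS by (auto elim: eventually_mono)
    from weak_law_of_large_numbers[OF \<nu> G this]
    show ?thesis using p_top by (rule filterlim_compose)
  qed
  have "(\<lambda>n. (1 - measure (?P (p n)) (?T (p n))) * (C1 + (\<bar>J\<bar> + 1))) \<longlonglongrightarrow> (1 - 1) * (C1 + (\<bar>J\<bar> + 1))"
    by (intro tendsto_intros q_lim)
  then have qev: "eventually (\<lambda>n. (1 - measure (?P (p n)) (?T (p n))) * (C1 + (\<bar>J\<bar> + 1)) < \<delta>) sequentially"
    using \<delta> by (intro order_tendstoD(2)) auto
  have qev2: "eventually (\<lambda>n. 1 / 2 < measure (?P (p n)) (?T (p n))) sequentially"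
    using q_lim by (rule order_tendstoD) simp
  have enev: "eventually (\<lambda>n. - J - \<delta> < en n / (real n)\<^sup>2) sequentially" "eventually (\<lambda>n. - J - 1 < en n / (real n)\<^sup>2) sequentially"
    using order_tendstoD(1)[OF en_lim, of "- J - \<delta>"] order_tendstoD(1)[OF en_lim, of "- J - 1"] \<delta> by simp_all
  have pev: "eventually (\<lambda>n. real (p n) / real n < \<kappa> + 1) sequentially"
    using p_kappa by (rule order_tendstoD) simp
  have "(\<lambda>n. real (p n) / (real n)\<^sup>2 * ln C + ln 2 * (1 / real n * (1 / real n))) \<longlonglongrightarrow> 0 * ln C + ln 2 * (0 * 0)"
    by (intro tendsto_intros p_over_n_facts lim_1_over_n)
  then have Cev: "eventually (\<lambda>n. real (p n) / (real n)\<^sup>2 * ln C + ln 2 * (1 / real n * (1 / real n)) < \<delta>) sequentially"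
    using \<delta> by (intro order_tendstoD(2)) auto
  have p1: "eventually (\<lambda>n. p n \<ge> 1) sequentially" using p_top by (auto simp: filterlim_at_top)
  show ?thesis
    using close1 wn_pos eventually_ge_at_top[of 1] qev qev2 enev pev Cev p1
  proof eventually_elim
    case (elim n)
    let ?m = "p n" and ?N = "(real n)\<^sup>2"
    note n = elim(3)
    have N0: "?N > 0" "real n > 0" using n by simp_all
    interpret P: prob_space "?P ?m" by (rule psP)
    have T: "?T ?m \<in> sets (?P ?m)"
      by (rule sets_empirical_preimage[OF elim(10) G(1)]) (auto simp: measurable_ident_sets)
    have TL: "?T ?m \<in> sets (?L ?m)"
      by (rule sets_empirical_preimage[OF elim(10) G(1)]) auto
    have aeK: "AE z in ?P ?m. \<forall>j\<in>{1..?m}. z j \<in> K"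
    proof (rule AE_finite_allI)
      fix j assume j: "j \<in> {1..?m}"
      show "AE z in ?P ?m. z j \<in> K"
        using AE_PiM_component[of "{1..?m}" "\<lambda>_. \<nu>" j "\<lambda>x. x \<in> K"] j supp \<nu>.prob_space_axioms by auto
    qed simp
    have aeD: "AE z in ?P ?m. \<forall>q\<in>?U ?m. z (fst q) \<noteq> z (snd q)"
    proof (rule AE_finite_allI[OF finU])
      fix q assume "q \<in> ?U ?m"
      then have ij: "fst q \<in> {1..?m}" "snd q \<in> {1..?m}" "fst q \<noteq> snd q" by auto
      have c: "(\<lambda>z. (z (fst q), z (snd q))) \<in> ?P ?m \<rightarrow>\<^sub>M \<nu> \<Otimes>\<^sub>M \<nu>"
        using ij by (intro measurable_Pair measurable_component_singleton) auto
      have "K \<in> sets borel" using borel_closed[OF compact_imp_closed[OF K(1)]] .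
      then have "AE z in \<nu> \<Otimes>\<^sub>M \<nu>. fst z \<in> K \<and> snd z \<in> K \<and> fst z \<noteq> snd z"
        by (intro AE_pair_distinct_of_bounded_density[OF \<nu> _ supp]) (rule dens)
      then have "AE z in \<nu> \<Otimes>\<^sub>M \<nu>. fst z \<noteq> snd z" by eventually_elim simp
      then have "AE z in distr (?P ?m) (\<nu> \<Otimes>\<^sub>M \<nu>) (\<lambda>z. (z (fst q), z (snd q))). fst z \<noteq> snd z"
        unfolding distr_PiM_pair[OF \<nu>.prob_space_axioms ij] .
      from AE_distrD[OF c this] show "AE z in ?P ?m. z (fst q) \<noteq> z (snd q)" by simp
    qed
    have good: "AE z in ?P ?m. ensemble_weight \<beta> \<gamma> S (wn n) n ?m z = exp (l n z) \<and> l n z \<le> C1 * ?N"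
      using aeK aeD AE_space
    proof eventually_elim
      case (elim z)
      have zK: "z j \<in> K" "z j \<in> S" if "j \<in> {1..?m}" for j using elim(1) that KS by auto
      have zE: "z \<in> PiE {1..?m} (\<lambda>_. S)" using zK elim(3) by (auto simp: space_PiM PiE_iff)
      have W: "ensemble_weight \<beta> \<gamma> S (wn n) n ?m z =
         exp (\<beta> * (\<Sum>(i, j)\<in>?U ?m. ?k (z i) (z j)) + real n * (\<Sum>j=1..?m. ln (wn n (z j))))"
      proof (rule ln_ensemble_weight[OF zE])
        fix i j assume ij: "i \<in> {1..?m}" "j \<in> {1..?m}" "i < j"
        then have "z i \<noteq> z j" using elim(2) by (auto dest!: bspec[of _ _ "(i, j)"])
        then show "z i ^ \<gamma> \<noteq> z j ^ \<gamma>" using power_inject_on_S zK ij by blast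
      qed (use \<open>\<forall>x\<in>K. wn n x > 0\<close> zK in auto)
      have leq: "l n z = \<beta> * (\<Sum>(i, j)\<in>?U ?m. ?k (z i) (z j)) + real n * (\<Sum>j=1..?m. ln (wn n (z j)))"
        unfolding l_def lw_def using zK by (simp add: proj_id)
      have b1: "(\<Sum>(i, j)\<in>?U ?m. ?k (z i) (z j)) \<le> (\<kappa> + 1)\<^sup>2 * D * ?N"
      proof -
        have "(\<Sum>(i, j)\<in>?U ?m. ?k (z i) (z j)) \<le> (\<Sum>q\<in>?U ?m. D)"
          by (rule sum_mono) (use kD zK in auto)
        also have "\<dots> = real (card (?U ?m)) * D" by simp
        also have "\<dots> \<le> (real ?m)\<^sup>2 * D"
          using cardU[of ?m] D0 by (intro mult_right_mono) (auto simp: power2_eq_square algebra_simps)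
        also have "\<dots> \<le> ((\<kappa> + 1) * real n)\<^sup>2 * D"
          using \<open>real ?m / real n < \<kappa> + 1\<close> N0 D0 by (intro mult_right_mono power_mono) (auto simp: divide_less_eq less_imp_le)
        finally show ?thesis by (simp add: power_mult_distrib mult_ac)
      qed
      have b2: "real n * (\<Sum>j=1..?m. ln (wn n (z j))) \<le> (\<kappa> + 1) * (\<bar>B0\<bar> + 1) * ?N"
      proof -
        have "(\<Sum>j=1..?m. ln (wn n (z j))) \<le> (\<Sum>j=1..?m. \<bar>B0\<bar> + 1)"
        proof (rule sum_mono)
          fix j assume "j \<in> {1..?m}"
          then have "\<bar>ln (wn n (z j)) - ln (w (z j))\<bar> < 1" "\<bar>ln (w (z j))\<bar> \<le> B0"
            using zK B0 \<open>\<forall>x\<in>K. \<bar>ln (wn n x) - ln (w x)\<bar> < 1\<close> by auto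
          then show "ln (wn n (z j)) \<le> \<bar>B0\<bar> + 1" by linarith
        qed
        also have "\<dots> = real ?m * (\<bar>B0\<bar> + 1)" by simp
        also have "\<dots> \<le> ((\<kappa> + 1) * real n) * (\<bar>B0\<bar> + 1)"
          using \<open>real ?m / real n < \<kappa> + 1\<close> N0 by (intro mult_right_mono) (auto simp: divide_less_eq less_imp_le)
        finally have "real n * (\<Sum>j=1..?m. ln (wn n (z j))) \<le> real n * (((\<kappa> + 1) * real n) * (\<bar>B0\<bar> + 1))"
          by (intro mult_left_mono) auto
        then show ?thesis by (simp add: power2_eq_square mult_ac)
      qed
      have "l n z \<le> \<beta> * ((\<kappa> + 1)\<^sup>2 * D * ?N) + (\<kappa> + 1) * (\<bar>B0\<bar> + 1) * ?N"
        unfolding leq using b1 b2 beta by (intro add_mono mult_left_mono) auto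
      then have "l n z \<le> C1 * ?N" by (simp add: C1_def algebra_simps)
      then show ?case using W leq by simp
    qed
    define q where "q = P.prob (?T ?m)"
    define t where "t = en n - 2 * \<delta> * ?N"
    have q: "1 / 2 < q" "q \<le> 1" "(1 - q) * (C1 + (\<bar>J\<bar> + 1)) < \<delta>" using elim(4,5) by (auto simp: q_def)
    have en: "(- J - 1) * ?N < en n" "(- J - \<delta>) * ?N < en n" using elim(6,7) N0 by (simp_all add: less_divide_eq)
    \<comment> \<open>With \<open>q\<close> near \<open>1\<close> the left-over terms of order \<open>(1 - q) n\<^sup>2\<close> are absorbed by the distance \<open>2 \<delta> n\<^sup>2\<close> of \<open>t\<close> from the expectation.\<close>
    have key: "1 / 2 \<le> q * (1 - t) + en n - C1 * ?N * (1 - q)"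
    proof -
      have "(1 - q) * ((- \<bar>J\<bar> - 1) * ?N) \<le> (1 - q) * en n"
      proof (rule mult_left_mono)
        have "(- \<bar>J\<bar> - 1) * ?N \<le> (- J - 1) * ?N" by (intro mult_right_mono) auto
        then show "(- \<bar>J\<bar> - 1) * ?N \<le> en n" using en by linarith
      qed (use q in simp)
      moreover have "(1 - q) * (C1 + (\<bar>J\<bar> + 1)) * ?N \<le> \<delta> * ?N" using q by (intro mult_right_mono) auto
      moreover have "\<delta> * ?N \<le> 2 * q * (\<delta> * ?N)"
        using q \<delta> N0 mult_right_mono[of 1 "2 * q" "\<delta> * ?N"] by simp
      moreover have "q * (1 - t) + en n - C1 * ?N * (1 - q) = q + 2 * q * (\<delta> * ?N) + (1 - q) * en n - C1 * ?N * (1 - q)"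
        by (simp add: t_def algebra_simps)
      moreover have "(1 - q) * (C1 + (\<bar>J\<bar> + 1)) * ?N = C1 * ?N * (1 - q) - (1 - q) * ((- \<bar>J\<bar> - 1) * ?N)"
        by (simp add: algebra_simps)
      ultimately show ?thesis using q by linarith
    qed
    have exp_eq: "P.expectation (l n) = en n" unfolding en_def by (rule lexp[OF n elim(1)])
    have AEc: "AE z in ?P ?m. l n z \<le> C1 * ?N" using good by eventually_elim simp
    have "ennreal (exp t * (1 / 2)) \<le> ennreal (exp t * (q * (1 - t) + en n - C1 * ?N * (1 - q)))"
      using key by (intro ennreal_leI mult_left_mono) auto
    also have "\<dots> \<le> (\<integral>\<^sup>+z. ennreal (exp (l n z)) * indicator (?T ?m) z \<partial>?P ?m)"
      using P.tilted_lower_bound[OF T lint[OF n elim(1)] AEc, of t] unfolding exp_eq q_def .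
    also have "\<dots> = (\<integral>\<^sup>+z. ennreal (ensemble_weight \<beta> \<gamma> S (wn n) n ?m z) * indicator (?T ?m) z \<partial>?P ?m)"
      using good by (intro nn_integral_cong_AE) (auto elim: eventually_mono)
    also have "\<dots> \<le> ennreal C ^ card {1..?m} * (\<integral>\<^sup>+z. ennreal (ensemble_weight \<beta> \<gamma> S (wn n) n ?m z) * indicator (?T ?m) z \<partial>?L ?m)"
    proof (rule nn_integral_PiM_le)
      show "(\<lambda>z. ennreal (ensemble_weight \<beta> \<gamma> S (wn n) n ?m z) * indicator (?T ?m) z) \<in> borel_measurable (?L ?m)"
        using borel_measurable_ensemble_weight[OF wn_cont[OF n]] TL by measurable
    qed (use dens \<nu>.sigma_finite_measure_axioms sigma_finite_lborel in auto)
    finally have main: "ennreal (exp t * (1 / 2)) \<le> ennreal (C ^ ?m) * empirical_mass \<beta> \<gamma> (wn n) n ?m G"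
      unfolding empirical_mass_def using C by (simp add: ennreal_power)
    have CM: "C ^ ?m > 0" using C by simp
    have "exp (- a * ?N) \<le> exp t * (1 / 2) / C ^ ?m"
    proof -
      have "exp t * (1 / 2) / C ^ ?m = exp (t - ln 2 - real ?m * ln C)"
        using C by (simp add: exp_diff exp_of_nat_mult)
      moreover have "- a * ?N \<le> t - ln 2 - real ?m * ln C"
      proof -
        have "(real ?m / ?N * ln C + ln 2 * (1 / real n * (1 / real n))) * ?N < \<delta> * ?N"
          using elim(9) N0 by (intro mult_strict_right_mono) auto
        moreover have "(real ?m / ?N * ln C + ln 2 * (1 / real n * (1 / real n))) * ?N = real ?m * ln C + ln 2"
        proof -
          have "real ?m / ?N * ln C * ?N = real ?m * ln C" using N0 by simp
          moreover have "ln 2 * (1 / real n * (1 / real n)) * ?N = ln (2::real)" using N0 by (simp add: power2_eq_square)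
          ultimately show ?thesis by (simp only: distrib_right)
        qed
        moreover have "a = J + 4 * \<delta>" by (simp add: \<delta>_def field_simps)
        then have "- a * ?N = (- J - \<delta>) * ?N - 2 * \<delta> * ?N - \<delta> * ?N" by (simp add: algebra_simps)
        ultimately show ?thesis using en(2) unfolding t_def by linarith
      qed
      ultimately show ?thesis by simp
    qed
    then have "ennreal (exp (- a * ?N)) \<le> ennreal (exp t * (1 / 2) / C ^ ?m)" by (rule ennreal_leI)
    also have "\<dots> = ennreal (exp t * (1 / 2)) / ennreal (C ^ ?m)" using CM by (intro divide_ennreal[symmetric]) auto
    also have "\<dots> \<le> (ennreal (C ^ ?m) * empirical_mass \<beta> \<gamma> (wn n) n ?m G) / ennreal (C ^ ?m)"
      by (rule divide_right_mono_ennreal[OF main])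
    also have "\<dots> = empirical_mass \<beta> \<gamma> (wn n) n ?m G"
    proof -
      have "0 < ennreal (C ^ ?m)" using CM by (simp only: ennreal_less_zero_iff)
      then have "ennreal (C ^ ?m) \<noteq> 0" by (metis less_irrefl)
      then show ?thesis by (subst mult.commute) (rule ennreal_mult_divide_eq; simp)
    qed
    finally show ?case .
  qed
qed

end

section \<open>Logarithmic singularities and the energy of smooth measures\<close>

text \<open>The positive part of \<open>- ln |t|\<close>. As \<open>ln 0 = 0\<close>, it vanishes at \<open>t = 0\<close>.\<close>

definition log_sing :: "real \<Rightarrow> real" where
  "log_sing t = max 0 (- ln \<bar>t\<bar>)"

lemma log_sing_nonneg: "0 \<le> log_sing t"
  by (simp add: log_sing_def)

lemma borel_measurable_log_sing [measurable]: "log_sing \<in> borel_measurable borel"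
  unfolding log_sing_def[abs_def] by measurable

lemma log_sing_0 [simp]: "log_sing 0 = 0"
  by (simp add: log_sing_def)

lemma log_sing_mult_le: "log_sing (a * b) \<le> log_sing a + log_sing b"
  by (cases "a = 0"; cases "b = 0") (auto simp: log_sing_def abs_mult ln_mult)

lemma log_sing_antimono: "0 < \<bar>a\<bar> \<Longrightarrow> \<bar>a\<bar> \<le> \<bar>b\<bar> \<Longrightarrow> log_sing b \<le> log_sing a"
  unfolding log_sing_def by (intro max.mono) auto

text \<open>From \<open>ln u \<le> u - 1\<close> at \<open>u = |t| powr (- 1 / 2)\<close>; the right-hand side is integrable.\<close>

lemma log_sing_le_powr: "log_sing t \<le> 2 * \<bar>t\<bar> powr (- 1 / 2) * indicator {-1..1} t"
proof (cases "t = 0 \<or> \<bar>t\<bar> > 1")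
  case True
  then show ?thesis by (auto simp: log_sing_def split: split_indicator)
next
  case False
  then have t: "\<bar>t\<bar> > 0" "\<bar>t\<bar> \<le> 1" "t \<in> {-1..1}" by auto
  have "ln (\<bar>t\<bar> powr (- 1 / 2)) \<le> \<bar>t\<bar> powr (- 1 / 2) - 1" using t by (intro ln_le_minus_one) auto
  then have "- ln \<bar>t\<bar> \<le> 2 * \<bar>t\<bar> powr (- 1 / 2)" using t by (simp add: ln_powr)
  then show ?thesis using t by (simp add: log_sing_def)
qed

lemma nn_integral_log_sing_finite: "(\<integral>\<^sup>+t. ennreal (log_sing t) \<partial>lborel) < \<infinity>"
proof -
  let ?f = "\<lambda>t::real. ennreal (2 * t powr (- 1 / 2)) * indicator {0..1} t"
  have [measurable]: "?f \<in> borel_measurable borel" by measurable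
  have I: "(\<integral>\<^sup>+t. ?f t \<partial>lborel) = ennreal (2 * (1 powr (- 1 / 2 + 1) / (- 1 / 2 + 1)))"
    by (rule nn_integral_has_integral_lebesgue'[OF _ has_integral_mult_right[OF has_integral_powr_from_0]]) auto
  have "(\<integral>\<^sup>+t. ennreal (log_sing t) \<partial>lborel) \<le> (\<integral>\<^sup>+t. ?f t + ?f (- t) \<partial>lborel)"
  proof (rule nn_integral_mono)
    fix t :: real
    have "ennreal (log_sing t) \<le> ennreal (2 * \<bar>t\<bar> powr (- 1 / 2) * indicator {-1..1} t)"
      by (rule ennreal_leI[OF log_sing_le_powr])
    also have "\<dots> \<le> ?f t + ?f (- t)"
      by (cases "t \<ge> 0") (auto split: split_indicator)
    finally show "ennreal (log_sing t) \<le> ?f t + ?f (- t)" .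
  qed
  also have "\<dots> = (\<integral>\<^sup>+t. ?f t \<partial>lborel) + (\<integral>\<^sup>+t. ?f (- t) \<partial>lborel)" by (rule nn_integral_add) measurable
  also have "(\<integral>\<^sup>+t. ?f (- t) \<partial>lborel) = (\<integral>\<^sup>+t. ?f t \<partial>lborel)"
    using nn_integral_real_affine[of ?f "-1" 0] by simp
  also have "(\<integral>\<^sup>+t. ?f t \<partial>lborel) + (\<integral>\<^sup>+t. ?f t \<partial>lborel) < \<infinity>" unfolding I by (simp flip: ennreal_plus)
  finally show ?thesis .
qed

definition log_sing_mass :: real where
  "log_sing_mass = enn2real (\<integral>\<^sup>+t. ennreal (log_sing t) \<partial>lborel)"

lemma log_sing_mass_nonneg: "0 \<le> log_sing_mass"
  by (simp add: log_sing_mass_def)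

lemma nn_integral_log_sing: "(\<integral>\<^sup>+t. ennreal (log_sing t) \<partial>lborel) = ennreal log_sing_mass"
  using nn_integral_log_sing_finite by (simp add: log_sing_mass_def ennreal_enn2real)

lemma nn_integral_log_sing_translate: "(\<integral>\<^sup>+t. ennreal (log_sing (s - t)) \<partial>lborel) = ennreal log_sing_mass"
  using nn_integral_real_affine[of "\<lambda>t. ennreal (log_sing t)" "-1" s] nn_integral_log_sing by simp

text \<open>A point of an interval that is neither its least nor its greatest element is interior.\<close>

lemma finite_interval_boundary:
  fixes S :: "real set"
  assumes "convex S"
  shows "finite (S - interior S)"
proof -
  let ?A = "{x \<in> S. \<forall>y\<in>S. x \<le> y}" and ?B = "{x \<in> S. \<forall>y\<in>S. y \<le> x}"
  have one: "finite A" if "\<And>x y. x \<in> A \<Longrightarrow> y \<in> A \<Longrightarrow> x = y" for A :: "real set"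
  proof (cases "A = {}")
    case False
    then obtain a where "a \<in> A" by blast
    then have "A \<subseteq> {a}" using that by blast
    then show ?thesis using finite_subset by blast
  qed simp
  have "S - interior S \<subseteq> ?A \<union> ?B"
  proof
    fix x assume x: "x \<in> S - interior S"
    show "x \<in> ?A \<union> ?B"
    proof (rule ccontr)
      assume "x \<notin> ?A \<union> ?B"
      then obtain a b where ab: "a \<in> S" "a < x" "b \<in> S" "x < b" using x by force
      have "is_interval S" using assms by (simp add: is_interval_convex_1)
      then have "{a..b} \<subseteq> S" using ab mem_is_interval_1_I[of S a b] by auto
      then have "{a<..<b} \<subseteq> interior S" by (intro interior_maximal) auto
      then show False using ab x by auto
    qed
  qed
  moreover have "finite ?A" by (rule one) (auto intro: antisym)
  moreover have "finite ?B" by (rule one) (auto intro: antisym)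
  ultimately show ?thesis using finite_subset by blast
qed

context beta_ensemble
begin

text \<open>The points near which \<open>- ln E\<close> differs from a multiple of \<open>- ln |x - y|\<close> by a bounded term. At \<open>0\<close>
  the derivative of the power function may vanish, which would change the multiple. Boundary points
  are left out to make the set open.\<close>

definition regular_points :: "real set" where
  "regular_points = interior S - zero_set S w - {0}"

lemma open_regular_points: "open regular_points"
  unfolding regular_points_def by (intro open_Diff open_interior finite_imp_closed zeros_finite) auto

lemma regular_points_subset: "regular_points \<subseteq> S - zero_set S w - {0}"
  unfolding regular_points_def using interior_subset by auto

lemma finite_irregular_points: "finite (S - regular_points)"
proof -
  have "S - regular_points \<subseteq> (S - interior S) \<union> zero_set S w \<union> {0}" by (auto simp: regular_points_def)
  then show ?thesis using finite_interval_boundary[OF convex_S] zeros_finite finite_subset by blast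
qed

lemma w_pos: "x \<in> S - zero_set S w \<Longrightarrow> w x > 0"
  using w_nonneg[of x] by (force simp: zero_set_def)

lemma E_pos: "x \<in> S - zero_set S w \<Longrightarrow> y \<in> S - zero_set S w \<Longrightarrow> x \<noteq> y \<Longrightarrow> E x y > 0"
  using w_pos[of x] w_pos[of y] power_inject_on_S[of x y] by (auto simp: ker_def intro!: mult_pos_pos)

lemma E_diag: "E x x = 0"
  by (simp add: ker_def)

lemma ln_E:
  assumes "x \<in> S - zero_set S w" "y \<in> S - zero_set S w" "x \<noteq> y"
  shows "- ln (E x y) = - (\<beta> * \<kappa>\<^sup>2 / 2) * ln \<bar>x ^ \<gamma> - y ^ \<gamma>\<bar> - \<kappa> / 2 * (ln (w x) + ln (w y))"
proof -
  have "w x > 0" "w y > 0" using w_pos assms by auto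
  moreover have "x ^ \<gamma> \<noteq> y ^ \<gamma>" using assms power_inject_on_S by auto
  ultimately show ?thesis by (simp add: ker_def ln_mult ln_powr)
qed

text \<open>The quotient of \<open>x ^ \<gamma> - y ^ \<gamma>\<close> by \<open>x - y\<close>, extended continuously to the diagonal.\<close>

definition diff_quot :: "real \<Rightarrow> real \<Rightarrow> real" where
  "diff_quot x y = (\<Sum>i<\<gamma>. y ^ (\<gamma> - Suc i) * x ^ i)"

lemma power_diff_quot: "x ^ \<gamma> - y ^ \<gamma> = (x - y) * diff_quot x y"
  unfolding diff_quot_def by (rule power_diff_sumr2)

lemma diff_quot_nonzero:
  assumes "x \<in> S" "y \<in> S" "x \<noteq> 0"
  shows "diff_quot x y \<noteq> 0"
proof (cases "x = y")
  case True
  have "diff_quot x x = (\<Sum>i<\<gamma>. x ^ (\<gamma> - 1))"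
    unfolding diff_quot_def by (rule sum.cong) (auto simp: power_add[symmetric] One_nat_def)
  then show ?thesis using True assms gamma by simp
next
  case False
  then show ?thesis using power_diff_quot[of x y] power_inject_on_S[OF assms(1,2)] by auto
qed

text \<open>By compactness \<open>ln w\<close> and \<open>ln |diff_quot|\<close> are bounded on \<open>K\<close>, so \<open>ln |x - y|\<close> is the only unbounded
  term.\<close>

lemma ln_E_log_sing:
  assumes K: "compact K" "K \<subseteq> regular_points"
  obtains c where "c \<ge> 0" "\<And>x y. x \<in> K \<Longrightarrow> y \<in> K \<Longrightarrow> x \<noteq> y \<Longrightarrow>
      \<bar>- ln (E x y) - \<beta> * \<kappa>\<^sup>2 / 2 * log_sing (x - y)\<bar> \<le> c"
    and "\<And>x y. x \<in> K \<Longrightarrow> y \<in> K \<Longrightarrow> x \<noteq> y \<Longrightarrow> \<bar>- ln \<bar>x ^ \<gamma> - y ^ \<gamma>\<bar> - log_sing (x - y)\<bar> \<le> c"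
proof -
  have KS: "K \<subseteq> S" "K \<subseteq> S - zero_set S w" "0 \<notin> K" using K regular_points_subset by auto
  have bd: "\<exists>B. \<forall>z\<in>A. \<bar>f z\<bar> \<le> B" if "compact A" "continuous_on A f" for A :: "'x::topological_space set" and f :: "'x \<Rightarrow> real"
    using compact_imp_bounded[OF compact_continuous_image[OF that(2,1)]] by (auto simp: bounded_iff)
  have "continuous_on K (\<lambda>x. ln (w x))"
    using w_pos KS by (intro continuous_on_ln continuous_on_subset[OF w_cont]) force+
  from bd[OF K(1) this] obtain b1 where b1: "\<And>x. x \<in> K \<Longrightarrow> \<bar>ln (w x)\<bar> \<le> b1" by blast
  have "continuous_on (K \<times> K) (\<lambda>z. ln \<bar>diff_quot (fst z) (snd z)\<bar>)"
  proof (rule continuous_on_ln)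
    show "continuous_on (K \<times> K) (\<lambda>z. \<bar>diff_quot (fst z) (snd z)\<bar>)"
      unfolding diff_quot_def by (intro continuous_intros)
    show "\<forall>z\<in>K \<times> K. \<bar>diff_quot (fst z) (snd z)\<bar> \<noteq> 0"
      using diff_quot_nonzero KS by (force simp: subset_eq)
  qed
  from bd[OF compact_Times[OF K(1) K(1)] this] obtain b2
    where b2: "\<forall>z\<in>K \<times> K. \<bar>ln \<bar>diff_quot (fst z) (snd z)\<bar>\<bar> \<le> b2" by blast
  have "continuous_on (K \<times> K) (\<lambda>z. fst z - snd z)" by (intro continuous_intros)
  from bd[OF compact_Times[OF K(1) K(1)] this] obtain b3
    where b3: "\<forall>z\<in>K \<times> K. \<bar>fst z - snd z\<bar> \<le> b3" by blast
  let ?a = "\<beta> * \<kappa>\<^sup>2 / 2"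
  define c1 where "c1 = ln (\<bar>b3\<bar> + 1) + \<bar>b2\<bar>"
  have c1: "c1 \<ge> 0" by (simp add: c1_def)
  have A: "\<bar>- ln \<bar>x ^ \<gamma> - y ^ \<gamma>\<bar> - log_sing (x - y)\<bar> \<le> c1" if xy: "x \<in> K" "y \<in> K" "x \<noteq> y" for x y
  proof -
    have "diff_quot x y \<noteq> 0" using diff_quot_nonzero xy KS by (metis subsetD)
    then have e: "ln \<bar>x ^ \<gamma> - y ^ \<gamma>\<bar> = ln \<bar>x - y\<bar> + ln \<bar>diff_quot x y\<bar>"
      unfolding power_diff_quot abs_mult using xy by (simp add: ln_mult)
    have "\<bar>x - y\<bar> \<le> b3" using bspec[OF b3, of "(x, y)"] xy by simp
    then have d: "\<bar>x - y\<bar> \<le> \<bar>b3\<bar> + 1" "\<bar>x - y\<bar> > 0" using xy by linarith+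
    then have "ln \<bar>x - y\<bar> \<le> ln (\<bar>b3\<bar> + 1)" by (subst ln_le_cancel_iff) auto
    moreover have "0 \<le> ln (\<bar>b3\<bar> + 1)" by simp
    ultimately have "\<bar>- ln \<bar>x - y\<bar> - log_sing (x - y)\<bar> \<le> ln (\<bar>b3\<bar> + 1)" by (auto simp: log_sing_def max_def)
    moreover have "\<bar>ln \<bar>diff_quot x y\<bar>\<bar> \<le> \<bar>b2\<bar>" using bspec[OF b2, of "(x, y)"] xy by simp
    ultimately show ?thesis unfolding e c1_def by linarith
  qed
  have a0: "?a \<ge> 0" using beta by simp
  have Bq: "\<bar>- ln (E x y) - ?a * log_sing (x - y)\<bar> \<le> ?a * c1 + \<kappa> * \<bar>b1\<bar>" if xy: "x \<in> K" "y \<in> K" "x \<noteq> y" for x y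
  proof -
    have "- ln (E x y) - ?a * log_sing (x - y) = ?a * (- ln \<bar>x ^ \<gamma> - y ^ \<gamma>\<bar> - log_sing (x - y)) - \<kappa> / 2 * (ln (w x) + ln (w y))"
      using ln_E[of x y] xy KS by (auto simp: algebra_simps subset_eq)
    also have "\<bar>\<dots>\<bar> \<le> \<bar>?a * (- ln \<bar>x ^ \<gamma> - y ^ \<gamma>\<bar> - log_sing (x - y))\<bar> + \<bar>\<kappa> / 2 * (ln (w x) + ln (w y))\<bar>"
      by (rule abs_triangle_ineq4)
    also have "\<dots> \<le> ?a * c1 + \<kappa> / 2 * (2 * \<bar>b1\<bar>)"
    proof (rule add_mono)
      show "\<bar>?a * (- ln \<bar>x ^ \<gamma> - y ^ \<gamma>\<bar> - log_sing (x - y))\<bar> \<le> ?a * c1"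
        unfolding abs_mult abs_of_nonneg[OF a0] by (rule mult_left_mono[OF A[OF xy] a0])
      have "\<bar>ln (w x) + ln (w y)\<bar> \<le> 2 * \<bar>b1\<bar>" using b1[OF xy(1)] b1[OF xy(2)] by linarith
      then show "\<bar>\<kappa> / 2 * (ln (w x) + ln (w y))\<bar> \<le> \<kappa> / 2 * (2 * \<bar>b1\<bar>)"
        unfolding abs_mult using kappa by (intro mult_mono) auto
    qed
    finally show ?thesis by simp
  qed
  show ?thesis
  proof (rule that[of "max c1 (?a * c1 + \<kappa> * \<bar>b1\<bar>)"])
    show "0 \<le> max c1 (?a * c1 + \<kappa> * \<bar>b1\<bar>)" using c1 by simp
  qed (use A Bq in \<open>auto simp: le_max_iff_disj\<close>)
qed

text \<open>The approximating measures are constructed on the line. Their energy is that of their image on \<open>S\<close>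
  under the projection.\<close>

definition line_kernel :: "real \<Rightarrow> real \<Rightarrow> ennreal" where
  "line_kernel x y = K.shifted_kernel (proj x) (proj y)"

definition line_energy :: "real measure \<Rightarrow> ennreal" where
  "line_energy \<nu> = (\<integral>\<^sup>+x. \<integral>\<^sup>+y. line_kernel x y \<partial>\<nu> \<partial>\<nu>)"

lemma borel_measurable_line_kernel [measurable]: "(\<lambda>(x, y). line_kernel x y) \<in> borel_measurable (borel \<Otimes>\<^sub>M borel)"
proof -
  have "(\<lambda>(x, y). E (proj x) (proj y)) \<in> borel_measurable (borel \<Otimes>\<^sub>M borel)"
    unfolding borel_prod by (intro borel_measurable_continuous_onI continuous_on_compose_proj2 K.cont_E)
  note [measurable] = this[unfolded case_prod_unfold]
  show ?thesis unfolding line_kernel_def K.shifted_kernel_def K.log_kernel_def case_prod_unfold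
    by measurable
qed

lemma shifted_energy_distr:
  assumes X: "X \<in> M \<rightarrow>\<^sub>M restrict_space borel S" and M: "sigma_finite_measure M"
    and D: "sigma_finite_measure (distr M (restrict_space borel S) X)"
  shows "K.shifted_energy (distr M (restrict_space borel S) X) = (\<integral>\<^sup>+s. \<integral>\<^sup>+t. line_kernel (X s) (X t) \<partial>M \<partial>M)"
proof -
  let ?R = "restrict_space borel S :: real measure" and ?D = "distr M (restrict_space borel S) X"
  have id: "(\<lambda>x. x) \<in> ?R \<rightarrow>\<^sub>M borel" by (rule measurable_restrict_space1) simp
  have lm: "(\<lambda>y. line_kernel x y) \<in> borel_measurable ?R" for x
    using measurable_compose[OF measurable_Pair1' borel_measurable_line_kernel, of x] id measurable_compose[OF id] by simp
  have spR: "space ?R = S" by (simp add: space_restrict_space)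
  have XS: "X s \<in> S" if "s \<in> space M" for s using measurable_space[OF X that] spR by simp
  have eq: "K.shifted_kernel x y = line_kernel x y" if "x \<in> S" "y \<in> S" for x y
    using that by (simp add: line_kernel_def proj_id)
  have "K.shifted_energy ?D = (\<integral>\<^sup>+x. \<integral>\<^sup>+y. line_kernel x y \<partial>?D \<partial>?D)"
    unfolding K.shifted_energy_def by (intro nn_integral_cong) (simp add: spR eq)
  also have "\<dots> = (\<integral>\<^sup>+x. \<integral>\<^sup>+t. line_kernel x (X t) \<partial>M \<partial>?D)"
    using lm by (intro nn_integral_cong nn_integral_distr[OF X]) simp
  also have "\<dots> = (\<integral>\<^sup>+s. \<integral>\<^sup>+t. line_kernel (X s) (X t) \<partial>M \<partial>M)"
  proof (rule nn_integral_distr[OF X])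
    have Xb: "X \<in> borel_measurable M" using measurable_compose[OF X id] by simp
    have "(\<lambda>z. line_kernel (fst z) (X (snd z))) \<in> borel_measurable (borel \<Otimes>\<^sub>M M)"
      using measurable_compose[OF measurable_Pair[OF measurable_fst measurable_compose[OF measurable_snd Xb]] borel_measurable_line_kernel]
      by simp
    then have "(\<lambda>x. \<integral>\<^sup>+t. line_kernel x (X t) \<partial>M) \<in> borel_measurable borel"
      by (intro sigma_finite_measure.borel_measurable_nn_integral[OF M]) (simp add: case_prod_unfold)
    from measurable_compose[OF id this]
    show "(\<lambda>x. \<integral>\<^sup>+t. line_kernel x (X t) \<partial>M) \<in> borel_measurable ?D" by simp
  qed
  finally show ?thesis .
qed

lemma shifted_energy_from_line:
  assumes \<nu>: "real_distribution \<nu>"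
  shows "K.shifted_energy (distr \<nu> (restrict_space borel S) proj) = line_energy \<nu>"
proof -
  interpret \<nu>: real_distribution \<nu> by fact
  have p: "proj \<in> \<nu> \<rightarrow>\<^sub>M restrict_space borel S"
    using borel_measurable_proj by (intro measurable_restrict_space2) auto
  interpret D: prob_space "distr \<nu> (restrict_space borel S) proj" by (rule \<nu>.prob_space_distr[OF p])
  have "proj (proj x) = proj x" for x by (rule proj_id) simp
  then have "line_kernel (proj x) (proj y) = line_kernel x y" for x y by (simp add: line_kernel_def)
  then show ?thesis
    using shifted_energy_distr[OF p \<nu>.sigma_finite_measure_axioms D.sigma_finite_measure_axioms]
    by (simp add: line_energy_def)
qed

lemma line_energy_to_line:
  "\<mu> \<in> borel_prob_measures S \<Longrightarrow> line_energy (to_line \<mu>) = K.shifted_energy \<mu>"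
  using shifted_energy_from_line[OF real_distribution_to_line, of \<mu>] distr_to_line_proj[of \<mu>] by simp

lemma log_energy_less_iff:
  assumes "\<mu> \<in> borel_prob_measures S" "0 \<le> a + Bd"
  shows "K.log_energy \<mu> < ereal a \<longleftrightarrow> K.shifted_energy \<mu> < ennreal (a + Bd)"
proof -
  have "K.shifted_energy \<mu> < ennreal (a + Bd) \<longleftrightarrow> enn2ereal (K.shifted_energy \<mu>) < ereal (a + Bd)"
    using assms(2) by (simp add: less_ennreal.rep_eq)
  then show ?thesis unfolding K.log_energy_shifted[OF assms(1)]
    by (cases "enn2ereal (K.shifted_energy \<mu>)") auto
qed

text \<open>A bound \<open>C\<close> for the density, expressed by integrals so that no density has to be named.\<close>

definition smooth_dist :: "real measure \<Rightarrow> real set \<Rightarrow> real \<Rightarrow> bool" where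
  "smooth_dist \<nu> K C \<longleftrightarrow> real_distribution \<nu> \<and> compact K \<and> K \<subseteq> regular_points \<and> (AE x in \<nu>. x \<in> K) \<and> C \<ge> 1 \<and>
     (\<forall>f\<in>borel_measurable borel. (\<integral>\<^sup>+x. f x \<partial>\<nu>) \<le> ennreal C * (\<integral>\<^sup>+x. f x \<partial>lborel))"

lemma smooth_dist_AE_pair:
  assumes "smooth_dist \<nu> K C"
  shows "AE z in \<nu> \<Otimes>\<^sub>M \<nu>. fst z \<in> K \<and> snd z \<in> K \<and> fst z \<noteq> snd z"
proof -
  note A = assms[unfolded smooth_dist_def]
  show ?thesis
  proof (rule AE_pair_distinct_of_bounded_density[where C = "ennreal C"])
    show "K \<in> sets borel" using A borel_closed[OF compact_imp_closed] by blast
  qed (use A in blast)+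
qed

text \<open>A bounded density makes the logarithmic singularity integrable, so the terms of the energy may be
  integrated separately as real integrals.\<close>

lemma smooth_dist_energy:
  assumes "smooth_dist \<nu> K C"
  defines "J \<equiv> - (\<beta> * \<kappa>\<^sup>2 / 2) * (\<integral>(x, y). ln \<bar>x ^ \<gamma> - y ^ \<gamma>\<bar> \<partial>(\<nu> \<Otimes>\<^sub>M \<nu>)) - \<kappa> * (\<integral>x. ln (w (proj x)) \<partial>\<nu>)"
  shows "integrable (\<nu> \<Otimes>\<^sub>M \<nu>) (\<lambda>(x, y). ln \<bar>x ^ \<gamma> - y ^ \<gamma>\<bar>)"
    and "line_energy \<nu> = ennreal (J + Bd)" and "0 \<le> J + Bd"
proof -
  note A = assms(1)[unfolded smooth_dist_def]
  interpret \<nu>: real_distribution \<nu> using A by blast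
  interpret P: pair_prob_space \<nu> \<nu> by unfold_locales
  have dens: "(\<integral>\<^sup>+x. f x \<partial>\<nu>) \<le> ennreal C * (\<integral>\<^sup>+x. f x \<partial>lborel)" if "f \<in> borel_measurable borel" for f
    using A that by blast
  have K: "compact K" "K \<subseteq> regular_points" using A by auto
  have C: "C \<ge> 1" using A by blast
  have KS: "K \<subseteq> S - zero_set S w" using K regular_points_subset by auto
  have AEp: "AE z in \<nu> \<Otimes>\<^sub>M \<nu>. fst z \<in> K \<and> snd z \<in> K \<and> fst z \<noteq> snd z" by (rule smooth_dist_AE_pair[OF assms(1)])
  obtain c where c: "c \<ge> 0" "\<And>x y. x \<in> K \<Longrightarrow> y \<in> K \<Longrightarrow> x \<noteq> y \<Longrightarrow>
      \<bar>- ln (E x y) - \<beta> * \<kappa>\<^sup>2 / 2 * log_sing (x - y)\<bar> \<le> c"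
    and c2: "\<And>x y. x \<in> K \<Longrightarrow> y \<in> K \<Longrightarrow> x \<noteq> y \<Longrightarrow> \<bar>- ln \<bar>x ^ \<gamma> - y ^ \<gamma>\<bar> - log_sing (x - y)\<bar> \<le> c"
    using ln_E_log_sing[OF K] by metis
  have ls: "integrable (\<nu> \<Otimes>\<^sub>M \<nu>) (\<lambda>z. log_sing (fst z - snd z))"
  proof (rule integrableI_bounded)
    have "(\<integral>\<^sup>+z. ennreal (norm (log_sing (fst z - snd z))) \<partial>(\<nu> \<Otimes>\<^sub>M \<nu>)) =
       (\<integral>\<^sup>+x. \<integral>\<^sup>+y. ennreal (log_sing (x - y)) \<partial>\<nu> \<partial>\<nu>)"
      by (subst \<nu>.nn_integral_fst[symmetric]) (auto simp: log_sing_nonneg)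
    also have "\<dots> \<le> (\<integral>\<^sup>+x. ennreal C * ennreal log_sing_mass \<partial>\<nu>)"
    proof (rule nn_integral_mono)
      fix x
      have "(\<integral>\<^sup>+y. ennreal (log_sing (x - y)) \<partial>\<nu>) \<le> ennreal C * (\<integral>\<^sup>+y. ennreal (log_sing (x - y)) \<partial>lborel)"
        by (rule dens) measurable
      then show "(\<integral>\<^sup>+y. ennreal (log_sing (x - y)) \<partial>\<nu>) \<le> ennreal C * ennreal log_sing_mass"
        unfolding nn_integral_log_sing_translate .
    qed
    also have "\<dots> < \<infinity>" using \<nu>.emeasure_space_1 by (simp add: ennreal_mult_less_top)
    finally show "(\<integral>\<^sup>+z. ennreal (norm (log_sing (fst z - snd z))) \<partial>(\<nu> \<Otimes>\<^sub>M \<nu>)) < \<infinity>" .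
  qed measurable
  have km: "(\<lambda>z. ln \<bar>fst z ^ \<gamma> - snd z ^ \<gamma>\<bar>) \<in> borel_measurable (\<nu> \<Otimes>\<^sub>M \<nu>)" by measurable
  have ki: "integrable (\<nu> \<Otimes>\<^sub>M \<nu>) (\<lambda>z. ln \<bar>fst z ^ \<gamma> - snd z ^ \<gamma>\<bar>)"
  proof (rule Bochner_Integration.integrable_bound[OF _ km])
    show "integrable (\<nu> \<Otimes>\<^sub>M \<nu>) (\<lambda>z. log_sing (fst z - snd z) + c)" using ls by simp
    show "AE z in \<nu> \<Otimes>\<^sub>M \<nu>. norm (ln \<bar>fst z ^ \<gamma> - snd z ^ \<gamma>\<bar>) \<le> norm (log_sing (fst z - snd z) + c)"
      using AEp
    proof eventually_elim
      case (elim z)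
      then have "\<bar>- ln \<bar>fst z ^ \<gamma> - snd z ^ \<gamma>\<bar> - log_sing (fst z - snd z)\<bar> \<le> c" by (intro c2) auto
      then show ?case using log_sing_nonneg[of "fst z - snd z"] c(1) unfolding real_norm_def by linarith
    qed
  qed
  then show "integrable (\<nu> \<Otimes>\<^sub>M \<nu>) (\<lambda>(x, y). ln \<bar>x ^ \<gamma> - y ^ \<gamma>\<bar>)" by (simp add: case_prod_unfold)
  let ?lw = "\<lambda>x. ln (w (proj x))"
  have lwm[measurable]: "?lw \<in> borel_measurable borel"
    using borel_measurable_continuous_onI[OF continuous_on_compose_proj[OF w_cont]] by (rule borel_measurable_ln)
  have "continuous_on K (\<lambda>x. ln (w x))"
    using w_pos KS by (intro continuous_on_ln continuous_on_subset[OF w_cont]) force+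
  from compact_imp_bounded[OF compact_continuous_image[OF this K(1)]]
  obtain b where b: "\<And>x. x \<in> K \<Longrightarrow> \<bar>ln (w x)\<bar> \<le> b" by (auto simp: bounded_iff)
  have AEK: "AE x in \<nu>. x \<in> K" using A by blast
  have lwi: "integrable \<nu> ?lw"
  proof (rule \<nu>.integrable_const_bound[of _ b])
    show "AE x in \<nu>. norm (?lw x) \<le> b" using AEK by eventually_elim (use b KS in \<open>auto simp: proj_id subset_eq\<close>)
  qed simp
  have d1: "distr (\<nu> \<Otimes>\<^sub>M \<nu>) \<nu> fst = \<nu>" by (rule \<nu>.distr_pair_fst)
  have lw1: "integrable (\<nu> \<Otimes>\<^sub>M \<nu>) (\<lambda>z. ?lw (fst z))" "(\<integral>z. ?lw (fst z) \<partial>(\<nu> \<Otimes>\<^sub>M \<nu>)) = (\<integral>x. ?lw x \<partial>\<nu>)"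
    using integrable_distr_eq[of fst "\<nu> \<Otimes>\<^sub>M \<nu>" \<nu> ?lw] integral_distr[of fst "\<nu> \<Otimes>\<^sub>M \<nu>" \<nu> ?lw] d1 lwi by auto
  have lw2: "integrable (\<nu> \<Otimes>\<^sub>M \<nu>) (\<lambda>z. ?lw (snd z))" "(\<integral>z. ?lw (snd z) \<partial>(\<nu> \<Otimes>\<^sub>M \<nu>)) = (\<integral>x. ?lw x \<partial>\<nu>)"
  proof -
    have "integrable (\<nu> \<Otimes>\<^sub>M \<nu>) (\<lambda>(x, y). ?lw (snd (y, x)))"
      using P.integrable_product_swap[OF lw1(1)] lw1(1) by (simp add: case_prod_unfold)
    then show "integrable (\<nu> \<Otimes>\<^sub>M \<nu>) (\<lambda>z. ?lw (snd z))"
      using P.integrable_product_swap[OF lw1(1)] by (simp add: case_prod_unfold)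
    then have "(\<integral>z. ?lw (snd z) \<partial>(\<nu> \<Otimes>\<^sub>M \<nu>)) = (\<integral>x. (\<integral>y. ?lw y \<partial>\<nu>) \<partial>\<nu>)"
      using P.integral_fst'[of "\<lambda>z. ?lw (snd z)"] by simp
    then show "(\<integral>z. ?lw (snd z) \<partial>(\<nu> \<Otimes>\<^sub>M \<nu>)) = (\<integral>x. ?lw x \<partial>\<nu>)" using \<nu>.prob_space by simp
  qed
  let ?F = "\<lambda>z. - (\<beta> * \<kappa>\<^sup>2 / 2) * ln \<bar>fst z ^ \<gamma> - snd z ^ \<gamma>\<bar> - \<kappa> / 2 * (?lw (fst z) + ?lw (snd z))"
  have Fi: "integrable (\<nu> \<Otimes>\<^sub>M \<nu>) ?F" using ki lw1 lw2 by simp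
  have FJ: "(\<integral>z. ?F z + Bd \<partial>(\<nu> \<Otimes>\<^sub>M \<nu>)) = J + Bd"
    using ki lw1 lw2 P.P.prob_space by (simp add: J_def case_prod_unfold algebra_simps)
  have FE: "?F z = - ln (E (fst z) (snd z)) \<and> 0 \<le> ?F z + Bd \<and> line_kernel (fst z) (snd z) = ennreal (?F z + Bd)"
    if z: "fst z \<in> K" "snd z \<in> K" "fst z \<noteq> snd z" for z
  proof -
    have pz: "proj (fst z) = fst z" "proj (snd z) = snd z" using z KS by (auto simp: proj_id)
    have e: "?F z = - ln (E (fst z) (snd z))" using ln_E[OF _ _ z(3)] z(1,2) KS pz by (simp add: subset_eq)
    have Ep: "E (fst z) (snd z) > 0" using z KS by (intro E_pos) auto
    have "ln (E (fst z) (snd z)) \<le> ln (exp Bd)" using z KS Ep K.E_le[of "fst z" "snd z"] by (subst ln_le_cancel_iff) auto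
    then show ?thesis using e Ep by (simp add: line_kernel_def pz K.shifted_kernel_pos add.commute)
  qed
  have AEF: "AE z in \<nu> \<Otimes>\<^sub>M \<nu>. 0 \<le> ?F z + Bd \<and> line_kernel (fst z) (snd z) = ennreal (?F z + Bd)"
    using AEp by eventually_elim (use FE in blast)
  have "0 \<le> (\<integral>z. ?F z + Bd \<partial>(\<nu> \<Otimes>\<^sub>M \<nu>))" using AEF by (intro integral_nonneg_AE) (auto elim: eventually_mono)
  then show "0 \<le> J + Bd" unfolding FJ .
  have lkm: "(\<lambda>z. line_kernel (fst z) (snd z)) \<in> borel_measurable (\<nu> \<Otimes>\<^sub>M \<nu>)"
    using borel_measurable_line_kernel by (simp add: case_prod_unfold)
  have "line_energy \<nu> = (\<integral>\<^sup>+z. line_kernel (fst z) (snd z) \<partial>(\<nu> \<Otimes>\<^sub>M \<nu>))"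
    unfolding line_energy_def using \<nu>.nn_integral_fst[OF lkm] by simp
  also have "\<dots> = (\<integral>\<^sup>+z. ennreal (?F z + Bd) \<partial>(\<nu> \<Otimes>\<^sub>M \<nu>))" using AEF by (intro nn_integral_cong_AE) (auto elim: eventually_mono)
  also have "\<dots> = ennreal (\<integral>z. ?F z + Bd \<partial>(\<nu> \<Otimes>\<^sub>M \<nu>))"
    using Fi AEF by (intro nn_integral_eq_integral) (auto elim: eventually_mono)
  finally show "line_energy \<nu> = ennreal (J + Bd)" unfolding FJ .
qed

end

section \<open>Approximation by smooth measures\<close>

definition unit_noise :: "real measure" where
  "unit_noise = uniform_measure lborel {0..1}"

lemma prob_space_unit_noise: "prob_space unit_noise"
  unfolding unit_noise_def by (rule prob_space_uniform_measure) auto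

lemma sets_unit_noise [measurable_cong, simp]: "sets unit_noise = sets borel"
  by (simp add: unit_noise_def)

lemma space_unit_noise [simp]: "space unit_noise = UNIV"
  by (simp add: unit_noise_def)

lemma AE_unit_noise: "AE u in unit_noise. 0 \<le> u \<and> u \<le> 1"
  unfolding unit_noise_def by (rule AE_uniform_measureI) auto

lemma nn_integral_unit_noise_le:
  assumes "f \<in> borel_measurable borel"
  shows "(\<integral>\<^sup>+u. f u \<partial>unit_noise) \<le> (\<integral>\<^sup>+u. f u \<partial>lborel)"
proof -
  have "(\<integral>\<^sup>+u. f u \<partial>unit_noise) = (\<integral>\<^sup>+u. f u * indicator {0..1} u \<partial>lborel)"
    unfolding unit_noise_def using assms by (subst nn_integral_uniform_measure) (auto simp: divide_ennreal_def)
  also have "\<dots> \<le> (\<integral>\<^sup>+u. f u \<partial>lborel)" by (intro nn_integral_mono) (auto split: split_indicator)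
  finally show ?thesis .
qed

lemma nn_integral_unit_noise_const_le:
  assumes "AE u in unit_noise. f u \<le> c"
  shows "(\<integral>\<^sup>+u. f u \<partial>unit_noise) \<le> c"
proof -
  interpret prob_space unit_noise by (rule prob_space_unit_noise)
  have "(\<integral>\<^sup>+u. f u \<partial>unit_noise) \<le> (\<integral>\<^sup>+u. c \<partial>unit_noise)" by (rule nn_integral_mono_AE[OF assms])
  then show ?thesis using emeasure_space_1 by simp
qed

text \<open>The law of \<open>X + \<epsilon> U\<close> for independent \<open>X\<close> and \<open>U\<close>, where \<open>X\<close> has law \<open>\<rho>\<close> and \<open>U\<close> is uniform on the
  unit interval.\<close>

definition smoothing :: "real measure \<Rightarrow> real \<Rightarrow> real measure" where
  "smoothing \<rho> \<epsilon> = distr (\<rho> \<Otimes>\<^sub>M unit_noise) borel (\<lambda>(x, u). x + \<epsilon> * u)"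

lemma real_distribution_smoothing:
  assumes "real_distribution \<rho>"
  shows "real_distribution (smoothing \<rho> \<epsilon>)"
proof -
  interpret real_distribution \<rho> by fact
  interpret P: prob_space "\<rho> \<Otimes>\<^sub>M unit_noise"
    by (rule prob_space_pair[OF prob_space_axioms prob_space_unit_noise])
  show ?thesis unfolding smoothing_def by (rule P.real_distribution_distr) measurable
qed

lemma nn_integral_smoothing:
  assumes "real_distribution \<rho>" and [measurable]: "f \<in> borel_measurable borel"
  shows "(\<integral>\<^sup>+z. f z \<partial>smoothing \<rho> \<epsilon>) = (\<integral>\<^sup>+x. \<integral>\<^sup>+u. f (x + \<epsilon> * u) \<partial>unit_noise \<partial>\<rho>)"
proof -
  interpret real_distribution \<rho> by fact
  interpret U: prob_space unit_noise by (rule prob_space_unit_noise)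
  have "(\<integral>\<^sup>+z. f z \<partial>smoothing \<rho> \<epsilon>) = (\<integral>\<^sup>+z. f (fst z + \<epsilon> * snd z) \<partial>(\<rho> \<Otimes>\<^sub>M unit_noise))"
    unfolding smoothing_def by (subst nn_integral_distr) (auto simp: case_prod_unfold)
  also have "\<dots> = (\<integral>\<^sup>+x. \<integral>\<^sup>+u. f (x + \<epsilon> * u) \<partial>unit_noise \<partial>\<rho>)"
    by (subst U.nn_integral_fst[symmetric]) auto
  finally show ?thesis .
qed

lemma nn_integral_smoothing_le:
  assumes \<rho>: "real_distribution \<rho>" and f[measurable]: "f \<in> borel_measurable borel" and \<epsilon>: "\<epsilon> > 0"
  shows "(\<integral>\<^sup>+z. f z \<partial>smoothing \<rho> \<epsilon>) \<le> ennreal (1 / \<epsilon>) * (\<integral>\<^sup>+z. f z \<partial>lborel)"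
proof -
  interpret real_distribution \<rho> by fact
  have "(\<integral>\<^sup>+u. f (x + \<epsilon> * u) \<partial>unit_noise) \<le> ennreal (1 / \<epsilon>) * (\<integral>\<^sup>+z. f z \<partial>lborel)" for x
  proof -
    have "(\<integral>\<^sup>+u. f (x + \<epsilon> * u) \<partial>unit_noise) \<le> (\<integral>\<^sup>+u. f (x + \<epsilon> * u) \<partial>lborel)"
      by (rule nn_integral_unit_noise_le) measurable
    also have "\<dots> = ennreal (1 / \<epsilon>) * (ennreal \<epsilon> * (\<integral>\<^sup>+u. f (x + \<epsilon> * u) \<partial>lborel))"
      using \<epsilon> by (simp add: mult.assoc[symmetric] ennreal_mult'[symmetric])
    also have "ennreal \<epsilon> * (\<integral>\<^sup>+u. f (x + \<epsilon> * u) \<partial>lborel) = (\<integral>\<^sup>+z. f z \<partial>lborel)"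
      using nn_integral_real_affine[OF f, of \<epsilon> x] \<epsilon> by simp
    finally show ?thesis .
  qed
  then have "(\<integral>\<^sup>+x. \<integral>\<^sup>+u. f (x + \<epsilon> * u) \<partial>unit_noise \<partial>\<rho>) \<le> (\<integral>\<^sup>+x. ennreal (1 / \<epsilon>) * (\<integral>\<^sup>+z. f z \<partial>lborel) \<partial>\<rho>)"
    by (rule nn_integral_mono)
  then show ?thesis unfolding nn_integral_smoothing[OF \<rho> f] using emeasure_space_1 by simp
qed

text \<open>The bound is uniform in \<open>\<epsilon>\<close>. If \<open>2 \<epsilon> \<le> |x - y|\<close>, the noise at most halves the distance. Otherwise,
  with \<open>\<epsilon>\<close> factored out, the average over \<open>v\<close> is bounded by the total mass of the singularity, and
  \<open>\<epsilon> > |x - y| / 2\<close> controls the factor.\<close>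

lemma nn_integral_log_sing_smoothing:
  assumes \<epsilon>: "0 < \<epsilon>" and xy: "x \<noteq> y"
  shows "(\<integral>\<^sup>+u. \<integral>\<^sup>+v. ennreal (log_sing (x + \<epsilon> * u - (y + \<epsilon> * v))) \<partial>unit_noise \<partial>unit_noise)
     \<le> ennreal (log_sing (x - y) + ln 2 + log_sing_mass)"
proof (rule nn_integral_unit_noise_const_le)
  have half: "log_sing ((x - y) / 2) \<le> log_sing (x - y) + ln 2"
    using log_sing_mult_le[of "x - y" "1 / 2"] by (simp add: log_sing_def ln_div)
  show "AE u in unit_noise. (\<integral>\<^sup>+v. ennreal (log_sing (x + \<epsilon> * u - (y + \<epsilon> * v))) \<partial>unit_noise)
     \<le> ennreal (log_sing (x - y) + ln 2 + log_sing_mass)"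
    using AE_unit_noise
  proof eventually_elim
    case u: (elim u)
    show ?case
    proof (cases "2 * \<epsilon> \<le> \<bar>x - y\<bar>")
      case True
      show ?thesis
      proof (rule nn_integral_unit_noise_const_le)
        show "AE v in unit_noise. ennreal (log_sing (x + \<epsilon> * u - (y + \<epsilon> * v))) \<le> ennreal (log_sing (x - y) + ln 2 + log_sing_mass)"
          using AE_unit_noise
        proof eventually_elim
          case v: (elim v)
          have "\<bar>u - v\<bar> \<le> 1" using u v by linarith
          then have "\<bar>\<epsilon> * (u - v)\<bar> \<le> \<epsilon>" using \<epsilon> by (simp add: abs_mult mult_left_le)
          moreover have "x + \<epsilon> * u - (y + \<epsilon> * v) = (x - y) + \<epsilon> * (u - v)" by (simp add: algebra_simps)
          moreover have "\<bar>t / 2\<bar> \<le> \<bar>t + h\<bar>" if "\<bar>h\<bar> \<le> \<epsilon>" "2 * \<epsilon> \<le> \<bar>t\<bar>" for t h :: real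
            using that by linarith
          ultimately have "\<bar>(x - y) / 2\<bar> \<le> \<bar>x + \<epsilon> * u - (y + \<epsilon> * v)\<bar>" using True by metis
          then have "log_sing (x + \<epsilon> * u - (y + \<epsilon> * v)) \<le> log_sing ((x - y) / 2)"
            using xy by (intro log_sing_antimono) auto
          then show ?case using half log_sing_mass_nonneg by (intro ennreal_leI) linarith
        qed
      qed
    next
      case False
      define s where "s = (x + \<epsilon> * u - y) / \<epsilon>"
      have e: "x + \<epsilon> * u - (y + \<epsilon> * v) = \<epsilon> * (s - v)" for v
      proof -
        have "\<epsilon> * s = x + \<epsilon> * u - y" using \<epsilon> by (simp add: s_def)
        then show ?thesis by (simp add: right_diff_distrib)
      qed
      have "log_sing \<epsilon> \<le> log_sing ((x - y) / 2)" using False xy \<epsilon> by (intro log_sing_antimono) auto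
      then have le: "log_sing \<epsilon> \<le> log_sing (x - y) + ln 2" using half by linarith
      interpret U: prob_space unit_noise by (rule prob_space_unit_noise)
      have "(\<integral>\<^sup>+v. ennreal (log_sing (x + \<epsilon> * u - (y + \<epsilon> * v))) \<partial>unit_noise) \<le>
         (\<integral>\<^sup>+v. ennreal (log_sing \<epsilon>) + ennreal (log_sing (s - v)) \<partial>unit_noise)"
        unfolding e using log_sing_mult_le log_sing_nonneg
        by (intro nn_integral_mono) (simp flip: ennreal_plus add: ennreal_leI)
      also have "\<dots> = ennreal (log_sing \<epsilon>) + (\<integral>\<^sup>+v. ennreal (log_sing (s - v)) \<partial>unit_noise)"
        using U.emeasure_space_1 by (subst nn_integral_add) auto
      also have "\<dots> \<le> ennreal (log_sing \<epsilon>) + (\<integral>\<^sup>+v. ennreal (log_sing (s - v)) \<partial>lborel)"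
        by (intro add_left_mono nn_integral_unit_noise_le) measurable
      also have "\<dots> = ennreal (log_sing \<epsilon> + log_sing_mass)"
        unfolding nn_integral_log_sing_translate using log_sing_nonneg log_sing_mass_nonneg by simp
      also have "\<dots> \<le> ennreal (log_sing (x - y) + ln 2 + log_sing_mass)" using le by (intro ennreal_leI) linarith
      finally show ?thesis .
    qed
  qed
qed

context beta_ensemble
begin

lemma borel_measurable_line_kernel_comp [measurable (raw)]:
  assumes "f \<in> borel_measurable M" "g \<in> borel_measurable M"
  shows "(\<lambda>z. line_kernel (f z) (g z)) \<in> borel_measurable M"
  using measurable_compose[OF measurable_Pair[OF assms] borel_measurable_line_kernel] by simp

lemma line_kernel_diag: "x \<in> S \<Longrightarrow> line_kernel x x = \<infinity>"
  by (simp add: line_kernel_def proj_id K.shifted_kernel_def K.log_kernel_def E_diag)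

lemma line_kernel_regular:
  "x \<in> S - zero_set S w \<Longrightarrow> y \<in> S - zero_set S w \<Longrightarrow> x \<noteq> y \<Longrightarrow> line_kernel x y = ennreal (Bd - ln (E x y))"
  using E_pos[of x y] by (simp add: line_kernel_def proj_id K.shifted_kernel_pos)

text \<open>The kernel is infinite on the diagonal, so finite energy excludes atoms. Hence the finitely many
  points of \<open>S\<close> that are not regular carry no mass, and by inner regularity there are compact sets
  of regular points of mass \<open>q\<close> arbitrarily close to \<open>1\<close>. Normalized restriction to such a set
  multiplies the nonnegative energy by at most \<open>1 / q\<^sup>2\<close> and converges weakly to \<open>\<mu>\<close>.\<close>

lemma restriction_to_regular_compact:
  assumes \<mu>: "\<mu> \<in> borel_prob_measures S" and G: "openin (weak_topology S) G" "\<mu> \<in> G"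
    and b: "K.shifted_energy \<mu> < ennreal b"
  shows "\<exists>\<rho> K. real_distribution \<rho> \<and> compact K \<and> K \<subseteq> regular_points \<and> (AE x in \<rho>. x \<in> K) \<and>
    distr \<rho> (restrict_space borel S) proj \<in> G \<and> line_energy \<rho> < ennreal b"
proof -
  let ?M = "to_line \<mu>"
  interpret M: real_distribution ?M using \<mu> by (rule real_distribution_to_line)
  have sM: "sets ?M = sets borel" by simp
  have N: "line_energy ?M < ennreal b" using b line_energy_to_line[OF \<mu>] by simp
  have AES: "AE x in ?M. x \<in> S"
  proof -
    have "(\<lambda>x. x) \<in> borel_measurable \<mu>" by (rule borel_measurable_borel_prob_measure[OF \<mu>]) simp
    then show ?thesis unfolding to_line_def
      using closed_S borel_prob_measuresD(3)[OF \<mu>] by (subst AE_distr_iff) auto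
  qed
  have atom: "emeasure ?M {a} = 0" if "a \<in> S" for a
  proof (rule ccontr)
    assume ne: "emeasure ?M {a} \<noteq> 0"
    have "(\<integral>\<^sup>+x. (top * emeasure ?M {a}) * indicator {a} x \<partial>?M) \<le> line_energy ?M"
      unfolding line_energy_def
    proof (rule nn_integral_mono)
      fix x
      show "(top * emeasure ?M {a}) * indicator {a} x \<le> (\<integral>\<^sup>+y. line_kernel x y \<partial>?M)"
      proof (cases "x = a")
        case True
        have "top * emeasure ?M {a} = (\<integral>\<^sup>+y. top * indicator {a} y \<partial>?M)"
          by (subst nn_integral_cmult_indicator) auto
        also have "\<dots> \<le> (\<integral>\<^sup>+y. line_kernel x y \<partial>?M)"
          using line_kernel_diag[OF that] True by (intro nn_integral_mono) (auto split: split_indicator)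
        finally show ?thesis using True by simp
      qed simp
    qed
    moreover have "(\<integral>\<^sup>+x. (top * emeasure ?M {a}) * indicator {a} x \<partial>?M) = top"
      using ne by (subst nn_integral_cmult_indicator) (auto simp: ennreal_top_mult ennreal_mult_top)
    ultimately show False using N by (simp add: top_unique)
  qed
  have "AE x in ?M. \<forall>a\<in>S - regular_points. x \<noteq> a"
  proof (rule AE_finite_allI[OF finite_irregular_points])
    fix a assume "a \<in> S - regular_points"
    then have "{a} \<in> null_sets ?M" using atom by (auto simp: null_sets_def)
    then have "AE x in ?M. x \<notin> {a}" by (rule AE_not_in)
    then show "AE x in ?M. x \<noteq> a" by eventually_elim simp
  qed
  then have AEr: "AE x in ?M. x \<in> regular_points" using AES by eventually_elim auto
  have "emeasure ?M regular_points = 1"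
    using AEr open_regular_points by (subst M.emeasure_eq_1_AE) auto
  then have "(SUP K\<in>{K. K \<subseteq> regular_points \<and> compact K}. emeasure ?M K) = 1"
    using inner_regular[of ?M regular_points] sM open_regular_points M.emeasure_space_1 by auto
  \<comment> \<open>The offset \<open>2\<close> makes the masses positive, so that they can be divided by.\<close>
  then have "\<exists>K. K \<subseteq> regular_points \<and> compact K \<and> ennreal (1 - 1 / real (j + 2)) < emeasure ?M K" for j :: nat
  proof -
    assume s: "(SUP K\<in>{K. K \<subseteq> regular_points \<and> compact K}. emeasure ?M K) = 1"
    have "ennreal (1 - 1 / real (j + 2)) < ennreal 1" by (subst ennreal_less_iff) auto
    then have "ennreal (1 - 1 / real (j + 2)) < (SUP K\<in>{K. K \<subseteq> regular_points \<and> compact K}. emeasure ?M K)"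
      unfolding s by simp
    then show ?thesis unfolding less_SUP_iff by blast
  qed
  then obtain Kj where Kj: "\<And>j. Kj j \<subseteq> regular_points" "\<And>j. compact (Kj j)"
    "\<And>j. ennreal (1 - 1 / real (j + 2)) < emeasure ?M (Kj j)" by metis
  have KB[measurable]: "Kj j \<in> sets borel" for j using borel_closed[OF compact_imp_closed[OF Kj(2)]] .
  define q where "q j = M.prob (Kj j)" for j
  have q: "1 - 1 / real (j + 2) < q j" "0 < q j" "q j \<le> 1" for j
  proof -
    show 1: "1 - 1 / real (j + 2) < q j" using Kj(3)[of j] unfolding M.emeasure_eq_measure q_def
      by (subst (asm) ennreal_less_iff) auto
    have "1 / real (j + 2) \<le> 1" by simp
    then show "0 < q j" using 1 by linarith
    show "q j \<le> 1" unfolding q_def by simp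
  qed
  have qlim: "q \<longlonglongrightarrow> 1"
  proof (rule tendsto_sandwich[of "\<lambda>j. 1 - 1 / real (j + 2)" q sequentially "\<lambda>_. 1"])
    have "(\<lambda>j. 1 - 1 / real (j + 2)) \<longlonglongrightarrow> 1 - 0"
      by (intro tendsto_intros LIMSEQ_ignore_initial_segment lim_1_over_n)
    then show "(\<lambda>j. 1 - 1 / real (j + 2)) \<longlonglongrightarrow> 1" by simp
  qed (use q in \<open>auto intro!: always_eventually less_imp_le\<close>)
  define \<rho> where "\<rho> j = density ?M (\<lambda>x. ennreal (indicator (Kj j) x / q j))" for j
  have dm[measurable]: "(\<lambda>x. indicator (Kj j) x / q j :: real) \<in> borel_measurable borel" for j by measurable
  have nn\<rho>: "(\<integral>\<^sup>+x. f x \<partial>\<rho> j) = (\<integral>\<^sup>+x. ennreal (indicator (Kj j) x / q j) * f x \<partial>?M)" if "f \<in> borel_measurable borel" for f j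
    unfolding \<rho>_def using that by (intro nn_integral_density) auto
  have \<rho>d: "real_distribution (\<rho> j)" for j
  proof -
    have "emeasure (\<rho> j) (space (\<rho> j)) = (\<integral>\<^sup>+x. 1 \<partial>\<rho> j)" by simp
    also have "\<dots> = (\<integral>\<^sup>+x. ennreal (1 / q j) * indicator (Kj j) x \<partial>?M)"
      unfolding nn\<rho>[OF borel_measurable_const] by (intro nn_integral_cong) (auto split: split_indicator)
    also have "\<dots> = ennreal (1 / q j) * ennreal (q j)"
      by (subst nn_integral_cmult_indicator) (auto simp: M.emeasure_eq_measure q_def)
    also have "\<dots> = 1" using q[of j] by (simp add: ennreal_mult'[symmetric])
    finally have "prob_space (\<rho> j)" by (rule prob_spaceI)
    then show ?thesis by (simp add: real_distribution_def real_distribution_axioms_def \<rho>_def)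
  qed
  have AEK: "AE x in \<rho> j. x \<in> Kj j" for j
    unfolding \<rho>_def by (subst AE_density) (auto split: split_indicator)
  have le\<rho>: "(\<integral>\<^sup>+x. f x \<partial>\<rho> j) \<le> ennreal (1 / q j) * (\<integral>\<^sup>+x. f x \<partial>?M)" if f: "f \<in> borel_measurable borel" for f j
  proof -
    have "(\<integral>\<^sup>+x. f x \<partial>\<rho> j) \<le> (\<integral>\<^sup>+x. ennreal (1 / q j) * f x \<partial>?M)"
      unfolding nn\<rho>[OF f] using q[of j] by (intro nn_integral_mono mult_right_mono) (auto split: split_indicator)
    also have "\<dots> = ennreal (1 / q j) * (\<integral>\<^sup>+x. f x \<partial>?M)" using f by (intro nn_integral_cmult) simp
    finally show ?thesis .
  qed
  have en: "line_energy (\<rho> j) \<le> ennreal (1 / q j) * (ennreal (1 / q j) * line_energy ?M)" for j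
  proof -
    interpret \<rho>: real_distribution "\<rho> j" by (rule \<rho>d)
    have "line_energy (\<rho> j) \<le> ennreal (1 / q j) * (\<integral>\<^sup>+x. \<integral>\<^sup>+y. line_kernel x y \<partial>\<rho> j \<partial>?M)"
      unfolding line_energy_def by (rule le\<rho>) measurable
    also have "\<dots> \<le> ennreal (1 / q j) * (\<integral>\<^sup>+x. ennreal (1 / q j) * (\<integral>\<^sup>+y. line_kernel x y \<partial>?M) \<partial>?M)"
      by (intro mult_left_mono nn_integral_mono le\<rho>) measurable
    also have "(\<integral>\<^sup>+x. ennreal (1 / q j) * (\<integral>\<^sup>+y. line_kernel x y \<partial>?M) \<partial>?M) = ennreal (1 / q j) * line_energy ?M"
      unfolding line_energy_def by (rule nn_integral_cmult) measurable
    finally show ?thesis .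
  qed
  obtain r where r: "line_energy ?M = ennreal r" "0 \<le> r" "r < b"
  proof -
    have "line_energy ?M < top" using N by (rule less_trans) simp
    then obtain r where r: "line_energy ?M = ennreal r" "0 \<le> r" by (cases "line_energy ?M") auto
    moreover have "r < b" using N r by (simp add: ennreal_less_iff)
    ultimately show ?thesis using that by blast
  qed
  have "(\<lambda>j. 1 / q j * (1 / q j * r)) \<longlonglongrightarrow> 1 / 1 * (1 / 1 * r)" by (intro tendsto_intros qlim) auto
  then have ev1: "eventually (\<lambda>j. 1 / q j * (1 / q j * r) < b) sequentially" using r by (intro order_tendstoD(2)) auto
  have lim: "limitin (weak_topology S) (\<lambda>j. distr (\<rho> j) (restrict_space borel S) proj) \<mu> sequentially"
  proof (rule limitin_weak_topologyI[OF \<mu>])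
    show "distr (\<rho> j) (restrict_space borel S) proj \<in> borel_prob_measures S" for j
      by (rule from_line_prob[OF \<rho>d]) auto
    fix f :: "real \<Rightarrow> real" assume f: "continuous_on S f" "bounded (f ` S)"
    obtain c where c0: "\<forall>y\<in>f ` S. norm y \<le> c" using f(2) unfolding bounded_iff by blast
    let ?g = "\<lambda>x. f (proj x)"
    have g[measurable]: "?g \<in> borel_measurable borel"
      using continuous_on_compose_proj[OF f(1)] by (rule borel_measurable_continuous_onI)
    have c: "\<bar>?g x\<bar> \<le> c" for x using c0 by simp
    have c_nn: "0 \<le> c" using c[of 0] by linarith
    have i1: "(\<integral>x. f x \<partial>distr (\<rho> j) (restrict_space borel S) proj) = (\<integral>x. indicator (Kj j) x / q j * ?g x \<partial>?M)" for j
    proof -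
      have "(\<integral>x. f x \<partial>distr (\<rho> j) (restrict_space borel S) proj) = (\<integral>x. ?g x \<partial>\<rho> j)"
        by (intro integral_distr borel_measurable_continuous_on_restrict f(1))
           (auto simp: \<rho>_def intro: measurable_restrict_space2)
      also have "\<dots> = (\<integral>x. indicator (Kj j) x / q j * ?g x \<partial>?M)"
        unfolding \<rho>_def using q[of j] by (intro integral_real_density) auto
      finally show ?thesis .
    qed
    have i2: "(\<integral>x. f x \<partial>\<mu>) = (\<integral>x. ?g x \<partial>?M)" by (rule integral_to_line_proj[OF \<mu> f(1)])
    have int: "integrable ?M ?g" by (rule M.integrable_const_bound[of _ c]) (use c in auto)
    have dev: "\<bar>(\<integral>x. indicator (Kj j) x / q j * ?g x \<partial>?M) - (\<integral>x. ?g x \<partial>?M)\<bar> \<le> c * (2 * (1 - q j))" for j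
    proof -
      have qj: "0 < q j" "q j \<le> 1" using q[of j] by auto
      have iK: "integrable ?M (\<lambda>x. indicator (Kj j) x :: real)" by (simp add: M.emeasure_eq_measure)
      have iKg: "integrable ?M (\<lambda>x. indicator (Kj j) x / q j * ?g x)"
      proof (rule M.integrable_const_bound[of _ "c / q j"])
        have "norm (indicator (Kj j) x / q j * ?g x) \<le> c / q j" for x
          using c[of x] qj c_nn by (auto split: split_indicator simp: abs_mult field_simps)
        then show "AE x in ?M. norm (indicator (Kj j) x / q j * ?g x) \<le> c / q j" by (rule AE_I2)
      qed measurable
      have "\<bar>(\<integral>x. indicator (Kj j) x / q j * ?g x \<partial>?M) - (\<integral>x. ?g x \<partial>?M)\<bar> =
          \<bar>\<integral>x. indicator (Kj j) x / q j * ?g x - ?g x \<partial>?M\<bar>" using iKg int by simp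
      also have "\<dots> \<le> (\<integral>x. \<bar>indicator (Kj j) x / q j * ?g x - ?g x\<bar> \<partial>?M)"
        using integral_norm_bound[of ?M "\<lambda>x. indicator (Kj j) x / q j * ?g x - ?g x"] by simp
      \<comment> \<open>The density differs from \<open>1\<close> by \<open>1 / q j - 1\<close> on \<open>Kj j\<close> and by \<open>1\<close> off \<open>Kj j\<close>; both cases are combined in one affine expression.\<close>
      also have "\<dots> \<le> (\<integral>x. c * (indicator (Kj j) x * (1 / q j - 2) + 1) \<partial>?M)"
      proof (rule integral_mono)
        show "integrable ?M (\<lambda>x. c * (indicator (Kj j) x * (1 / q j - 2) + 1))" using iK by simp
        show "integrable ?M (\<lambda>x. \<bar>indicator (Kj j) x / q j * ?g x - ?g x\<bar>)" using iKg int by simp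
        fix x
        have q1: "1 / q j - 1 \<ge> 0" using qj by simp
        have "\<bar>1 / q j * ?g x - ?g x\<bar> = (1 / q j - 1) * \<bar>?g x\<bar>"
          using q1 by (metis abs_mult abs_of_nonneg left_diff_distrib mult_1)
        also have "\<dots> \<le> (1 / q j - 1) * c" using q1 c by (intro mult_left_mono) auto
        finally have "\<bar>1 / q j * ?g x - ?g x\<bar> \<le> c * (1 / q j - 1)" by (simp add: mult.commute)
        then show "\<bar>indicator (Kj j) x / q j * ?g x - ?g x\<bar> \<le> c * (indicator (Kj j) x * (1 / q j - 2) + 1)"
          using c[of x] by (auto split: split_indicator)
      qed
      also have "\<dots> = c * (q j * (1 / q j - 2) + 1)"
        using iK M.prob_space by (simp add: q_def)
      also have "q j * (1 / q j - 2) + 1 = 2 * (1 - q j)" using qj by (simp add: algebra_simps)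
      finally show ?thesis .
    qed
    have "(\<lambda>j. (\<integral>x. indicator (Kj j) x / q j * ?g x \<partial>?M) - (\<integral>x. ?g x \<partial>?M)) \<longlonglongrightarrow> 0"
    proof (rule Lim_null_comparison)
      show "eventually (\<lambda>j. norm ((\<integral>x. indicator (Kj j) x / q j * ?g x \<partial>?M) - (\<integral>x. ?g x \<partial>?M)) \<le> c * (2 * (1 - q j))) sequentially"
        using dev by (intro always_eventually) simp
      have "(\<lambda>j. c * (2 * (1 - q j))) \<longlonglongrightarrow> c * (2 * (1 - 1))" by (intro tendsto_intros qlim)
      then show "(\<lambda>j. c * (2 * (1 - q j))) \<longlonglongrightarrow> 0" by simp
    qed
    then show "(\<lambda>j. \<integral>x. f x \<partial>distr (\<rho> j) (restrict_space borel S) proj) \<longlonglongrightarrow> (\<integral>x. f x \<partial>\<mu>)"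
      unfolding i1 i2 by (rule LIM_zero_cancel)
  qed
  have ev2: "eventually (\<lambda>j. distr (\<rho> j) (restrict_space borel S) proj \<in> G) sequentially"
    using lim G by (auto simp: limitin_def)
  obtain j where j: "1 / q j * (1 / q j * r) < b" "distr (\<rho> j) (restrict_space borel S) proj \<in> G"
    using eventually_happens[OF eventually_conj[OF ev1 ev2]] by auto
  have "line_energy (\<rho> j) \<le> ennreal (1 / q j * (1 / q j * r))"
    using en[of j] q[of j] r by (simp add: ennreal_mult'[symmetric])
  also have "\<dots> < ennreal b" using j(1) r q[of j] by (subst ennreal_less_iff) auto
  finally show ?thesis using \<rho>d[of j] Kj(1,2)[of j] AEK[of j] j(2) by blast
qed

end

lemma (in beta_ensemble) smoothing_regular:
  assumes \<rho>: "real_distribution \<rho>" and K: "compact K" "K \<subseteq> regular_points" and AEK: "AE x in \<rho>. x \<in> K"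
  obtains \<epsilon>0 K' where "0 < \<epsilon>0" "\<epsilon>0 \<le> 1" "compact K'" "K' \<subseteq> regular_points"
    "\<And>x t. x \<in> K \<Longrightarrow> 0 \<le> t \<Longrightarrow> t \<le> \<epsilon>0 \<Longrightarrow> x + t \<in> K'"
    "\<And>\<epsilon>. 0 < \<epsilon> \<Longrightarrow> \<epsilon> \<le> \<epsilon>0 \<Longrightarrow> smooth_dist (smoothing \<rho> \<epsilon>) K' (1 / \<epsilon>)"
proof -
  interpret \<rho>: real_distribution \<rho> by fact
  obtain d where d: "d > 0" "(\<Union>x\<in>K. ball x d) \<subseteq> regular_points"
    using compact_subset_open_imp_ball_epsilon_subset[OF K(1) open_regular_points K(2)] .
  define \<epsilon>0 where "\<epsilon>0 = min 1 (d / 2)"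
  define K' where "K' = (\<lambda>z. fst z + snd z) ` (K \<times> {0..\<epsilon>0})"
  have e0: "0 < \<epsilon>0" "\<epsilon>0 \<le> 1" "\<epsilon>0 < d" using d by (auto simp: \<epsilon>0_def)
  have K'c: "compact K'" unfolding K'_def by (intro compact_continuous_image continuous_intros compact_Times K) simp
  have K'r: "K' \<subseteq> regular_points"
  proof
    fix z assume "z \<in> K'"
    then obtain x t where z: "z = x + t" "x \<in> K" "0 \<le> t" "t \<le> \<epsilon>0" by (auto simp: K'_def)
    then have "z \<in> ball x d" using e0 by (simp add: dist_real_def)
    then show "z \<in> regular_points" using d(2) z(2) by blast
  qed
  have K'm: "x + t \<in> K'" if "x \<in> K" "0 \<le> t" "t \<le> \<epsilon>0" for x t
    unfolding K'_def using that by (intro image_eqI[of _ _ "(x, t)"]) auto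
  have [measurable]: "K' \<in> sets borel" using borel_closed[OF compact_imp_closed[OF K'c]] .
  have "smooth_dist (smoothing \<rho> \<epsilon>) K' (1 / \<epsilon>)" if e: "0 < \<epsilon>" "\<epsilon> \<le> \<epsilon>0" for \<epsilon>
  proof -
    have "(\<integral>\<^sup>+z. indicator (- K') z \<partial>smoothing \<rho> \<epsilon>) = (\<integral>\<^sup>+x. \<integral>\<^sup>+u. indicator (- K') (x + \<epsilon> * u) \<partial>unit_noise \<partial>\<rho>)"
      by (rule nn_integral_smoothing[OF \<rho>]) measurable
    also have "\<dots> = (\<integral>\<^sup>+x. 0 \<partial>\<rho>)"
    proof (rule nn_integral_cong_AE)
      show "AE x in \<rho>. (\<integral>\<^sup>+u. indicator (- K') (x + \<epsilon> * u) \<partial>unit_noise) = 0"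
        using AEK
      proof eventually_elim
        case (elim x)
        have "AE u in unit_noise. indicator (- K') (x + \<epsilon> * u) \<le> (0 :: ennreal)"
          using AE_unit_noise
        proof eventually_elim
          case (elim u)
          have "\<epsilon> * u \<le> \<epsilon>0 * 1" using elim e by (intro mult_mono) auto
          then have "x + \<epsilon> * u \<in> K'" using elim e \<open>x \<in> K\<close> by (intro K'm) auto
          then show ?case by simp
        qed
        from nn_integral_unit_noise_const_le[OF this] show ?case by simp
      qed
    qed
    finally have "(\<integral>\<^sup>+z. indicator (- K') z \<partial>smoothing \<rho> \<epsilon>) = 0" by simp
    then have "AE z in smoothing \<rho> \<epsilon>. indicator (- K') z = (0 :: ennreal)"
      by (subst (asm) nn_integral_0_iff_AE) (auto simp: smoothing_def)
    then have "AE z in smoothing \<rho> \<epsilon>. z \<in> K'" by eventually_elim (auto split: split_indicator_asm)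
    then show ?thesis unfolding smooth_dist_def
      using real_distribution_smoothing[OF \<rho>] K'c K'r e e0 nn_integral_smoothing_le[OF \<rho> _ e(1)] by auto
  qed
  then show ?thesis using that[of \<epsilon>0 K'] e0 K'c K'r K'm by blast
qed

lemma (in beta_ensemble) line_energy_smoothing:
  assumes \<rho>: "real_distribution \<rho>"
  shows "line_energy (smoothing \<rho> \<epsilon>) =
    (\<integral>\<^sup>+z. (\<integral>\<^sup>+u. \<integral>\<^sup>+v. line_kernel (fst z + \<epsilon> * u) (snd z + \<epsilon> * v) \<partial>unit_noise \<partial>unit_noise) \<partial>(\<rho> \<Otimes>\<^sub>M \<rho>))"
proof -
  interpret \<rho>: real_distribution \<rho> by fact
  interpret U: prob_space unit_noise by (rule prob_space_unit_noise)
  have "line_energy (smoothing \<rho> \<epsilon>) = (\<integral>\<^sup>+x'. (\<integral>\<^sup>+y. \<integral>\<^sup>+v. line_kernel x' (y + \<epsilon> * v) \<partial>unit_noise \<partial>\<rho>) \<partial>smoothing \<rho> \<epsilon>)"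
    unfolding line_energy_def by (intro nn_integral_cong nn_integral_smoothing[OF \<rho>]) measurable
  also have "\<dots> = (\<integral>\<^sup>+x. \<integral>\<^sup>+u. (\<integral>\<^sup>+y. \<integral>\<^sup>+v. line_kernel (x + \<epsilon> * u) (y + \<epsilon> * v) \<partial>unit_noise \<partial>\<rho>) \<partial>unit_noise \<partial>\<rho>)"
    by (rule nn_integral_smoothing[OF \<rho>]) measurable
  also have "\<dots> = (\<integral>\<^sup>+x. \<integral>\<^sup>+y. (\<integral>\<^sup>+u. \<integral>\<^sup>+v. line_kernel (x + \<epsilon> * u) (y + \<epsilon> * v) \<partial>unit_noise \<partial>unit_noise) \<partial>\<rho> \<partial>\<rho>)"
  proof (rule nn_integral_cong)
    fix x
    interpret PS: pair_sigma_finite unit_noise \<rho> by unfold_locales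
    have "(\<lambda>(u, y). \<integral>\<^sup>+v. line_kernel (x + \<epsilon> * u) (y + \<epsilon> * v) \<partial>unit_noise) \<in> borel_measurable (unit_noise \<Otimes>\<^sub>M \<rho>)"
      by measurable
    from PS.Fubini'[OF this]
    show "(\<integral>\<^sup>+u. (\<integral>\<^sup>+y. \<integral>\<^sup>+v. line_kernel (x + \<epsilon> * u) (y + \<epsilon> * v) \<partial>unit_noise \<partial>\<rho>) \<partial>unit_noise) =
       (\<integral>\<^sup>+y. (\<integral>\<^sup>+u. \<integral>\<^sup>+v. line_kernel (x + \<epsilon> * u) (y + \<epsilon> * v) \<partial>unit_noise \<partial>unit_noise) \<partial>\<rho>)" by simp
  qed
  also have "\<dots> = (\<integral>\<^sup>+z. (\<integral>\<^sup>+u. \<integral>\<^sup>+v. line_kernel (fst z + \<epsilon> * u) (snd z + \<epsilon> * v) \<partial>unit_noise \<partial>unit_noise) \<partial>(\<rho> \<Otimes>\<^sub>M \<rho>))"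
    by (subst \<rho>.nn_integral_fst[symmetric]) auto
  finally show ?thesis .
qed

lemma (in beta_ensemble) line_kernel_upper_semicont:
  assumes xy: "x \<in> S - zero_set S w" "y \<in> S - zero_set S w" "x \<noteq> y" and \<eta>: "\<eta> > 0"
  obtains d where "d > 0" "\<And>x' y'. x' \<in> S \<Longrightarrow> y' \<in> S \<Longrightarrow> \<bar>x' - x\<bar> < d \<Longrightarrow> \<bar>y' - y\<bar> < d \<Longrightarrow>
     line_kernel x' y' \<le> line_kernel x y + ennreal \<eta>"
proof -
  have E0: "E x y > 0" by (rule E_pos[OF xy])
  have "0 < E x y * (1 - exp (- \<eta>))" using E0 \<eta> by simp
  then obtain d where d: "d > 0" "\<And>z. z \<in> S \<times> S \<Longrightarrow> dist z (x, y) < d \<Longrightarrow>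
     dist ((\<lambda>(x, y). E x y) z) ((\<lambda>(x, y). E x y) (x, y)) < E x y * (1 - exp (- \<eta>))"
    using K.cont_E xy unfolding continuous_on_iff by (metis DiffD1 SigmaI)
  show ?thesis
  proof (rule that[of "d / 2"])
    fix x' y' assume x': "x' \<in> S" "y' \<in> S" "\<bar>x' - x\<bar> < d / 2" "\<bar>y' - y\<bar> < d / 2"
    have "dist (x', y') (x, y) \<le> dist x' x + dist y' y"
      unfolding dist_Pair_Pair by (rule order_trans[OF sqrt_add_le_add_sqrt]) auto
    also have "\<dots> < d" using x' by (simp add: dist_real_def)
    finally have "\<bar>E x' y' - E x y\<bar> < E x y * (1 - exp (- \<eta>))" using d(2)[of "(x', y')"] x' by (simp add: dist_real_def)
    then have gt: "E x y * exp (- \<eta>) < E x' y'" by (simp add: algebra_simps)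
    have p: "0 < E x y * exp (- \<eta>)" using E0 by simp
    have E': "E x' y' > 0" using gt p by linarith
    have "ln (E x y * exp (- \<eta>)) \<le> ln (E x' y')" using gt p E' by (subst ln_le_cancel_iff) auto
    then have "Bd - ln (E x' y') \<le> (Bd - ln (E x y)) + \<eta>" using E0 by (simp add: ln_mult)
    moreover have "0 \<le> Bd - ln (E x y)"
    proof -
      have "ln (E x y) \<le> ln (exp Bd)" using K.E_le[of x y] xy E0 by (subst ln_le_cancel_iff) auto
      then show ?thesis by simp
    qed
    ultimately have "ennreal (Bd - ln (E x' y')) \<le> ennreal (Bd - ln (E x y)) + ennreal \<eta>"
      using \<eta> by (simp flip: ennreal_plus add: ennreal_leI)
    then show "line_kernel x' y' \<le> line_kernel x y + ennreal \<eta>"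
      using line_kernel_regular[OF xy] x' E' by (simp add: line_kernel_def proj_id K.shifted_kernel_pos)
  qed (use d in simp)
qed

text \<open>The energy of the smoothed measure is the integral of the averaged kernel \<open>H k\<close> against \<open>\<rho> \<Otimes>\<^sub>M \<rho>\<close>.
  By \<open>nn_integral_log_sing_smoothing\<close> the averages are at most the kernel plus a constant, an
  integrable bound, and off the diagonal their upper limit is at most the kernel. The reverse Fatou
  lemma bounds the upper limit of the energies.\<close>

lemma (in beta_ensemble) smoothing_approximates:
  assumes \<rho>: "real_distribution \<rho>" and K: "compact K" "K \<subseteq> regular_points" and AEK: "AE x in \<rho>. x \<in> K"
    and G: "openin (weak_topology S) G" "distr \<rho> (restrict_space borel S) proj \<in> G"
    and b: "line_energy \<rho> < ennreal b"
  shows "\<exists>\<nu> K' C. smooth_dist \<nu> K' C \<and> distr \<nu> (restrict_space borel S) proj \<in> G \<and> line_energy \<nu> < ennreal b"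
proof -
  interpret \<rho>: real_distribution \<rho> by fact
  interpret U: prob_space unit_noise by (rule prob_space_unit_noise)
  interpret P: pair_prob_space \<rho> \<rho> by unfold_locales
  obtain \<epsilon>0 K' where e0: "0 < \<epsilon>0" "\<epsilon>0 \<le> 1" and K': "compact K'" "K' \<subseteq> regular_points"
    and K'm: "\<And>x t. x \<in> K \<Longrightarrow> 0 \<le> t \<Longrightarrow> t \<le> \<epsilon>0 \<Longrightarrow> x + t \<in> K'"
    and sm: "\<And>\<epsilon>. 0 < \<epsilon> \<Longrightarrow> \<epsilon> \<le> \<epsilon>0 \<Longrightarrow> smooth_dist (smoothing \<rho> \<epsilon>) K' (1 / \<epsilon>)"
    using smoothing_regular[OF \<rho> K AEK] by metis
  define e where "e k = \<epsilon>0 / real (Suc k)" for k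
  have e: "0 < e k" "e k \<le> \<epsilon>0" for k using e0 by (auto simp: e_def divide_le_eq)
  have elim0: "e \<longlonglongrightarrow> 0"
  proof -
    have "(\<lambda>k. \<epsilon>0 * (1 / real (Suc k))) \<longlonglongrightarrow> \<epsilon>0 * 0" by (intro tendsto_intros LIMSEQ_Suc lim_1_over_n)
    then show ?thesis by (simp add: e_def[abs_def])
  qed
  have K'S: "K' \<subseteq> S - zero_set S w" "K' \<subseteq> S" and KS: "K \<subseteq> S - zero_set S w" "K \<subseteq> K'"
    using K' K regular_points_subset K'm[of _ 0] e0 by (auto simp: subset_eq)
  have step: "x + e k * u \<in> K'" if "x \<in> K" "0 \<le> u" "u \<le> 1" for x k u
  proof -
    have "e k * u \<le> \<epsilon>0 * 1" using that e[of k] e0 by (intro mult_mono) auto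
    then show ?thesis using that e[of k] by (intro K'm) auto
  qed
  define H where "H k z = (\<integral>\<^sup>+u. \<integral>\<^sup>+v. line_kernel (fst z + e k * u) (snd z + e k * v) \<partial>unit_noise \<partial>unit_noise)" for k z
  let ?a = "\<beta> * \<kappa>\<^sup>2 / 2"
  have a0: "0 \<le> ?a" using beta by simp
  obtain c where c: "c \<ge> 0" "\<And>x y. x \<in> K' \<Longrightarrow> y \<in> K' \<Longrightarrow> x \<noteq> y \<Longrightarrow> \<bar>- ln (E x y) - ?a * log_sing (x - y)\<bar> \<le> c"
    using ln_E_log_sing[OF K'] by metis
  have kle: "line_kernel x y \<le> ennreal (Bd + c) + ennreal ?a * ennreal (log_sing (x - y))" if "x \<in> K'" "y \<in> K'" "x \<noteq> y" for x y
  proof -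
    have "Bd - ln (E x y) \<le> (Bd + c) + ?a * log_sing (x - y)" using c(2)[OF that] by linarith
    then have "ennreal (Bd - ln (E x y)) \<le> ennreal ((Bd + c) + ?a * log_sing (x - y))" by (rule ennreal_leI)
    also have "\<dots> = ennreal (Bd + c) + ennreal ?a * ennreal (log_sing (x - y))"
      unfolding ennreal_mult[OF a0 log_sing_nonneg, symmetric]
      using a0 c(1) K.B_nonneg log_sing_nonneg by (intro ennreal_plus mult_nonneg_nonneg add_nonneg_nonneg)
    finally have le: "ennreal (Bd - ln (E x y)) \<le> ennreal (Bd + c) + ennreal ?a * ennreal (log_sing (x - y))" .
    have "line_kernel x y = ennreal (Bd - ln (E x y))"
      using that K'S(1) by (intro line_kernel_regular) blast+
    then show ?thesis using le by (simp only:)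
  qed
  \<comment> \<open>A bound for the increase of the kernel under averaging over the noise: the singularity is compared with the kernel twice, each time with error \<open>c\<close>, and its average grows by at most \<open>ln 2 + log_sing_mass\<close>.\<close>
  define c4 where "c4 = (Bd + c) + ?a * (ln 2 + log_sing_mass) + c"
  have Hle: "H k z \<le> line_kernel (fst z) (snd z) + ennreal c4" if z: "fst z \<in> K" "snd z \<in> K" "fst z \<noteq> snd z" for k z
  proof -
    let ?x = "fst z" and ?y = "snd z"
    have inner: "(\<integral>\<^sup>+v. line_kernel (?x + e k * u) (?y + e k * v) \<partial>unit_noise) \<le>
       ennreal (Bd + c) + ennreal ?a * (\<integral>\<^sup>+v. ennreal (log_sing (?x + e k * u - (?y + e k * v))) \<partial>unit_noise)"
      if u: "0 \<le> u \<and> u \<le> 1" for u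
    proof -
      have "AE v in unit_noise. s \<noteq> v" for s
        by (rule AE_neq_of_bounded_density[where C = 1]) (simp_all add: nn_integral_unit_noise_le)
      from this[of "(?x + e k * u - ?y) / e k"]
      have "AE v in unit_noise. line_kernel (?x + e k * u) (?y + e k * v) \<le>
          ennreal (Bd + c) + ennreal ?a * ennreal (log_sing (?x + e k * u - (?y + e k * v)))"
        using AE_unit_noise
      proof eventually_elim
        case (elim v)
        have "?x + e k * u \<noteq> ?y + e k * v" using elim(1) e(1)[of k] by (auto simp: field_simps)
        then show ?case using step z u elim(2) by (intro kle) auto
      qed
      then have "(\<integral>\<^sup>+v. line_kernel (?x + e k * u) (?y + e k * v) \<partial>unit_noise) \<le>
        (\<integral>\<^sup>+v. ennreal (Bd + c) + ennreal ?a * ennreal (log_sing (?x + e k * u - (?y + e k * v))) \<partial>unit_noise)"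
        by (rule nn_integral_mono_AE)
      also have "\<dots> = ennreal (Bd + c) + ennreal ?a * (\<integral>\<^sup>+v. ennreal (log_sing (?x + e k * u - (?y + e k * v))) \<partial>unit_noise)"
        using U.emeasure_space_1 by (simp add: nn_integral_add nn_integral_cmult)
      finally show ?thesis .
    qed
    have "H k z \<le> (\<integral>\<^sup>+u. ennreal (Bd + c) + ennreal ?a * (\<integral>\<^sup>+v. ennreal (log_sing (?x + e k * u - (?y + e k * v))) \<partial>unit_noise) \<partial>unit_noise)"
      unfolding H_def by (rule nn_integral_mono_AE) (rule eventually_mono[OF AE_unit_noise inner])
    also have "\<dots> = ennreal (Bd + c) + ennreal ?a * (\<integral>\<^sup>+u. \<integral>\<^sup>+v. ennreal (log_sing (?x + e k * u - (?y + e k * v))) \<partial>unit_noise \<partial>unit_noise)"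
      using U.emeasure_space_1 by (simp add: nn_integral_add nn_integral_cmult)
    also have "\<dots> \<le> ennreal (Bd + c) + ennreal ?a * ennreal (log_sing (?x - ?y) + ln 2 + log_sing_mass)"
      by (intro add_left_mono mult_left_mono nn_integral_log_sing_smoothing e z) auto
    also have "\<dots> = ennreal ((Bd + c) + ?a * (log_sing (?x - ?y) + ln 2 + log_sing_mass))"
      using a0 c(1) K.B_nonneg log_sing_nonneg[of "?x - ?y"] log_sing_mass_nonneg
      by (subst ennreal_mult[symmetric]) (auto simp flip: ennreal_plus)
    also have "\<dots> \<le> ennreal ((Bd - ln (E ?x ?y)) + c4)"
    proof (rule ennreal_leI)
      have "?a * log_sing (?x - ?y) \<le> - ln (E ?x ?y) + c" using c(2)[OF subsetD[OF KS(2) z(1)] subsetD[OF KS(2) z(2)] z(3)] by linarith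
      then show "(Bd + c) + ?a * (log_sing (?x - ?y) + ln 2 + log_sing_mass) \<le> (Bd - ln (E ?x ?y)) + c4"
        using K.B_nonneg unfolding c4_def distrib_left by linarith
    qed
    also have "\<dots> \<le> ennreal (Bd - ln (E ?x ?y)) + ennreal c4"
    proof -
      have "0 \<le> c4" using a0 c(1) K.B_nonneg log_sing_mass_nonneg unfolding c4_def
        by (intro add_nonneg_nonneg mult_nonneg_nonneg) auto
      moreover have "0 \<le> Bd - ln (E ?x ?y)" if "0 < E ?x ?y"
        using that K.E_le[of ?x ?y] z KS ln_le_cancel_iff[of "E ?x ?y" "exp Bd"] by (auto simp: subset_eq)
      moreover have "0 < E ?x ?y" using z KS(1) by (intro E_pos) blast+
      ultimately show ?thesis by (subst ennreal_plus) auto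
    qed
    finally have le: "H k z \<le> ennreal (Bd - ln (E ?x ?y)) + ennreal c4" .
    have "line_kernel ?x ?y = ennreal (Bd - ln (E ?x ?y))"
      using z KS(1) by (intro line_kernel_regular) blast+
    then show ?thesis using le by (simp only:)
  qed
  have Hm: "H k \<in> borel_measurable (\<rho> \<Otimes>\<^sub>M \<rho>)" for k unfolding H_def[abs_def] by measurable
  have km: "(\<lambda>z. line_kernel (fst z) (snd z)) \<in> borel_measurable (\<rho> \<Otimes>\<^sub>M \<rho>)" by measurable
  have LE: "line_energy \<rho> = (\<integral>\<^sup>+z. line_kernel (fst z) (snd z) \<partial>(\<rho> \<Otimes>\<^sub>M \<rho>))"
    unfolding line_energy_def using \<rho>.nn_integral_fst[OF km] by simp
  have fin: "(\<integral>\<^sup>+z. line_kernel (fst z) (snd z) \<partial>(\<rho> \<Otimes>\<^sub>M \<rho>)) < \<infinity>"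
    using b unfolding LE by (rule less_trans) simp
  have AEp: "AE z in \<rho> \<Otimes>\<^sub>M \<rho>. fst z \<in> K \<and> snd z \<in> K \<and> fst z \<noteq> snd z"
  proof -
    have [measurable]: "K \<in> sets borel" using borel_closed[OF compact_imp_closed[OF K(1)]] .
    have "AE z in \<rho> \<Otimes>\<^sub>M \<rho>. fst z \<in> K \<and> snd z \<in> K"
    proof (rule P.AE_pair_measure)
      show "{z \<in> space (\<rho> \<Otimes>\<^sub>M \<rho>). fst z \<in> K \<and> snd z \<in> K} \<in> sets (\<rho> \<Otimes>\<^sub>M \<rho>)" by measurable
      show "AE x in \<rho>. AE y in \<rho>. fst (x, y) \<in> K \<and> snd (x, y) \<in> K"
        using AEK by eventually_elim (use AEK in \<open>auto elim: eventually_mono\<close>)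
    qed
    moreover have "AE z in \<rho> \<Otimes>\<^sub>M \<rho>. line_kernel (fst z) (snd z) \<noteq> \<infinity>"
      using fin by (intro nn_integral_PInf_AE km) auto
    ultimately show ?thesis
    proof eventually_elim
      case (elim z)
      then show ?case using line_kernel_diag[of "fst z"] KS by auto
    qed
  qed
  have limH: "limsup (\<lambda>k. H k z) \<le> line_kernel (fst z) (snd z)" if z: "fst z \<in> K" "snd z \<in> K" "fst z \<noteq> snd z" for z
  proof (rule ennreal_le_epsilon)
    fix \<eta> :: real assume \<eta>: "0 < \<eta>"
    obtain d where d: "d > 0" "\<And>x' y'. x' \<in> S \<Longrightarrow> y' \<in> S \<Longrightarrow> \<bar>x' - fst z\<bar> < d \<Longrightarrow> \<bar>y' - snd z\<bar> < d \<Longrightarrow>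
       line_kernel x' y' \<le> line_kernel (fst z) (snd z) + ennreal \<eta>"
      using line_kernel_upper_semicont[of "fst z" "snd z" \<eta>] z KS \<eta> by (metis subsetD)
    have "eventually (\<lambda>k. e k < d) sequentially" using elim0 d(1) by (rule order_tendstoD)
    then have "eventually (\<lambda>k. H k z \<le> line_kernel (fst z) (snd z) + ennreal \<eta>) sequentially"
    proof eventually_elim
      case (elim k)
      have "line_kernel (fst z + e k * u) (snd z + e k * v) \<le> line_kernel (fst z) (snd z) + ennreal \<eta>"
        if "0 \<le> u \<and> u \<le> 1" "0 \<le> v \<and> v \<le> 1" for u v
      proof (rule d(2))
        show "fst z + e k * u \<in> S" "snd z + e k * v \<in> S" using step z that K'S by blast+
        have small: "\<bar>r + e k * t - r\<bar> < d" if "0 \<le> t \<and> t \<le> 1" for r t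
        proof -
          have "e k * t \<le> e k * 1" "0 \<le> e k * t" using that e[of k] by (intro mult_left_mono mult_nonneg_nonneg; simp)+
          then show ?thesis using elim by simp
        qed
        show "\<bar>fst z + e k * u - fst z\<bar> < d" "\<bar>snd z + e k * v - snd z\<bar> < d"
          using small that by blast+
      qed
      then show ?case unfolding H_def
        by (intro nn_integral_unit_noise_const_le eventually_mono[OF AE_unit_noise])
    qed
    then show "limsup (\<lambda>k. H k z) \<le> line_kernel (fst z) (snd z) + ennreal \<eta>" by (rule Limsup_bounded)
  qed
  have "limsup (\<lambda>k. \<integral>\<^sup>+z. H k z \<partial>(\<rho> \<Otimes>\<^sub>M \<rho>)) \<le> (\<integral>\<^sup>+z. limsup (\<lambda>k. H k z) \<partial>(\<rho> \<Otimes>\<^sub>M \<rho>))"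
  proof (rule nn_integral_limsup[OF Hm])
    show "(\<lambda>z. line_kernel (fst z) (snd z) + ennreal c4) \<in> borel_measurable (\<rho> \<Otimes>\<^sub>M \<rho>)" by measurable
    show "AE z in \<rho> \<Otimes>\<^sub>M \<rho>. H k z \<le> line_kernel (fst z) (snd z) + ennreal c4" for k
      using AEp by eventually_elim (use Hle in blast)
    show "(\<integral>\<^sup>+z. line_kernel (fst z) (snd z) + ennreal c4 \<partial>(\<rho> \<Otimes>\<^sub>M \<rho>)) < \<infinity>"
      using fin km P.P.emeasure_space_1 by (subst nn_integral_add) auto
  qed
  also have "\<dots> \<le> (\<integral>\<^sup>+z. line_kernel (fst z) (snd z) \<partial>(\<rho> \<Otimes>\<^sub>M \<rho>))"
    by (rule nn_integral_mono_AE, rule eventually_mono[OF AEp]) (use limH in blast)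
  also have "\<dots> < ennreal b" using b LE by simp
  finally have "limsup (\<lambda>k. line_energy (smoothing \<rho> (e k))) < ennreal b"
    unfolding line_energy_smoothing[OF \<rho>] H_def .
  then have ev1: "eventually (\<lambda>k. line_energy (smoothing \<rho> (e k)) < ennreal b) sequentially"
    by (rule Limsup_lessD)
  have rm: "proj \<in> borel \<rightarrow>\<^sub>M restrict_space borel S" by (intro measurable_restrict_space2) auto
  have lim: "limitin (weak_topology S) (\<lambda>k. distr (smoothing \<rho> (e k)) (restrict_space borel S) proj)
     (distr \<rho> (restrict_space borel S) proj) sequentially"
  proof (rule limitin_weak_topologyI)
    show "distr \<rho> (restrict_space borel S) proj \<in> borel_prob_measures S" by (rule from_line_prob[OF \<rho>]) auto
    show "distr (smoothing \<rho> (e k)) (restrict_space borel S) proj \<in> borel_prob_measures S" for k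
      by (rule from_line_prob[OF real_distribution_smoothing[OF \<rho>]]) auto
    fix f :: "real \<Rightarrow> real" assume f: "continuous_on S f" "bounded (f ` S)"
    obtain B where B0: "\<forall>y\<in>f ` S. norm y \<le> B" using f(2) unfolding bounded_iff by blast
    let ?g = "\<lambda>x. f (proj x)"
    have gc: "continuous_on UNIV ?g" by (rule continuous_on_compose_proj[OF f(1)])
    have g[measurable]: "?g \<in> borel_measurable borel" using gc by (rule borel_measurable_continuous_onI)
    have B: "norm (?g x) \<le> B" for x using B0 by simp
    interpret Q: prob_space "\<rho> \<Otimes>\<^sub>M unit_noise"
      by (rule prob_space_pair[OF \<rho>.prob_space_axioms prob_space_unit_noise])
    have fm: "f \<in> borel_measurable (restrict_space borel S)" by (rule borel_measurable_continuous_on_restrict[OF f(1)])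
    have s1: "(\<integral>x. f x \<partial>distr (smoothing \<rho> (e k)) (restrict_space borel S) proj) =
        (\<integral>z. ?g (fst z + e k * snd z) \<partial>(\<rho> \<Otimes>\<^sub>M unit_noise))" for k
    proof -
      have "(\<integral>x. f x \<partial>distr (smoothing \<rho> (e k)) (restrict_space borel S) proj) = (\<integral>x. ?g x \<partial>smoothing \<rho> (e k))"
        by (rule integral_distr[OF _ fm]) (use rm in \<open>simp add: smoothing_def\<close>)
      also have "\<dots> = (\<integral>z. ?g (fst z + e k * snd z) \<partial>(\<rho> \<Otimes>\<^sub>M unit_noise))"
        unfolding smoothing_def by (subst integral_distr) (auto simp: case_prod_unfold)
      finally show ?thesis .
    qed
    have s2: "(\<integral>x. f x \<partial>distr \<rho> (restrict_space borel S) proj) = (\<integral>z. ?g (fst z) \<partial>(\<rho> \<Otimes>\<^sub>M unit_noise))"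
    proof -
      have "(\<integral>x. f x \<partial>distr \<rho> (restrict_space borel S) proj) = (\<integral>x. ?g x \<partial>\<rho>)"
        by (rule integral_distr[OF _ fm]) (use rm in simp)
      also have "\<rho> = distr (\<rho> \<Otimes>\<^sub>M unit_noise) \<rho> fst" by (rule U.distr_pair_fst[symmetric])
      then have "(\<integral>x. ?g x \<partial>\<rho>) = (\<integral>x. ?g x \<partial>distr (\<rho> \<Otimes>\<^sub>M unit_noise) \<rho> fst)" by metis
      also have "\<dots> = (\<integral>z. ?g (fst z) \<partial>(\<rho> \<Otimes>\<^sub>M unit_noise))" by (rule integral_distr) auto
      finally show ?thesis .
    qed
    show "(\<lambda>k. \<integral>x. f x \<partial>distr (smoothing \<rho> (e k)) (restrict_space borel S) proj) \<longlonglongrightarrow> (\<integral>x. f x \<partial>distr \<rho> (restrict_space borel S) proj)"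
      unfolding s1 s2
    proof (rule integral_dominated_convergence[where w = "\<lambda>_. B"])
      have "(\<lambda>k. ?g (fst z + e k * snd z)) \<longlonglongrightarrow> ?g (fst z)" for z :: "real \<times> real"
      proof -
        have "isCont ?g (fst z)" using gc continuous_on_eq_continuous_at[OF open_UNIV] by blast
        moreover have "(\<lambda>k. fst z + e k * snd z) \<longlonglongrightarrow> fst z + 0 * snd z" by (intro tendsto_intros elim0)
        ultimately show ?thesis using isCont_tendsto_compose[of "fst z" ?g] by simp
      qed
      then show "AE z in \<rho> \<Otimes>\<^sub>M unit_noise. (\<lambda>k. ?g (fst z + e k * snd z)) \<longlonglongrightarrow> ?g (fst z)" by (intro AE_I2)
    qed (use B in \<open>auto intro!: AE_I2\<close>)
  qed
  have ev2: "eventually (\<lambda>k. distr (smoothing \<rho> (e k)) (restrict_space borel S) proj \<in> G) sequentially"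
    using lim G by (auto simp: limitin_def)
  obtain k where "line_energy (smoothing \<rho> (e k)) < ennreal b" "distr (smoothing \<rho> (e k)) (restrict_space borel S) proj \<in> G"
    using eventually_happens[OF eventually_conj[OF ev1 ev2]] by auto
  then show ?thesis using sm[OF e] by blast
qed

section \<open>The large deviation principle\<close>

context beta_ensemble
begin

lemma empirical_mass_lower:
  assumes G: "openin (weak_topology S) G" "\<mu> \<in> G" and a: "K.log_energy \<mu> < ereal a"
  shows "eventually (\<lambda>n. ennreal (exp (- a * (real n)\<^sup>2)) \<le> empirical_mass \<beta> \<gamma> (wn n) n (p n) G) sequentially"
proof -
  have \<mu>: "\<mu> \<in> borel_prob_measures S" using openin_subset[OF G(1)] G(2) by auto
  have "ereal (- Bd) < ereal a" using K.log_energy_ge[OF \<mu>] a by (rule le_less_trans)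
  then have a0: "0 \<le> a + Bd" by simp
  have "K.shifted_energy \<mu> < ennreal (a + Bd)" using a log_energy_less_iff[OF \<mu> a0] by simp
  from restriction_to_regular_compact[OF \<mu> G this] obtain \<rho> K where \<rho>: "real_distribution \<rho>" "compact K" "K \<subseteq> regular_points"
    "AE x in \<rho>. x \<in> K" "distr \<rho> (restrict_space borel S) proj \<in> G" "line_energy \<rho> < ennreal (a + Bd)" by blast
  from smoothing_approximates[OF \<rho>(1-4) G(1) \<rho>(5,6)] obtain \<nu> K' C where
    \<nu>: "smooth_dist \<nu> K' C" "distr \<nu> (restrict_space borel S) proj \<in> G" "line_energy \<nu> < ennreal (a + Bd)" by blast
  note e = smooth_dist_energy[OF \<nu>(1)]
  have J: "- (\<beta> * \<kappa>\<^sup>2 / 2) * (\<integral>(x, y). ln \<bar>x ^ \<gamma> - y ^ \<gamma>\<bar> \<partial>(\<nu> \<Otimes>\<^sub>M \<nu>)) - \<kappa> * (\<integral>x. ln (w (proj x)) \<partial>\<nu>) < a"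
    using \<nu>(3) e(3) unfolding e(2) by (subst (asm) ennreal_less_iff) auto
  note A = \<nu>(1)[unfolded smooth_dist_def]
  show ?thesis
  proof (rule empirical_mass_lower_regular[where C = C and K = K', OF _ _ _ _ _ _ e(1) G(1) \<nu>(2) J])
    show "K' \<subseteq> S - zero_set S w" using A regular_points_subset by auto
  qed (use A in blast)+
qed

text \<open>A point mass at a regular point has finite energy once it is smoothed.\<close>

lemma finite_log_energy_exists:
  assumes "\<not> emeasure lborel S = 0"
  obtains \<mu> where "\<mu> \<in> borel_prob_measures S" "K.log_energy \<mu> < \<infinity>"
proof -
  have "S \<inter> regular_points \<noteq> {}"
  proof
    assume "S \<inter> regular_points = {}"
    then have "S = S - regular_points" by auto
    then have "finite S" using finite_irregular_points by metis
    then show False using assms emeasure_lborel_countable[OF countable_finite] by blast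
  qed
  then obtain x0 where x0: "x0 \<in> regular_points" by auto
  have \<rho>: "real_distribution (return borel x0)"
    by (simp add: real_distribution_def real_distribution_axioms_def prob_space_return)
  have "AE x in return borel x0. x \<in> {x0}" by (subst AE_return) auto
  from smoothing_regular[OF \<rho> _ _ this] x0
  obtain \<epsilon>0 K' where "0 < \<epsilon>0" and sm: "\<And>\<epsilon>. 0 < \<epsilon> \<Longrightarrow> \<epsilon> \<le> \<epsilon>0 \<Longrightarrow> smooth_dist (smoothing (return borel x0) \<epsilon>) K' (1 / \<epsilon>)"
    by (metis empty_subsetI finite.emptyI finite_imp_compact finite_insert insert_subset)
  then have s: "smooth_dist (smoothing (return borel x0) \<epsilon>0) K' (1 / \<epsilon>0)" by simp
  let ?\<nu> = "smoothing (return borel x0) \<epsilon>0"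
  let ?\<mu> = "distr ?\<nu> (restrict_space borel S) proj"
  have \<nu>: "real_distribution ?\<nu>" using s by (simp add: smooth_dist_def)
  have \<mu>: "?\<mu> \<in> borel_prob_measures S" by (rule from_line_prob[OF \<nu>]) auto
  have "K.shifted_energy ?\<mu> < \<infinity>" unfolding shifted_energy_from_line[OF \<nu>] smooth_dist_energy(2)[OF s] by simp
  then have "K.log_energy ?\<mu> < \<infinity>"
    unfolding K.log_energy_shifted[OF \<mu>] by (cases "K.shifted_energy ?\<mu>") auto
  with \<mu> that show ?thesis by blast
qed

lemma rate_function_eq_log_energy:
  assumes \<mu>: "\<mu> \<in> borel_prob_measures S"
  shows "rate_function \<beta> \<gamma> S \<kappa> w c \<mu> = K.log_energy \<mu> + c"
proof -
  have eq: "energy_kernel \<beta> \<gamma> S \<kappa> w x y = K.log_kernel x y" if xy: "x \<in> S" "y \<in> S" for x y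
  proof (cases "x ^ \<gamma> = y ^ \<gamma> \<or> {x, y} \<inter> zero_set S w \<noteq> {}")
    case True
    then have "E x y = 0" by (auto simp: ker_def zero_set_def)
    then show ?thesis using True by (simp add: energy_kernel_def K.log_kernel_def)
  next
    case False
    then have "x \<in> S - zero_set S w" "y \<in> S - zero_set S w" "x \<noteq> y" using xy by auto
    then show ?thesis using False ln_E[of x y] E_pos[of x y]
      by (simp add: energy_kernel_def K.log_kernel_def mult.commute mult.left_commute)
  qed
  have "ereal_integral (\<mu> \<Otimes>\<^sub>M \<mu>) (\<lambda>(x, y). energy_kernel \<beta> \<gamma> S \<kappa> w x y) = K.log_energy \<mu>"
  proof -
    have "(\<lambda>(x, y). energy_kernel \<beta> \<gamma> S \<kappa> w x y) z = (\<lambda>(x, y). K.log_kernel x y) z" if "z \<in> space (\<mu> \<Otimes>\<^sub>M \<mu>)" for z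
      using that eq by (cases z) (auto simp: space_pair_measure borel_prob_measuresD(3)[OF \<mu>])
    then show ?thesis unfolding K.log_energy_def ereal_integral_def
      by (intro arg_cong2[where f = minus] arg_cong[where f = enn2ereal] nn_integral_cong) simp_all
  qed
  then show ?thesis by (simp add: rate_function_def)
qed

lemma ln_ext_scaled:
  assumes "n \<ge> 1" "0 < x"
  shows "ereal (1 / (real n)\<^sup>2) * ln_ext x = ereal (ln x / (real n)\<^sup>2)"
  using assms by (simp add: ln_ext_def)

lemma ln_ext_scaled_le:
  assumes n: "n \<ge> 1" and x: "x \<le> exp (- r * (real n)\<^sup>2)"
  shows "ereal (1 / (real n)\<^sup>2) * ln_ext x \<le> ereal (- r)"
proof (cases "0 < x")
  case True
  have "ln x \<le> ln (exp (- r * (real n)\<^sup>2))" using x True by (subst ln_le_cancel_iff) auto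
  then have "ln x / (real n)\<^sup>2 \<le> - r" using n by (simp add: divide_le_eq)
  then show ?thesis unfolding ln_ext_scaled[OF n True] by simp
next
  case False
  then show ?thesis using n by (simp add: ln_ext_def)
qed

lemma ln_ext_scaled_ge:
  assumes n: "n \<ge> 1" and x: "exp (- r * (real n)\<^sup>2) \<le> x"
  shows "ereal (- r) \<le> ereal (1 / (real n)\<^sup>2) * ln_ext x"
proof -
  have x0: "0 < x" using x exp_gt_zero less_le_trans by blast
  have "ln (exp (- r * (real n)\<^sup>2)) \<le> ln x" using x x0 by (subst ln_le_cancel_iff) auto
  then have "- r \<le> ln x / (real n)\<^sup>2" using n by (simp add: le_divide_eq)
  then show ?thesis unfolding ln_ext_scaled[OF n x0] by simp
qed

text \<open>Applied to the set of all measures, the two bounds for masses squeeze \<open>Z n\<close> between \<open>exp (- (j0 + d)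
  n\<^sup>2)\<close> and \<open>exp (- (j0 - d) n\<^sup>2)\<close>, where \<open>j0\<close> is the infimum of the energy. Since masses are \<open>Z n\<close>
  times probabilities, the bounds for the probabilities follow.\<close>

lemma large_deviation_principle_of_mass:
  fixes Z :: "nat \<Rightarrow> real" and Ln :: "nat \<Rightarrow> real measure measure"
  assumes S0: "\<not> emeasure lborel S = 0"
    and Z: "\<And>n. n \<ge> 1 \<Longrightarrow> 0 < Z n"
    and ZM: "\<And>n. n \<ge> 1 \<Longrightarrow> ennreal (Z n) = empirical_mass \<beta> \<gamma> (wn n) n (p n) (borel_prob_measures S)"
    and Ln: "\<And>n. n \<ge> 1 \<Longrightarrow> prob_space (Ln n)" "\<And>n. n \<ge> 1 \<Longrightarrow> sets (Ln n) = sets (borel_of (weak_topology S))"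
    and law: "\<And>n A. n \<ge> 1 \<Longrightarrow> A \<in> sets (borel_of (weak_topology S)) \<Longrightarrow>
      empirical_mass \<beta> \<gamma> (wn n) n (p n) A = ennreal (Z n * measure (Ln n) A)"
  shows "\<exists>c. c < \<infinity> \<and> (\<lambda>n. ereal (1 / (real n)\<^sup>2) * ln_ext (Z n)) \<longlonglongrightarrow> c \<and>
    large_deviation_principle (weak_topology S) Ln (\<lambda>n. (real n)\<^sup>2) (rate_function \<beta> \<gamma> S \<kappa> w c)"
proof -
  let ?X = "weak_topology S" and ?M = "borel_prob_measures S"
  obtain \<mu>0 where \<mu>0: "\<mu>0 \<in> ?M" "K.log_energy \<mu>0 < \<infinity>" using finite_log_energy_exists[OF S0] .
  define J0 where "J0 = (INF \<mu>\<in>?M. K.log_energy \<mu>)"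
  have "J0 \<le> K.log_energy \<mu>0" unfolding J0_def using \<mu>0(1) by (rule INF_lower)
  then have "J0 < \<infinity>" using \<mu>0(2) by (rule le_less_trans)
  moreover have "ereal (- Bd) \<le> J0" unfolding J0_def by (rule INF_greatest) (rule K.log_energy_ge)
  ultimately obtain j0 where j0: "J0 = ereal j0" by (cases J0) auto
  have j0_le: "ereal j0 \<le> K.log_energy \<mu>" if "\<mu> \<in> ?M" for \<mu>
    unfolding j0[symmetric] J0_def using that by (rule INF_lower)
  have top: "openin ?X ?M" "closedin ?X ?M" using openin_topspace[of ?X] closedin_topspace[of ?X] by simp_all
  have Zup: "eventually (\<lambda>n. Z n \<le> exp (- (j0 - d) * (real n)\<^sup>2)) sequentially" if d: "d > 0" for d
  proof -
    have "eventually (\<lambda>n. empirical_mass \<beta> \<gamma> (wn n) n (p n) ?M \<le> ennreal (exp (- (j0 - d) * (real n)\<^sup>2))) sequentially"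
    proof (rule empirical_mass_upper[OF top(2)])
      show "j0 - d < j0 - d / 2" using d by simp
      fix \<mu> assume "\<mu> \<in> ?M"
      then show "ereal (j0 - d / 2) < K.log_energy \<mu>" using j0_le[of \<mu>] d by (intro less_le_trans[OF _ j0_le]) auto
    qed
    then show ?thesis using eventually_ge_at_top[of 1]
      by eventually_elim (simp add: ZM[symmetric] ennreal_le_iff)
  qed
  have Zlo: "eventually (\<lambda>n. exp (- (j0 + d) * (real n)\<^sup>2) \<le> Z n) sequentially" if d: "d > 0" for d
  proof -
    have "J0 < ereal (j0 + d)" using d j0 by simp
    then obtain \<mu> where \<mu>: "\<mu> \<in> ?M" "K.log_energy \<mu> < ereal (j0 + d)" unfolding J0_def INF_less_iff by blast
    have "eventually (\<lambda>n. ennreal (exp (- (j0 + d) * (real n)\<^sup>2)) \<le> empirical_mass \<beta> \<gamma> (wn n) n (p n) ?M) sequentially"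
      by (rule empirical_mass_lower[OF top(1) \<mu>])
    then show ?thesis using eventually_ge_at_top[of 1]
    proof eventually_elim
      case (elim n)
      then have "ennreal (exp (- (j0 + d) * (real n)\<^sup>2)) \<le> ennreal (Z n)" by (simp add: ZM)
      then show ?case using Z[OF elim(2)] by (subst (asm) ennreal_le_iff) auto
    qed
  qed
  have Zlim: "(\<lambda>n. ereal (1 / (real n)\<^sup>2) * ln_ext (Z n)) \<longlonglongrightarrow> ereal (- j0)"
  proof -
    have "(\<lambda>n. ln (Z n) / (real n)\<^sup>2) \<longlonglongrightarrow> - j0"
    proof (rule tendstoI)
      fix e :: real assume e: "e > 0"
      then have "e / 2 > 0" by simp
      from Zup[OF this] Zlo[OF this] eventually_ge_at_top[of 1]
      show "eventually (\<lambda>n. dist (ln (Z n) / (real n)\<^sup>2) (- j0) < e) sequentially"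
      proof eventually_elim
        case (elim n)
        have "ereal (ln (Z n) / (real n)\<^sup>2) \<le> ereal (- (j0 - e / 2))" "ereal (- (j0 + e / 2)) \<le> ereal (ln (Z n) / (real n)\<^sup>2)"
          using ln_ext_scaled_le[OF elim(3,1)] ln_ext_scaled_ge[OF elim(3,2)] unfolding ln_ext_scaled[OF elim(3) Z[OF elim(3)]] by simp_all
        then have "\<bar>ln (Z n) / (real n)\<^sup>2 + j0\<bar> \<le> e / 2" unfolding ereal_less_eq by linarith
        then show ?case using e by (simp add: dist_real_def)
      qed
    qed
    then have "(\<lambda>n. ereal (ln (Z n) / (real n)\<^sup>2)) \<longlonglongrightarrow> ereal (- j0)" by simp
    moreover have "eventually (\<lambda>n. ereal (ln (Z n) / (real n)\<^sup>2) = ereal (1 / (real n)\<^sup>2) * ln_ext (Z n)) sequentially"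
      using eventually_ge_at_top[of 1] by eventually_elim (simp only: ln_ext_scaled Z)
    ultimately show ?thesis by (rule Lim_transform_eventually)
  qed
  let ?I = "rate_function \<beta> \<gamma> S \<kappa> w (ereal (- j0))"
  have I: "?I \<mu> = K.log_energy \<mu> - ereal j0" if "\<mu> \<in> ?M" for \<mu>
    unfolding rate_function_eq_log_energy[OF that] by (simp add: minus_ereal_def)
  have I_gt: "ereal r < ?I \<mu> \<longleftrightarrow> ereal (r + j0) < K.log_energy \<mu>" if "\<mu> \<in> ?M" for \<mu> r
    unfolding I[OF that] by (cases "K.log_energy \<mu>") (auto simp: less_diff_eq)
  have I_lt: "?I \<mu> < ereal r \<longleftrightarrow> K.log_energy \<mu> < ereal (r + j0)" if "\<mu> \<in> ?M" for \<mu> r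
    unfolding I[OF that] by (cases "K.log_energy \<mu>") (auto simp: diff_less_eq)
  have I0: "0 \<le> ?I \<mu>" if "\<mu> \<in> ?M" for \<mu>
    using j0_le[OF that] unfolding I[OF that] by (cases "K.log_energy \<mu>") auto
  have good: "good_rate_function ?X ?I"
    unfolding good_rate_function_def
  proof (intro conjI allI impI ballI)
    show "0 \<le> ?I \<mu>" if "\<mu> \<in> topspace ?X" for \<mu> using I0 that by simp
    fix a :: ereal
    show "openin ?X {\<mu> \<in> topspace ?X. a < ?I \<mu>}"
    proof (cases a)
      case (real r)
      then have "{\<mu> \<in> topspace ?X. a < ?I \<mu>} = {\<mu> \<in> ?M. ereal (r + j0) < K.log_energy \<mu>}"
        using I_gt by auto
      then show ?thesis using K.openin_log_energy_greater by simp
    next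
      case MInf
      then have "{\<mu> \<in> topspace ?X. a < ?I \<mu>} = ?M"
        using I0 less_le_trans[of "-\<infinity>" "0::ereal"] by auto
      then show ?thesis using top by simp
    qed simp
  next
    fix L :: real
    have "{\<mu> \<in> topspace ?X. ?I \<mu> \<le> ereal L} = {\<mu> \<in> ?M. K.log_energy \<mu> \<le> ereal (L + j0)}"
      using I_gt by (auto simp: not_less[symmetric])
    then show "compactin ?X {\<mu> \<in> topspace ?X. ?I \<mu> \<le> ereal L}" using K.compactin_log_energy_le by simp
  qed
  have sets_open: "U \<in> sets (borel_of ?X)" if "openin ?X U" for U
  proof -
    have "{U. openin ?X U} \<subseteq> Pow (topspace ?X)" using openin_subset by blast
    then show ?thesis unfolding borel_of_def using that by (simp add: sets_measure_of sigma_sets.Basic)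
  qed
  have sets_closed: "A \<in> sets (borel_of ?X)" if "closedin ?X A" for A
  proof -
    have "{U. openin ?X U} \<subseteq> Pow (topspace ?X)" using openin_subset by blast
    then have "space (borel_of ?X) = topspace ?X" unfolding borel_of_def by (rule space_measure_of)
    moreover have "topspace ?X - A \<in> sets (borel_of ?X)" using that by (intro sets_open) (simp add: closedin_def)
    moreover have "A = topspace ?X - (topspace ?X - A)" using closedin_subset[OF that] by auto
    ultimately show ?thesis by (metis sets.compl_sets)
  qed
  have lower: "- (INF x\<in>G. ?I x) \<le> liminf (\<lambda>n. ereal (1 / (real n)\<^sup>2) * ln_ext (measure (Ln n) G))"
    if G: "openin ?X G" for G
  proof (rule ccontr)
    assume "\<not> ?thesis"
    then obtain s where s: "liminf (\<lambda>n. ereal (1 / (real n)\<^sup>2) * ln_ext (measure (Ln n) G)) < ereal s" "ereal s < - (INF x\<in>G. ?I x)"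
      using ereal_dense2[of "liminf (\<lambda>n. ereal (1 / (real n)\<^sup>2) * ln_ext (measure (Ln n) G))" "- (INF x\<in>G. ?I x)"] by (auto simp: not_le)
    have "(INF x\<in>G. ?I x) < ereal (- s)" using s(2) by (cases "(INF x\<in>G. ?I x)") auto
    then obtain \<mu> where \<mu>: "\<mu> \<in> G" "?I \<mu> < ereal (- s)" unfolding INF_less_iff by blast
    have \<mu>M: "\<mu> \<in> ?M" using openin_subset[OF G] \<mu>(1) by auto
    obtain r where r: "?I \<mu> < ereal r" "ereal r < ereal (- s)" using ereal_dense2[OF \<mu>(2)] by auto
    have d: "- s - r > 0" using r(2) by simp
    have "eventually (\<lambda>n. ennreal (exp (- (r + j0) * (real n)\<^sup>2)) \<le> empirical_mass \<beta> \<gamma> (wn n) n (p n) G) sequentially"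
      using r(1) I_lt[OF \<mu>M] by (intro empirical_mass_lower[OF G \<mu>(1)]) simp
    then have "eventually (\<lambda>n. ereal s \<le> ereal (1 / (real n)\<^sup>2) * ln_ext (measure (Ln n) G)) sequentially"
      using Zup[OF d] eventually_ge_at_top[of 1]
    proof eventually_elim
      case (elim n)
      let ?q = "measure (Ln n) G"
      have "ennreal (exp (- (r + j0) * (real n)\<^sup>2)) \<le> ennreal (Z n * ?q)" using elim law[OF elim(3) sets_open[OF G]] by simp
      then have "exp (- (r + j0) * (real n)\<^sup>2) \<le> Z n * ?q" using Z[OF elim(3)] by (subst (asm) ennreal_le_iff) auto
      also have "\<dots> \<le> exp (- (j0 - (- s - r)) * (real n)\<^sup>2) * ?q" using elim(2) by (intro mult_right_mono) auto
      finally have "exp (- (r + j0) * (real n)\<^sup>2) / exp (- (j0 - (- s - r)) * (real n)\<^sup>2) \<le> ?q" by (simp add: divide_le_eq mult.commute)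
      also have "exp (- (r + j0) * (real n)\<^sup>2) / exp (- (j0 - (- s - r)) * (real n)\<^sup>2) = exp (- (- s) * (real n)\<^sup>2)"
        unfolding exp_diff[symmetric] by (simp add: algebra_simps)
      finally show ?case using ln_ext_scaled_ge[OF elim(3), of "- s" ?q] by simp
    qed
    then have "ereal s \<le> liminf (\<lambda>n. ereal (1 / (real n)\<^sup>2) * ln_ext (measure (Ln n) G))" by (rule Liminf_bounded)
    then show False using s(1) by simp
  qed
  have upper: "limsup (\<lambda>n. ereal (1 / (real n)\<^sup>2) * ln_ext (measure (Ln n) A)) \<le> - (INF x\<in>A. ?I x)"
    if A: "closedin ?X A" for A
  proof (rule ccontr)
    assume "\<not> ?thesis"
    then obtain s where s: "ereal s < limsup (\<lambda>n. ereal (1 / (real n)\<^sup>2) * ln_ext (measure (Ln n) A))" "- (INF x\<in>A. ?I x) < ereal s"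
      using ereal_dense2[of "- (INF x\<in>A. ?I x)" "limsup (\<lambda>n. ereal (1 / (real n)\<^sup>2) * ln_ext (measure (Ln n) A))"] by (auto simp: not_le)
    have "ereal (- s) < (INF x\<in>A. ?I x)" using s(2) by (cases "(INF x\<in>A. ?I x)") auto
    then obtain r where r: "ereal (- s) < ereal r" "ereal r < (INF x\<in>A. ?I x)" using ereal_dense2 by blast
    define d where "d = (r + s) / 2"
    have d: "d > 0" using r(1) by (simp add: d_def)
    have "eventually (\<lambda>n. empirical_mass \<beta> \<gamma> (wn n) n (p n) A \<le> ennreal (exp (- (j0 - s + d) * (real n)\<^sup>2))) sequentially"
    proof (rule empirical_mass_upper[OF A])
      show "j0 - s + d < r + j0" using r(1) by (simp add: d_def field_simps)
      fix \<mu> assume \<mu>: "\<mu> \<in> A"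
      then have "\<mu> \<in> ?M" using closedin_subset[OF A] by auto
      moreover have "ereal r < ?I \<mu>" using r(2) INF_lower[OF \<mu>] by (rule less_le_trans)
      ultimately show "ereal (r + j0) < K.log_energy \<mu>" using I_gt by simp
    qed
    then have "eventually (\<lambda>n. ereal (1 / (real n)\<^sup>2) * ln_ext (measure (Ln n) A) \<le> ereal s) sequentially"
      using Zlo[OF d] eventually_ge_at_top[of 1]
    proof eventually_elim
      case (elim n)
      let ?q = "measure (Ln n) A"
      have "ennreal (Z n * ?q) \<le> ennreal (exp (- (j0 - s + d) * (real n)\<^sup>2))" using elim law[OF elim(3) sets_closed[OF A]] by simp
      then have "Z n * ?q \<le> exp (- (j0 - s + d) * (real n)\<^sup>2)" by (subst (asm) ennreal_le_iff) auto
      moreover have "exp (- (j0 + d) * (real n)\<^sup>2) * ?q \<le> Z n * ?q" using elim(2) by (intro mult_right_mono) auto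
      ultimately have "exp (- (j0 + d) * (real n)\<^sup>2) * ?q \<le> exp (- (j0 - s + d) * (real n)\<^sup>2)" by simp
      then have "?q \<le> exp (- (j0 - s + d) * (real n)\<^sup>2) / exp (- (j0 + d) * (real n)\<^sup>2)" by (simp add: le_divide_eq mult.commute)
      also have "\<dots> = exp (- (- s) * (real n)\<^sup>2)" unfolding exp_diff[symmetric] by (simp add: algebra_simps)
      finally show ?case using ln_ext_scaled_le[OF elim(3), of ?q "- s"] by simp
    qed
    then have "limsup (\<lambda>n. ereal (1 / (real n)\<^sup>2) * ln_ext (measure (Ln n) A)) \<le> ereal s" by (rule Limsup_bounded)
    then show False using s(1) by simp
  qed
  have "large_deviation_principle ?X Ln (\<lambda>n. (real n)\<^sup>2) ?I"
    unfolding large_deviation_principle_def using Ln good lower upper by blast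
  then show ?thesis using Zlim by (intro exI[of _ "ereal (- j0)"]) simp
qed

end

theorem theorem3p1:
  fixes \<beta> \<kappa> :: real and \<gamma> :: nat and S :: "real set"
    and wn :: "nat \<Rightarrow> real \<Rightarrow> real" and w :: "real \<Rightarrow> real" and p :: "nat \<Rightarrow> nat"
    and P :: "'a measure" and \<Lambda> :: "nat \<Rightarrow> 'a \<Rightarrow> nat \<Rightarrow> real"
    and Q :: "nat \<Rightarrow> (nat \<Rightarrow> real) measure"
  assumes beta: "\<beta> > 0" and gamma: "\<gamma> \<ge> 1"
    and S_interval: "is_interval S" "closed S"
    and S_even: "even \<gamma> \<Longrightarrow> S \<subseteq> {0..}"
    and wn_cont: "\<And>n. n \<ge> 1 \<Longrightarrow> continuous_on S (wn n)"
    and wn_nonneg: "\<And>n x. n \<ge> 1 \<Longrightarrow> x \<in> S \<Longrightarrow> wn n x \<ge> 0"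
    and p_pos: "\<And>n. n \<ge> 1 \<Longrightarrow> p n \<ge> 1"
    and p_top: "filterlim p at_top sequentially"
    and p_kappa: "(\<lambda>n. real (p n) / real n) \<longlonglongrightarrow> \<kappa>" and kappa: "\<kappa> > 0"
    and prob: "prob_space P"
    and Lambda_meas:
      "\<And>n. n \<ge> 1 \<Longrightarrow> \<Lambda> n \<in> measurable P (\<Pi>\<^sub>M j\<in>{1..p n}. restrict_space borel S)"
    and Lambda_density:
      "\<And>n. n \<ge> 1 \<Longrightarrow> distributed P (\<Pi>\<^sub>M j\<in>{1..p n}. lborel) (\<Lambda> n)
         (\<lambda>x. ennreal (ensemble_density \<beta> \<gamma> S (wn n) n (p n) x))"
    and Q_def: "\<And>n. n \<ge> 1 \<Longrightarrow> Q n = distr P (\<Pi>\<^sub>M j\<in>{1..p n}. restrict_space borel S) (\<Lambda> n)"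
    and a1_w: "continuous_on S w" "\<And>x. x \<in> S \<Longrightarrow> w x \<ge> 0"
    and a1_zeros: "finite (zero_set S w)"
      "eventually (\<lambda>n. zero_set S (wn n) \<subseteq> zero_set S w) sequentially"
    and a1_conv: "\<And>K. compact K \<Longrightarrow> K \<subseteq> S \<Longrightarrow> uniform_limit K wn w sequentially"
    and a1_log_conv: "\<And>K. compact K \<Longrightarrow> K \<subseteq> S - zero_set S w \<Longrightarrow>
      uniform_limit K (\<lambda>n x. ln (wn n x)) (\<lambda>x. ln (w x)) sequentially"
    and a1_log_lipschitz: "\<And>K. compact K \<Longrightarrow> K \<subseteq> S - zero_set S w \<Longrightarrow>
      \<exists>C. C-lipschitz_on K (\<lambda>x. ln (w x))"
    and a2: "\<not> bounded S \<Longrightarrow> \<exists>n0\<ge>1. \<exists>\<epsilon>>0.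
      ((\<lambda>x. ennreal (\<bar>x\<bar> powr (real \<gamma> * \<kappa> * max \<beta> 1 + \<epsilon>)) * (SUP n\<in>{n0..}. ennreal (wn n x)))
         \<longlongrightarrow> 0) (inf at_infinity (principal S))"
  shows "(\<forall>n\<ge>1. distr P (borel_of (weak_topology S)) (\<lambda>\<omega>. empirical_measure S (p n) (\<Lambda> n \<omega>))
            = distr (Q n) (borel_of (weak_topology S)) (empirical_measure S (p n))) \<and>
         (\<exists>c::ereal. c < \<infinity> \<and>
            (\<lambda>n. ereal (1 / (real n)\<^sup>2) * ln_ext (ensemble_Z \<beta> \<gamma> S (wn n) n (p n)))
              \<longlonglongrightarrow> c \<and>
            large_deviation_principle (weak_topology S)
              (\<lambda>n. distr (Q n) (borel_of (weak_topology S)) (empirical_measure S (p n)))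
              (\<lambda>n. (real n)\<^sup>2) (rate_function \<beta> \<gamma> S \<kappa> w c))"
proof -
  have "S \<noteq> {}"
  proof -
    obtain \<omega> where "\<omega> \<in> space P" using prob_space.not_empty[OF prob] by blast
    then have "\<Lambda> 1 \<omega> \<in> space (\<Pi>\<^sub>M j\<in>{1..p 1}. restrict_space borel S)"
      by (rule measurable_space[OF Lambda_meas[OF order_refl]])
    then have "\<Lambda> 1 \<omega> 1 \<in> S" using p_pos[of 1] unfolding space_PiM by (auto simp: space_restrict_space dest!: PiE_mem[where x = 1])
    then show ?thesis by blast
  qed
  then interpret closed_real_interval S
    using S_interval by unfold_locales (auto simp: is_interval_convex_1)
  interpret beta_ensemble S \<beta> \<kappa> \<gamma> wn w p
    by unfold_locales (fact beta gamma kappa S_even wn_cont wn_nonneg p_top p_kappa a1_w a1_zeros a1_conv a1_log_conv a2)+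
  have em: "empirical_measure S (p n) \<in> (\<Pi>\<^sub>M j\<in>{1..p n}. restrict_space borel S) \<rightarrow>\<^sub>M borel_of (weak_topology S)" if "n \<ge> 1" for n
    by (rule measurable_empirical_measure[OF p_pos[OF that]])
  have "distr P (borel_of (weak_topology S)) (\<lambda>\<omega>. empirical_measure S (p n) (\<Lambda> n \<omega>))
            = distr (Q n) (borel_of (weak_topology S)) (empirical_measure S (p n))" if n: "n \<ge> 1" for n
    unfolding Q_def[OF n] using distr_distr[OF em[OF n] Lambda_meas[OF n]] by (simp add: o_def)
  moreover have "\<exists>c. c < \<infinity> \<and> (\<lambda>n. ereal (1 / (real n)\<^sup>2) * ln_ext (ensemble_Z \<beta> \<gamma> S (wn n) n (p n))) \<longlonglongrightarrow> c \<and>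
    large_deviation_principle (weak_topology S) (\<lambda>n. distr (Q n) (borel_of (weak_topology S)) (empirical_measure S (p n)))
      (\<lambda>n. (real n)\<^sup>2) (rate_function \<beta> \<gamma> S \<kappa> w c)"
  proof (rule large_deviation_principle_of_mass)
    show "\<not> emeasure lborel S = 0"
      by (rule nondegenerate[OF wn_cont[OF order_refl] wn_nonneg[OF order_refl] p_pos[OF order_refl] prob
            Lambda_meas[OF order_refl] Lambda_density[OF order_refl]])
    fix n :: nat assume n: "n \<ge> 1"
    note f = wn_cont[OF n] wn_nonneg[OF n] p_pos[OF n] prob Lambda_meas[OF n] Lambda_density[OF n]
    show "0 < ensemble_Z \<beta> \<gamma> S (wn n) n (p n)" by (rule ensemble_Z_pos[OF f])
    show "ennreal (ensemble_Z \<beta> \<gamma> S (wn n) n (p n)) = empirical_mass \<beta> \<gamma> (wn n) n (p n) (borel_prob_measures S)"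
      by (rule ensemble_Z_eq_mass[OF f])
    show "prob_space (distr (Q n) (borel_of (weak_topology S)) (empirical_measure S (p n)))"
      unfolding Q_def[OF n] using prob_space.prob_space_distr[OF prob_space.prob_space_distr[OF prob Lambda_meas[OF n]]] em[OF n]
      by simp
    show "empirical_mass \<beta> \<gamma> (wn n) n (p n) A = ennreal (ensemble_Z \<beta> \<gamma> S (wn n) n (p n) *
        measure (distr (Q n) (borel_of (weak_topology S)) (empirical_measure S (p n))) A)"
      if "A \<in> sets (borel_of (weak_topology S))" for A
      unfolding Q_def[OF n] by (rule empirical_law[OF f that])
  qed simp
  ultimately show ?thesis by blast
qed

end
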